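(* Let $\mathcal B$ be a finitely semisimple ribbon $\Bbbk$-category whose simple objects are scalar, with $\Lambda$, the coend $(B,j)$ and $(e_\lambda)_{\lambda\in\Lambda}$ as in the context. Let $\mathcal D$ be a full ribbon and abelian subcategory of $\mathcal B$. Let $\Lambda_{\mathcal D}$ be a (finite) set of representatives of isomorphism classes of simple objects of $\mathcal D$, chosen so that $\Lambda_{\mathcal D}\subset\Lambda$. Then $$\sum_{\lambda\in\Lambda_{\mathcal D}}\dim_q(\lambda)\,e_\lambda\in\mathcal I(\mathcal B).$$
   Context: **Ribbon $\Bbbk$-categories.** $\Bbbk$ is a field. Monoidal categories are taken strict. A ribbon category is a monoidal category with unit $\mathbf 1$, a left duality ($X^*$, $\mathrm{ev}_X:X^*\otimes X\to\mathbf 1$, $\mathrm{coev}_X:\mathbf 1\to X\otimes X^*$; $\mathbf 1^*=\mathbf 1$), a braiding $c_{X,Y}$, and a twist $\theta_X$ (natural isomorphisms with $\theta_{X\otimes Y}=c_{Y,X}c_{X,Y}(\theta_X\otimes\theta_Y)$ and $\theta_{X^*}=(\theta_X)^*$). A ribbon $\Bbbk$-category is a ribbon category whose Hom-sets are $\Bbbk$-vector spaces, with bilinear composition and tensor product, and with $\mathrm{End}(\mathbf 1)=\Bbbk$. Put $\widetilde{\mathrm{ev}}_X=\mathrm{ev}_X c_{X,X^*}(\theta_X\otimes\mathrm{id}_{X^*})$, $\widetilde{\mathrm{coev}}_X=(\mathrm{id}_{X^*}\otimes\theta_X^{-1})(c_{X^*,X})^{-1}\mathrm{coev}_X$, $\mathrm{tr}_q(f)=\widetilde{\mathrm{ev}}_X(f\otimes\mathrm{id}_{X^*})\mathrm{coev}_X\in\Bbbk$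 for $f\in\mathrm{End}(X)$, $\dim_q(X)=\mathrm{tr}_q(\mathrm{id}_X)$. A morphism $f:X\to Y$ is negligible if $\mathrm{tr}_q(gf)=0$ for all $g:Y\to X$. A full ribbon and abelian subcategory is a full subcategory containing $\mathbf 1$, closed under tensor product and duality, and which is abelian. **Coend and $\mathcal I$.** For a ribbon $\Bbbk$-category with a coend $(A,i)$ of $(X,Y)\mapsto X^*\otimes Y$ (universal dinatural family $i_X:X^*\otimes X\to A$), $A$ is a Hopf algebra with: $\Delta_A i_X=(i_X\otimes i_X)(\mathrm{id}\otimes\mathrm{coev}_X\otimes\mathrm{id})$; $\varepsilon_A i_X=\mathrm{ev}_X$; $\eta_A=i_{\mathbf 1}$; $m_A(i_X\otimes i_Y)=i_{Y\otimes X}(\gamma_{X,Y}\otimes\mathrm{id}_{Y\otimes X})(\mathrm{id}_{X^*}\otimes c_{X,Y^*\otimes Y})$ with $\gamma_{X,Y}:X^*\otimes Y^*\to(Y\otimes X)^*$ canonical; $S_A i_X=i_{X^*}(\beta_X\otimes\theta_{X^*})c_{X^*,X}$ with $\beta_X=(\widetilde{\mathrm{ev}}_X\otimes\mathrm{id}_{X^{**}})(\mathrm{id}_X\otimes\mathrm{coev}_{X^*})$. With $\Gamma_l=(\mathrm{id}_A\otimes m_A)(\Delta_A\otimes\mathrm{id}_A)$, $\mathcal I(\mathcal C)$ is the set of $\alpha\in\mathrm{Hom}(\mathbf 1,A)$ such that $S_A\alpha-\alpha$ and $\Gamma_l(\alpha\otimes\alpha)-\alpha\otimes\alpha$ are negligible.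 (In a semisimple ribbon $\Bbbk$-category negligible morphisms are zero, so these conditions read $S_A\alpha=\alpha$, $\Gamma_l(\alpha\otimes\alpha)=\alpha\otimes\alpha$.) **Finitely semisimple case.** A $\Bbbk$-category is finitely semisimple if it is abelian, every object is a finite direct sum of simple objects, and there are finitely many isomorphism classes of simple objects. An object $X$ is scalar if $\mathrm{End}(X)=\Bbbk$. $\Lambda$ is a (finite) set of representatives of isomorphism classes of simple objects of $\mathcal B$ with $\mathbf 1\in\Lambda$. $B=\bigoplus_{\lambda\in\Lambda}\lambda^*\otimes\lambda$ with projections $p_\lambda:B\to\lambda^*\otimes\lambda$ and injections $q_\lambda:\lambda^*\otimes\lambda\to B$. For an object $X\simeq\bigoplus_{k\in I}\lambda_k$ with projections $p_k:X\to\lambda_k$ and injections $q_k:\lambda_k\to X$ ($\lambda_k\in\Lambda$), set $j_X=\sum_k q_{\lambda_k}(q_k^*\otimes p_k):X^*\otimes X\to B$. Then $(B,j)$ is a coend of $(X,Y)\mapsto X^*\otimes Y$, $j_\lambda=q_\lambda$. Set $e_\lambda=j_\lambda\widetilde{\mathrm{coev}}_\lambda:\mathbf 1\to B$; these form a basis of $\mathrm{Hom}_{\mathcal B}(\mathbf 1,B)$. *)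

theory Defs
  imports "HOL-Algebra.Module"
begin

section \<open>Categories\<close>

text \<open>
  All categories are small, with a set of objects and a set of arrows; every arrow carries
  its source and target. Fields of the records are only meaningful on these carriers.
  \<open>K\<close> is the ground field throughout.
\<close>

record ('o, 'm) category =
  Obj :: "'o set"
  Arr :: "'m set"
  Dom :: "'m \<Rightarrow> 'o"
  Cod :: "'m \<Rightarrow> 'o"
  Ide :: "'o \<Rightarrow> 'm"
  Comp :: "'m \<Rightarrow> 'm \<Rightarrow> 'm" (infixl \<open>\<cdot>\<index>\<close> 65)

definition Hom :: "('o, 'm, 'z) category_scheme \<Rightarrow> 'o \<Rightarrow> 'o \<Rightarrow> 'm set" where
  "Hom C X Y = {f \<in> Arr C. Dom C f = X \<and> Cod C f = Y}"

locale category =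
  fixes C :: "('o, 'm, 'z) category_scheme" (structure)
  assumes Dom_Obj: "f \<in> Arr C \<Longrightarrow> Dom C f \<in> Obj C"
    and Cod_Obj: "f \<in> Arr C \<Longrightarrow> Cod C f \<in> Obj C"
    and Ide_Hom: "X \<in> Obj C \<Longrightarrow> Ide C X \<in> Hom C X X"
    and Comp_Hom: "\<lbrakk>f \<in> Hom C X Y; g \<in> Hom C Y Z\<rbrakk> \<Longrightarrow> g \<cdot> f \<in> Hom C X Z"
    and Ide_left: "f \<in> Hom C X Y \<Longrightarrow> Ide C Y \<cdot> f = f"
    and Ide_right: "f \<in> Hom C X Y \<Longrightarrow> f \<cdot> Ide C X = f"
    and Comp_assoc:
      "\<lbrakk>f \<in> Hom C W X; g \<in> Hom C X Y; h \<in> Hom C Y Z\<rbrakk> \<Longrightarrow> (h \<cdot> g) \<cdot> f = h \<cdot> (g \<cdot> f)"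

definition inverse_arrows :: "('o, 'm, 'z) category_scheme \<Rightarrow> 'm \<Rightarrow> 'm \<Rightarrow> bool" where
  "inverse_arrows C f g \<longleftrightarrow>
     f \<in> Arr C \<and> g \<in> Hom C (Cod C f) (Dom C f) \<and>
     g \<cdot>\<^bsub>C\<^esub> f = Ide C (Dom C f) \<and> f \<cdot>\<^bsub>C\<^esub> g = Ide C (Cod C f)"

definition iso_arrow :: "('o, 'm, 'z) category_scheme \<Rightarrow> 'm \<Rightarrow> bool" where
  "iso_arrow C f \<longleftrightarrow> (\<exists>g. inverse_arrows C f g)"

definition inverse_of :: "('o, 'm, 'z) category_scheme \<Rightarrow> 'm \<Rightarrow> 'm" where
  "inverse_of C f = (THE g. inverse_arrows C f g)"

definition isomorphic :: "('o, 'm, 'z) category_scheme \<Rightarrow> 'o \<Rightarrow> 'o \<Rightarrow> bool" where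
  "isomorphic C X Y \<longleftrightarrow> (\<exists>f \<in> Hom C X Y. iso_arrow C f)"

definition mono_arrow :: "('o, 'm, 'z) category_scheme \<Rightarrow> 'm \<Rightarrow> bool" where
  "mono_arrow C f \<longleftrightarrow> f \<in> Arr C \<and>
     (\<forall>W. \<forall>g \<in> Hom C W (Dom C f). \<forall>h \<in> Hom C W (Dom C f). f \<cdot>\<^bsub>C\<^esub> g = f \<cdot>\<^bsub>C\<^esub> h \<longrightarrow> g = h)"

definition epi_arrow :: "('o, 'm, 'z) category_scheme \<Rightarrow> 'm \<Rightarrow> bool" where
  "epi_arrow C f \<longleftrightarrow> f \<in> Arr C \<and>
     (\<forall>W. \<forall>g \<in> Hom C (Cod C f) W. \<forall>h \<in> Hom C (Cod C f) W. g \<cdot>\<^bsub>C\<^esub> f = h \<cdot>\<^bsub>C\<^esub> f \<longrightarrow> g = h)"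

definition zero_object :: "('o, 'm, 'z) category_scheme \<Rightarrow> 'o \<Rightarrow> bool" where
  "zero_object C X \<longleftrightarrow> X \<in> Obj C \<and>
     (\<forall>Y \<in> Obj C. (\<exists>!f. f \<in> Hom C X Y) \<and> (\<exists>!f. f \<in> Hom C Y X))"

definition simple_object :: "('o, 'm, 'z) category_scheme \<Rightarrow> 'o \<Rightarrow> bool" where
  "simple_object C X \<longleftrightarrow> X \<in> Obj C \<and> \<not> zero_object C X \<and>
     (\<forall>f. mono_arrow C f \<and> Cod C f = X \<longrightarrow> zero_object C (Dom C f) \<or> iso_arrow C f)"

definition simple_representatives :: "('o, 'm, 'z) category_scheme \<Rightarrow> 'o set \<Rightarrow> bool" where
  "simple_representatives C L \<longleftrightarrow>
     (\<forall>l \<in> L. simple_object C l) \<and>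
     (\<forall>X. simple_object C X \<longrightarrow> (\<exists>!l. l \<in> L \<and> isomorphic C X l))"

definition full_subcategory ::
  "('o, 'm, 'z) category_scheme \<Rightarrow> 'o set \<Rightarrow> ('o, 'm, 'z) category_scheme" where
  "full_subcategory C D =
     C\<lparr>Obj := D, Arr := {f \<in> Arr C. Dom C f \<in> D \<and> Cod C f \<in> D}\<rparr>"


section \<open>Linear and abelian categories\<close>

record ('k, 'o, 'm) linear_category = "('o, 'm) category" +
  arr_zero :: "'o \<Rightarrow> 'o \<Rightarrow> 'm"
  arr_add :: "'m \<Rightarrow> 'm \<Rightarrow> 'm" (infixl \<open>\<oplus>\<^sub>m\<index>\<close> 60)
  arr_smult :: "'k \<Rightarrow> 'm \<Rightarrow> 'm" (infixr \<open>\<odot>\<^sub>m\<index>\<close> 75)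

text \<open>
  Hom-sets as modules in the sense of the algebra library, whose module records extend ring
  records: the fields \<open>mult\<close> and \<open>one\<close> are irrelevant for the locale \<^locale>\<open>module\<close>.
\<close>

definition Hom_module ::
  "('k, 'o, 'm, 'z) linear_category_scheme \<Rightarrow> 'o \<Rightarrow> 'o \<Rightarrow> ('k, 'm) module" where
  "Hom_module C X Y =
     \<lparr>carrier = Hom C X Y, mult = (\<lambda>_ _. undefined), one = undefined,
      zero = arr_zero C X Y, add = arr_add C, smult = arr_smult C\<rparr>"

locale k_category = category C + field K
  for K :: "('k, 'r) ring_scheme" and C :: "('k, 'o, 'm, 'z) linear_category_scheme" (structure) +
  assumes Hom_vector_space:
      "\<lbrakk>X \<in> Obj C; Y \<in> Obj C\<rbrakk> \<Longrightarrow> module K (Hom_module C X Y)"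
    and Comp_add_left:
      "\<lbrakk>f \<in> Hom C X Y; g \<in> Hom C Y Z; g' \<in> Hom C Y Z\<rbrakk> \<Longrightarrow> (g \<oplus>\<^sub>m g') \<cdot> f = g \<cdot> f \<oplus>\<^sub>m g' \<cdot> f"
    and Comp_add_right:
      "\<lbrakk>f \<in> Hom C X Y; f' \<in> Hom C X Y; g \<in> Hom C Y Z\<rbrakk> \<Longrightarrow> g \<cdot> (f \<oplus>\<^sub>m f') = g \<cdot> f \<oplus>\<^sub>m g \<cdot> f'"
    and Comp_smult_left:
      "\<lbrakk>a \<in> carrier K; f \<in> Hom C X Y; g \<in> Hom C Y Z\<rbrakk> \<Longrightarrow> (a \<odot>\<^sub>m g) \<cdot> f = a \<odot>\<^sub>m (g \<cdot> f)"
    and Comp_smult_right: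
      "\<lbrakk>a \<in> carrier K; f \<in> Hom C X Y; g \<in> Hom C Y Z\<rbrakk> \<Longrightarrow> g \<cdot> (a \<odot>\<^sub>m f) = a \<odot>\<^sub>m (g \<cdot> f)"

text \<open>\<open>End(X) = K\<close>, via \<open>a \<mapsto> a id\<^sub>X\<close>.\<close>

definition scalar_object ::
  "('k, 'r) ring_scheme \<Rightarrow> ('k, 'o, 'm, 'z) linear_category_scheme \<Rightarrow> 'o \<Rightarrow> bool" where
  "scalar_object K C X \<longleftrightarrow> X \<in> Obj C \<and>
     bij_betw (\<lambda>a. a \<odot>\<^sub>m\<^bsub>C\<^esub> Ide C X) (carrier K) (Hom C X X)"

text \<open>\<open>S\<close> is the direct sum of the finite family \<open>(X k)\<^sub>k\<close>, with projections \<open>p\<close> and injections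
  \<open>q\<close>. For empty \<open>I\<close> this says that \<open>S\<close> is a zero object.\<close>

definition direct_sum ::
  "('k, 'o, 'm, 'z) linear_category_scheme \<Rightarrow> 'i set \<Rightarrow> ('i \<Rightarrow> 'o) \<Rightarrow> 'o
     \<Rightarrow> ('i \<Rightarrow> 'm) \<Rightarrow> ('i \<Rightarrow> 'm) \<Rightarrow> bool" where
  "direct_sum C I X S p q \<longleftrightarrow>
     finite I \<and> S \<in> Obj C \<and>
     (\<forall>k \<in> I. X k \<in> Obj C \<and> p k \<in> Hom C S (X k) \<and> q k \<in> Hom C (X k) S) \<and>
     (\<forall>k \<in> I. \<forall>l \<in> I.
        p k \<cdot>\<^bsub>C\<^esub> q l = (if k = l then Ide C (X k) else arr_zero C (X l) (X k))) \<and>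
     (\<Oplus>\<^bsub>Hom_module C S S\<^esub>k \<in> I. q k \<cdot>\<^bsub>C\<^esub> p k) = Ide C S"

definition kernel_of :: "('k, 'o, 'm, 'z) linear_category_scheme \<Rightarrow> 'm \<Rightarrow> 'm \<Rightarrow> bool" where
  "kernel_of C f i \<longleftrightarrow>
     f \<in> Arr C \<and> i \<in> Arr C \<and> Cod C i = Dom C f \<and>
     f \<cdot>\<^bsub>C\<^esub> i = arr_zero C (Dom C i) (Cod C f) \<and>
     (\<forall>W. \<forall>h \<in> Hom C W (Dom C f). f \<cdot>\<^bsub>C\<^esub> h = arr_zero C W (Cod C f) \<longrightarrow>
        (\<exists>!u. u \<in> Hom C W (Dom C i) \<and> i \<cdot>\<^bsub>C\<^esub> u = h))"

definition cokernel_of :: "('k, 'o, 'm, 'z) linear_category_scheme \<Rightarrow> 'm \<Rightarrow> 'm \<Rightarrow> bool" where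
  "cokernel_of C f p \<longleftrightarrow>
     f \<in> Arr C \<and> p \<in> Arr C \<and> Dom C p = Cod C f \<and>
     p \<cdot>\<^bsub>C\<^esub> f = arr_zero C (Dom C f) (Cod C p) \<and>
     (\<forall>W. \<forall>h \<in> Hom C (Cod C f) W. h \<cdot>\<^bsub>C\<^esub> f = arr_zero C (Dom C f) W \<longrightarrow>
        (\<exists>!u. u \<in> Hom C (Cod C p) W \<and> u \<cdot>\<^bsub>C\<^esub> p = h))"

locale abelian_k_category = k_category +
  assumes direct_sums:
      "(\<And>k. k < (n::nat) \<Longrightarrow> X k \<in> Obj C) \<Longrightarrow> \<exists>S p q. direct_sum C {..<n} X S p q"
    and kernels: "f \<in> Arr C \<Longrightarrow> \<exists>i. kernel_of C f i"
    and cokernels: "f \<in> Arr C \<Longrightarrow> \<exists>p. cokernel_of C f p"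
    and monos_normal: "mono_arrow C i \<Longrightarrow> \<exists>f. kernel_of C f i"
    and epis_normal: "epi_arrow C p \<Longrightarrow> \<exists>f. cokernel_of C f p"

locale finitely_semisimple_k_category = abelian_k_category +
  assumes semisimple:
      "X \<in> Obj C \<Longrightarrow> \<exists>(n::nat) S p q. (\<forall>k < n. simple_object C (S k)) \<and> direct_sum C {..<n} S X p q"
    and finitely_many_simples:
      "finite ({X. simple_object C X} // {(X, Y). isomorphic C X Y})"


section \<open>Strict ribbon categories\<close>

record ('k, 'o, 'm) ribbon_category = "('k, 'o, 'm) linear_category" +
  tunit :: "'o" (\<open>\<bbbone>\<index>\<close>)
  tensor_obj :: "'o \<Rightarrow> 'o \<Rightarrow> 'o" (infixl \<open>\<otimes>\<^sub>o\<index>\<close> 70)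
  tensor_arr :: "'m \<Rightarrow> 'm \<Rightarrow> 'm" (infixl \<open>\<otimes>\<^sub>m\<index>\<close> 70)
  dual_obj :: "'o \<Rightarrow> 'o"
  ev :: "'o \<Rightarrow> 'm"
  coev :: "'o \<Rightarrow> 'm"
  braid :: "'o \<Rightarrow> 'o \<Rightarrow> 'm"
  twist :: "'o \<Rightarrow> 'm"

definition dual_arr :: "('k, 'o, 'm, 'z) ribbon_category_scheme \<Rightarrow> 'm \<Rightarrow> 'm" where
  "dual_arr C f =
     (let X = Dom C f; Y = Cod C f; X' = Ide C (dual_obj C X); Y' = Ide C (dual_obj C Y)
      in (ev C Y \<otimes>\<^sub>m\<^bsub>C\<^esub> X') \<cdot>\<^bsub>C\<^esub> (Y' \<otimes>\<^sub>m\<^bsub>C\<^esub> f \<otimes>\<^sub>m\<^bsub>C\<^esub> X') \<cdot>\<^bsub>C\<^esub> (Y' \<otimes>\<^sub>m\<^bsub>C\<^esub> coev C X))"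

locale strict_monoidal_category = category C
  for C :: "('k, 'o, 'm, 'z) ribbon_category_scheme" (structure) +
  assumes tunit_Obj: "\<bbbone> \<in> Obj C"
    and tensor_Obj: "\<lbrakk>X \<in> Obj C; Y \<in> Obj C\<rbrakk> \<Longrightarrow> X \<otimes>\<^sub>o Y \<in> Obj C"
    and tensor_Hom:
      "\<lbrakk>f \<in> Hom C X Y; g \<in> Hom C X' Y'\<rbrakk> \<Longrightarrow> f \<otimes>\<^sub>m g \<in> Hom C (X \<otimes>\<^sub>o X') (Y \<otimes>\<^sub>o Y')"
    and tensor_Ide: "\<lbrakk>X \<in> Obj C; Y \<in> Obj C\<rbrakk> \<Longrightarrow> Ide C X \<otimes>\<^sub>m Ide C Y = Ide C (X \<otimes>\<^sub>o Y)"
    and tensor_Comp: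
      "\<lbrakk>f \<in> Hom C X Y; g \<in> Hom C Y Z; f' \<in> Hom C X' Y'; g' \<in> Hom C Y' Z'\<rbrakk>
       \<Longrightarrow> (g \<cdot> f) \<otimes>\<^sub>m (g' \<cdot> f') = (g \<otimes>\<^sub>m g') \<cdot> (f \<otimes>\<^sub>m f')"
    and tensor_obj_assoc:
      "\<lbrakk>X \<in> Obj C; Y \<in> Obj C; Z \<in> Obj C\<rbrakk> \<Longrightarrow> (X \<otimes>\<^sub>o Y) \<otimes>\<^sub>o Z = X \<otimes>\<^sub>o (Y \<otimes>\<^sub>o Z)"
    and tensor_arr_assoc:
      "\<lbrakk>f \<in> Arr C; g \<in> Arr C; h \<in> Arr C\<rbrakk> \<Longrightarrow> (f \<otimes>\<^sub>m g) \<otimes>\<^sub>m h = f \<otimes>\<^sub>m (g \<otimes>\<^sub>m h)"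
    and tunit_obj_left: "X \<in> Obj C \<Longrightarrow> \<bbbone> \<otimes>\<^sub>o X = X"
    and tunit_obj_right: "X \<in> Obj C \<Longrightarrow> X \<otimes>\<^sub>o \<bbbone> = X"
    and tunit_arr_left: "f \<in> Arr C \<Longrightarrow> Ide C \<bbbone> \<otimes>\<^sub>m f = f"
    and tunit_arr_right: "f \<in> Arr C \<Longrightarrow> f \<otimes>\<^sub>m Ide C \<bbbone> = f"

locale ribbon_category = strict_monoidal_category +
  assumes dual_Obj: "X \<in> Obj C \<Longrightarrow> dual_obj C X \<in> Obj C"
    and dual_tunit: "dual_obj C \<bbbone> = \<bbbone>"
    and ev_Hom: "X \<in> Obj C \<Longrightarrow> ev C X \<in> Hom C (dual_obj C X \<otimes>\<^sub>o X) \<bbbone>"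
    and coev_Hom: "X \<in> Obj C \<Longrightarrow> coev C X \<in> Hom C \<bbbone> (X \<otimes>\<^sub>o dual_obj C X)"
    and zigzag:
      "X \<in> Obj C \<Longrightarrow> (Ide C X \<otimes>\<^sub>m ev C X) \<cdot> (coev C X \<otimes>\<^sub>m Ide C X) = Ide C X"
    and zigzag_dual:
      "X \<in> Obj C \<Longrightarrow> (ev C X \<otimes>\<^sub>m Ide C (dual_obj C X)) \<cdot> (Ide C (dual_obj C X) \<otimes>\<^sub>m coev C X)
         = Ide C (dual_obj C X)"
    and braid_Hom: "\<lbrakk>X \<in> Obj C; Y \<in> Obj C\<rbrakk> \<Longrightarrow> braid C X Y \<in> Hom C (X \<otimes>\<^sub>o Y) (Y \<otimes>\<^sub>o X)"
    and braid_iso: "\<lbrakk>X \<in> Obj C; Y \<in> Obj C\<rbrakk> \<Longrightarrow> iso_arrow C (braid C X Y)"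
    and braid_natural:
      "\<lbrakk>f \<in> Hom C X X'; g \<in> Hom C Y Y'\<rbrakk>
       \<Longrightarrow> braid C X' Y' \<cdot> (f \<otimes>\<^sub>m g) = (g \<otimes>\<^sub>m f) \<cdot> braid C X Y"
    and braid_tensor_right:
      "\<lbrakk>X \<in> Obj C; Y \<in> Obj C; Z \<in> Obj C\<rbrakk>
       \<Longrightarrow> braid C X (Y \<otimes>\<^sub>o Z) = (Ide C Y \<otimes>\<^sub>m braid C X Z) \<cdot> (braid C X Y \<otimes>\<^sub>m Ide C Z)"
    and braid_tensor_left:
      "\<lbrakk>X \<in> Obj C; Y \<in> Obj C; Z \<in> Obj C\<rbrakk>
       \<Longrightarrow> braid C (X \<otimes>\<^sub>o Y) Z = (braid C X Z \<otimes>\<^sub>m Ide C Y) \<cdot> (Ide C X \<otimes>\<^sub>m braid C Y Z)"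
    and twist_Hom: "X \<in> Obj C \<Longrightarrow> twist C X \<in> Hom C X X"
    and twist_iso: "X \<in> Obj C \<Longrightarrow> iso_arrow C (twist C X)"
    and twist_natural: "f \<in> Hom C X Y \<Longrightarrow> twist C Y \<cdot> f = f \<cdot> twist C X"
    and twist_tensor:
      "\<lbrakk>X \<in> Obj C; Y \<in> Obj C\<rbrakk>
       \<Longrightarrow> twist C (X \<otimes>\<^sub>o Y) = braid C Y X \<cdot> braid C X Y \<cdot> (twist C X \<otimes>\<^sub>m twist C Y)"
    and twist_dual: "X \<in> Obj C \<Longrightarrow> twist C (dual_obj C X) = dual_arr C (twist C X)"

locale ribbon_k_category = k_category K C + ribbon_category C
  for K :: "('k, 'r) ring_scheme" and C :: "('k, 'o, 'm, 'z) ribbon_category_scheme" (structure) +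
  assumes tensor_add_left:
      "\<lbrakk>f \<in> Hom C X Y; f' \<in> Hom C X Y; g \<in> Hom C X' Y'\<rbrakk>
       \<Longrightarrow> (f \<oplus>\<^sub>m f') \<otimes>\<^sub>m g = f \<otimes>\<^sub>m g \<oplus>\<^sub>m f' \<otimes>\<^sub>m g"
    and tensor_add_right:
      "\<lbrakk>f \<in> Hom C X Y; g \<in> Hom C X' Y'; g' \<in> Hom C X' Y'\<rbrakk>
       \<Longrightarrow> f \<otimes>\<^sub>m (g \<oplus>\<^sub>m g') = f \<otimes>\<^sub>m g \<oplus>\<^sub>m f \<otimes>\<^sub>m g'"
    and tensor_smult_left:
      "\<lbrakk>a \<in> carrier K; f \<in> Hom C X Y; g \<in> Hom C X' Y'\<rbrakk>
       \<Longrightarrow> (a \<odot>\<^sub>m f) \<otimes>\<^sub>m g = a \<odot>\<^sub>m (f \<otimes>\<^sub>m g)"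
    and tensor_smult_right:
      "\<lbrakk>a \<in> carrier K; f \<in> Hom C X Y; g \<in> Hom C X' Y'\<rbrakk>
       \<Longrightarrow> f \<otimes>\<^sub>m (a \<odot>\<^sub>m g) = a \<odot>\<^sub>m (f \<otimes>\<^sub>m g)"
    and scalar_tunit: "scalar_object K C \<bbbone>"

definition ev_r :: "('k, 'o, 'm, 'z) ribbon_category_scheme \<Rightarrow> 'o \<Rightarrow> 'm" where
  "ev_r C X =
     ev C X \<cdot>\<^bsub>C\<^esub> braid C X (dual_obj C X) \<cdot>\<^bsub>C\<^esub> (twist C X \<otimes>\<^sub>m\<^bsub>C\<^esub> Ide C (dual_obj C X))"

definition coev_r :: "('k, 'o, 'm, 'z) ribbon_category_scheme \<Rightarrow> 'o \<Rightarrow> 'm" where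
  "coev_r C X =
     (Ide C (dual_obj C X) \<otimes>\<^sub>m\<^bsub>C\<^esub> inverse_of C (twist C X))
       \<cdot>\<^bsub>C\<^esub> inverse_of C (braid C (dual_obj C X) X) \<cdot>\<^bsub>C\<^esub> coev C X"

text \<open>The quantum trace takes values in \<open>K\<close> through the identification \<open>End(\<bbbone>) = K\<close>.\<close>

definition tr_q ::
  "('k, 'r) ring_scheme \<Rightarrow> ('k, 'o, 'm, 'z) ribbon_category_scheme \<Rightarrow> 'm \<Rightarrow> 'k" where
  "tr_q K C f =
     (let X = Dom C f in
      THE a. a \<in> carrier K \<and> a \<odot>\<^sub>m\<^bsub>C\<^esub> Ide C \<bbbone>\<^bsub>C\<^esub> =
        ev_r C X \<cdot>\<^bsub>C\<^esub> (f \<otimes>\<^sub>m\<^bsub>C\<^esub> Ide C (dual_obj C X)) \<cdot>\<^bsub>C\<^esub> coev C X)"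

definition dim_q ::
  "('k, 'r) ring_scheme \<Rightarrow> ('k, 'o, 'm, 'z) ribbon_category_scheme \<Rightarrow> 'o \<Rightarrow> 'k" where
  "dim_q K C X = tr_q K C (Ide C X)"

definition negligible ::
  "('k, 'r) ring_scheme \<Rightarrow> ('k, 'o, 'm, 'z) ribbon_category_scheme \<Rightarrow> 'm \<Rightarrow> bool" where
  "negligible K C f \<longleftrightarrow> f \<in> Arr C \<and>
     (\<forall>g \<in> Hom C (Cod C f) (Dom C f). tr_q K C (g \<cdot>\<^bsub>C\<^esub> f) = \<zero>\<^bsub>K\<^esub>)"

definition full_ribbon_abelian_subcategory ::
  "('k, 'r) ring_scheme \<Rightarrow> ('k, 'o, 'm, 'z) ribbon_category_scheme \<Rightarrow> 'o set \<Rightarrow> bool" where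
  "full_ribbon_abelian_subcategory K C D \<longleftrightarrow>
     D \<subseteq> Obj C \<and> \<bbbone>\<^bsub>C\<^esub> \<in> D \<and>
     (\<forall>X \<in> D. \<forall>Y \<in> D. X \<otimes>\<^sub>o\<^bsub>C\<^esub> Y \<in> D) \<and> (\<forall>X \<in> D. dual_obj C X \<in> D) \<and>
     abelian_k_category K (full_subcategory C D)"


section \<open>The Hopf algebra structure of the coend\<close>

text \<open>The canonical arrow \<open>\<gamma>\<^sub>X\<^sub>,\<^sub>Y\<close> from \<open>X* \<otimes> Y*\<close> to \<open>(Y \<otimes> X)*\<close>, mate of the nested evaluation.\<close>

definition dual_tensor :: "('k, 'o, 'm, 'z) ribbon_category_scheme \<Rightarrow> 'o \<Rightarrow> 'o \<Rightarrow> 'm" where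
  "dual_tensor C X Y =
     (let X' = dual_obj C X; Y' = dual_obj C Y; Z = Y \<otimes>\<^sub>o\<^bsub>C\<^esub> X in
      (ev C X \<otimes>\<^sub>m\<^bsub>C\<^esub> Ide C (dual_obj C Z))
        \<cdot>\<^bsub>C\<^esub> (Ide C X' \<otimes>\<^sub>m\<^bsub>C\<^esub> ev C Y \<otimes>\<^sub>m\<^bsub>C\<^esub> Ide C X \<otimes>\<^sub>m\<^bsub>C\<^esub> Ide C (dual_obj C Z))
        \<cdot>\<^bsub>C\<^esub> (Ide C X' \<otimes>\<^sub>m\<^bsub>C\<^esub> Ide C Y' \<otimes>\<^sub>m\<^bsub>C\<^esub> coev C Z))"

text \<open>The arrow \<open>\<beta>\<^sub>X\<close> from \<open>X\<close> to \<open>X**\<close>.\<close>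

definition bidual :: "('k, 'o, 'm, 'z) ribbon_category_scheme \<Rightarrow> 'o \<Rightarrow> 'm" where
  "bidual C X =
     (let X' = dual_obj C X in
      (ev_r C X \<otimes>\<^sub>m\<^bsub>C\<^esub> Ide C (dual_obj C X')) \<cdot>\<^bsub>C\<^esub> (Ide C X \<otimes>\<^sub>m\<^bsub>C\<^esub> coev C X'))"

text \<open>
  Let \<open>i X : X* \<otimes> X \<rightarrow> A\<close> be a coend. The universal property (for the product, applied in both
  variables) makes each of the following descriptions define a unique arrow.
\<close>

definition coend_comult ::
  "('k, 'o, 'm, 'z) ribbon_category_scheme \<Rightarrow> 'o \<Rightarrow> ('o \<Rightarrow> 'm) \<Rightarrow> 'm" where
  "coend_comult C A i =
     (THE d. d \<in> Hom C A (A \<otimes>\<^sub>o\<^bsub>C\<^esub> A) \<and>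
        (\<forall>X \<in> Obj C. d \<cdot>\<^bsub>C\<^esub> i X =
           (i X \<otimes>\<^sub>m\<^bsub>C\<^esub> i X) \<cdot>\<^bsub>C\<^esub> (Ide C (dual_obj C X) \<otimes>\<^sub>m\<^bsub>C\<^esub> coev C X \<otimes>\<^sub>m\<^bsub>C\<^esub> Ide C X)))"

definition coend_mult ::
  "('k, 'o, 'm, 'z) ribbon_category_scheme \<Rightarrow> 'o \<Rightarrow> ('o \<Rightarrow> 'm) \<Rightarrow> 'm" where
  "coend_mult C A i =
     (THE m. m \<in> Hom C (A \<otimes>\<^sub>o\<^bsub>C\<^esub> A) A \<and>
        (\<forall>X \<in> Obj C. \<forall>Y \<in> Obj C. m \<cdot>\<^bsub>C\<^esub> (i X \<otimes>\<^sub>m\<^bsub>C\<^esub> i Y) =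
           i (Y \<otimes>\<^sub>o\<^bsub>C\<^esub> X)
             \<cdot>\<^bsub>C\<^esub> (dual_tensor C X Y \<otimes>\<^sub>m\<^bsub>C\<^esub> Ide C (Y \<otimes>\<^sub>o\<^bsub>C\<^esub> X))
             \<cdot>\<^bsub>C\<^esub> (Ide C (dual_obj C X) \<otimes>\<^sub>m\<^bsub>C\<^esub> braid C X (dual_obj C Y \<otimes>\<^sub>o\<^bsub>C\<^esub> Y))))"

definition coend_antipode ::
  "('k, 'o, 'm, 'z) ribbon_category_scheme \<Rightarrow> 'o \<Rightarrow> ('o \<Rightarrow> 'm) \<Rightarrow> 'm" where
  "coend_antipode C A i =
     (THE s. s \<in> Hom C A A \<and>
        (\<forall>X \<in> Obj C. s \<cdot>\<^bsub>C\<^esub> i X =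
           i (dual_obj C X)
             \<cdot>\<^bsub>C\<^esub> (bidual C X \<otimes>\<^sub>m\<^bsub>C\<^esub> twist C (dual_obj C X))
             \<cdot>\<^bsub>C\<^esub> braid C (dual_obj C X) X))"

definition Gamma_l ::
  "('k, 'o, 'm, 'z) ribbon_category_scheme \<Rightarrow> 'o \<Rightarrow> ('o \<Rightarrow> 'm) \<Rightarrow> 'm" where
  "Gamma_l C A i =
     (Ide C A \<otimes>\<^sub>m\<^bsub>C\<^esub> coend_mult C A i) \<cdot>\<^bsub>C\<^esub> (coend_comult C A i \<otimes>\<^sub>m\<^bsub>C\<^esub> Ide C A)"

text \<open>The set \<open>\<I>(C)\<close>, computed with the coend \<open>(A, i)\<close>.\<close>

definition I_set ::
  "('k, 'r) ring_scheme \<Rightarrow> ('k, 'o, 'm, 'z) ribbon_category_scheme \<Rightarrow> 'o \<Rightarrow> ('o \<Rightarrow> 'm)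
     \<Rightarrow> 'm set" where
  "I_set K C A i =
     {\<alpha> \<in> Hom C \<bbbone>\<^bsub>C\<^esub> A.
        negligible K C (coend_antipode C A i \<cdot>\<^bsub>C\<^esub> \<alpha> \<ominus>\<^bsub>Hom_module C \<bbbone>\<^bsub>C\<^esub> A\<^esub> \<alpha>) \<and>
        negligible K C (Gamma_l C A i \<cdot>\<^bsub>C\<^esub> (\<alpha> \<otimes>\<^sub>m\<^bsub>C\<^esub> \<alpha>)
          \<ominus>\<^bsub>Hom_module C \<bbbone>\<^bsub>C\<^esub> (A \<otimes>\<^sub>o\<^bsub>C\<^esub> A)\<^esub> (\<alpha> \<otimes>\<^sub>m\<^bsub>C\<^esub> \<alpha>))}"

text \<open>
  \<open>B\<close> is the direct sum of all \<open>l* \<otimes> l\<close> with \<open>l \<in> L\<close>, with projections \<open>p\<close> and injections \<open>q\<close>, and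
  \<open>j X\<close> is computed from some decomposition of \<open>X\<close> (projections \<open>p'\<close>, injections \<open>q'\<close>) into a
  direct sum of elements of \<open>L\<close>. When simple objects are scalar and \<open>L\<close> represents them, the
  result does not depend on the decomposition.
\<close>

definition semisimple_coend ::
  "('k, 'o, 'm, 'z) ribbon_category_scheme \<Rightarrow> 'o set \<Rightarrow> 'o \<Rightarrow> ('o \<Rightarrow> 'm) \<Rightarrow> ('o \<Rightarrow> 'm)
     \<Rightarrow> ('o \<Rightarrow> 'm) \<Rightarrow> bool" where
  "semisimple_coend C L B p q j \<longleftrightarrow>
     direct_sum C L (\<lambda>l. dual_obj C l \<otimes>\<^sub>o\<^bsub>C\<^esub> l) B p q \<and>
     (\<forall>X \<in> Obj C. \<exists>(n::nat) S p' q'.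
        (\<forall>k < n. S k \<in> L) \<and> direct_sum C {..<n} S X p' q' \<and>
        j X = (\<Oplus>\<^bsub>Hom_module C (dual_obj C X \<otimes>\<^sub>o\<^bsub>C\<^esub> X) B\<^esub>k \<in> {..<n}.
                 q (S k) \<cdot>\<^bsub>C\<^esub> (dual_arr C (q' k) \<otimes>\<^sub>m\<^bsub>C\<^esub> p' k)))"

end

theory Submission
  imports Defs
begin

text \<open>
  Write X' for the dual of X and \<open>d X\<close> for its quantum dimension, and let \<open>\<alpha>\<close> be the sum of
  \<open>d l\<close> times \<open>e l\<close> over the chosen simple objects of the subcategory. Both differences that have to
  be negligible are in fact zero.

  The antipode condition holds because the antipode sends the closed strand \<open>e X = j X \<cdot> coev_r X\<close> to
  the closed strand of X' (\<open>antipode_loop\<close>), while \<open>e X\<close> and \<open>d X\<close> depend only on the isomorphism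
  class of X and \<open>d\<close> is invariant under duality. Passing to duals permutes the simple objects of the
  subcategory, so it permutes the terms of \<open>\<alpha>\<close>.

  The condition on \<open>\<Gamma>\<close> is the invariance of \<open>\<alpha>\<close> under handle slides. It reduces to the statement
  that \<open>\<alpha>\<close> is an integral on the subcategory: multiplying \<open>j X\<close> by \<open>\<alpha>\<close> gives \<open>\<alpha> \<cdot> ev X\<close>
  for X in the subcategory (\<open>mult_kirby\<close>). The braiding in the product disappears here, because a
  closed strand can be pulled through it; what remains is the strand of an object M, cabled with the
  strand of X. To compute its component at a simple object N, decompose \<open>M \<otimes> X\<close>, with projections \<open>f\<close>
  to N and injections \<open>g\<close> from N, and bend the leg X of both to the other side. This gives arrows from
  M to \<open>N \<otimes> X'\<close> and back whose composite on M is a scalar. Comparing traces shows that this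
  scalar is \<open>d N / d M\<close> times the Kronecker delta, so the bent arrows, weighted by \<open>d M\<close>, add up to
  \<open>d N\<close> times the projection of \<open>N \<otimes> X'\<close> onto its M-isotypic part (\<open>handle_slide_component\<close>,
  where the division by \<open>d M\<close> is avoided). Summed over all simple objects M of the subcategory these
  projections give the identity when N lies in the subcategory, since all constituents of
  \<open>N \<otimes> X'\<close> then do; and no M contributes when N does not, since a nonzero arrow from M to
  \<open>N \<otimes> X'\<close> would make N a constituent of \<open>M \<otimes> X\<close>.

  The subcategory enters only through closure properties of its set of simple objects (the locale
  \<open>closed_simples\<close>). They follow from the splitting of idempotents: being abelian, the
  subcategory contains, up to isomorphism, every direct summand of its objects
  (\<open>summand_representative\<close>).

  The ribbon calculus behind this consists of the two zigzag identities for \<open>ev_r\<close> and \<open>coev_r\<close>,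
  the behaviour of \<open>coev_r\<close> under tensor products and duals, and the cyclicity of the trace. The Hopf
  algebra maps are accessed only through the universal property of \<open>(B, j)\<close>.
\<close>

section \<open>Composition and inverses\<close>

context category
begin

lemma Hom_Obj: "f \<in> Hom C X Y \<Longrightarrow> X \<in> Obj C" "f \<in> Hom C X Y \<Longrightarrow> Y \<in> Obj C"
  using Dom_Obj Cod_Obj by (auto simp: Hom_def)

lemma Ide_typing:
  "X \<in> Obj C \<Longrightarrow> Ide C X \<in> Arr C"
  "X \<in> Obj C \<Longrightarrow> Dom C (Ide C X) = X"
  "X \<in> Obj C \<Longrightarrow> Cod C (Ide C X) = X"
  using Ide_Hom by (auto simp: Hom_def)

lemma Comp_typing:
  "\<lbrakk>f \<in> Arr C; g \<in> Arr C; Dom C g = Cod C f\<rbrakk> \<Longrightarrow> g \<cdot> f \<in> Arr C"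
  "\<lbrakk>f \<in> Arr C; g \<in> Arr C; Dom C g = Cod C f\<rbrakk> \<Longrightarrow> Dom C (g \<cdot> f) = Dom C f"
  "\<lbrakk>f \<in> Arr C; g \<in> Arr C; Dom C g = Cod C f\<rbrakk> \<Longrightarrow> Cod C (g \<cdot> f) = Cod C g"
  using Comp_Hom by (auto simp: Hom_def)

lemma Comp_unit:
  "\<lbrakk>f \<in> Arr C; Cod C f = X\<rbrakk> \<Longrightarrow> Ide C X \<cdot> f = f"
  "\<lbrakk>f \<in> Arr C; Dom C f = X\<rbrakk> \<Longrightarrow> f \<cdot> Ide C X = f"
  using Ide_left Ide_right by (auto simp: Hom_def)

lemma Comp_reassoc:
  "\<lbrakk>f \<in> Arr C; g \<in> Arr C; h \<in> Arr C; Dom C g = Cod C f; Dom C h = Cod C g\<rbrakk>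
    \<Longrightarrow> (h \<cdot> g) \<cdot> f = h \<cdot> (g \<cdot> f)"
  using Comp_assoc by (auto simp: Hom_def)

lemmas typing = Dom_Obj Cod_Obj Ide_typing Comp_typing

lemma inverse_of_inverse_arrows: "inverse_arrows C f g \<Longrightarrow> inverse_of C f = g"
  unfolding inverse_of_def
proof (rule the_equality)
  fix h assume g: "inverse_arrows C f g" and h: "inverse_arrows C f h"
  have "h = h \<cdot> Ide C (Cod C f)"
    using h by (simp add: inverse_arrows_def Hom_def Comp_unit)
  also have "\<dots> = h \<cdot> (f \<cdot> g)"
    using g by (simp add: inverse_arrows_def)
  also have "\<dots> = (h \<cdot> f) \<cdot> g"
    using g h by (intro Comp_reassoc[symmetric]) (auto simp: inverse_arrows_def Hom_def)
  also have "\<dots> = g"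
    using g h by (simp add: inverse_arrows_def Hom_def Comp_unit)
  finally show "h = g" .
qed simp

lemma inverse_of_iso:
  assumes "iso_arrow C f"
  shows "inverse_of C f \<in> Arr C"
    and "Dom C (inverse_of C f) = Cod C f"
    and "Cod C (inverse_of C f) = Dom C f"
    and "inverse_of C f \<cdot> f = Ide C (Dom C f)"
    and "f \<cdot> inverse_of C f = Ide C (Cod C f)"
proof -
  obtain g where "inverse_arrows C f g"
    using assms by (auto simp: iso_arrow_def)
  moreover from this have "inverse_of C f = g"
    by (rule inverse_of_inverse_arrows)
  ultimately show
    "inverse_of C f \<in> Arr C" "Dom C (inverse_of C f) = Cod C f"
    "Cod C (inverse_of C f) = Dom C f"
    "inverse_of C f \<cdot> f = Ide C (Dom C f)" "f \<cdot> inverse_of C f = Ide C (Cod C f)"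
    by (auto simp: inverse_arrows_def Hom_def)
qed

lemma iso_arrow_Arr: "iso_arrow C f \<Longrightarrow> f \<in> Arr C"
  by (auto simp: iso_arrow_def inverse_arrows_def)

lemma iso_cancel_left:
  assumes "iso_arrow C f" "g \<in> Arr C" "h \<in> Arr C" "Cod C g = Dom C f" "Cod C h = Dom C f"
    and eq: "f \<cdot> g = f \<cdot> h"
  shows "g = h"
proof -
  have "inverse_of C f \<cdot> (f \<cdot> g) = inverse_of C f \<cdot> (f \<cdot> h)"
    by (simp add: eq)
  then have "(inverse_of C f \<cdot> f) \<cdot> g = (inverse_of C f \<cdot> f) \<cdot> h"
    using assms(2-5) inverse_of_iso(1-3)[OF assms(1)] iso_arrow_Arr[OF assms(1)]
    by (simp add: Comp_reassoc)
  then show ?thesis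
    using assms(2-5) inverse_of_iso(4)[OF assms(1)] by (simp add: Comp_unit)
qed

end

section \<open>Interchange in strict monoidal categories\<close>

context strict_monoidal_category
begin

lemma tensor_typing:
  "\<lbrakk>f \<in> Arr C; g \<in> Arr C\<rbrakk> \<Longrightarrow> f \<otimes>\<^sub>m g \<in> Arr C"
  "\<lbrakk>f \<in> Arr C; g \<in> Arr C\<rbrakk> \<Longrightarrow> Dom C (f \<otimes>\<^sub>m g) = Dom C f \<otimes>\<^sub>o Dom C g"
  "\<lbrakk>f \<in> Arr C; g \<in> Arr C\<rbrakk> \<Longrightarrow> Cod C (f \<otimes>\<^sub>m g) = Cod C f \<otimes>\<^sub>o Cod C g"
  using tensor_Hom by (auto simp: Hom_def)

lemma interchange:
  "\<lbrakk>f \<in> Arr C; g \<in> Arr C; f' \<in> Arr C; g' \<in> Arr C; Dom C g = Cod C f; Dom C g' = Cod C f'\<rbrakk>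
    \<Longrightarrow> (g \<otimes>\<^sub>m g') \<cdot> (f \<otimes>\<^sub>m f') = (g \<cdot> f) \<otimes>\<^sub>m (g' \<cdot> f')"
  using tensor_Comp by (auto simp: Hom_def)

lemma interchange_assoc:
  "\<lbrakk>f \<in> Arr C; g \<in> Arr C; f' \<in> Arr C; g' \<in> Arr C; Dom C g = Cod C f; Dom C g' = Cod C f';
    r \<in> Arr C; Cod C r = Dom C f \<otimes>\<^sub>o Dom C f'\<rbrakk>
    \<Longrightarrow> (g \<otimes>\<^sub>m g') \<cdot> ((f \<otimes>\<^sub>m f') \<cdot> r) = ((g \<cdot> f) \<otimes>\<^sub>m (g' \<cdot> f')) \<cdot> r"
  by (simp add: interchange[symmetric] Comp_reassoc typing tensor_typing)

lemma tensor_Ide_split: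
  "\<lbrakk>X \<in> Obj C; Y \<in> Obj C\<rbrakk> \<Longrightarrow> Ide C (X \<otimes>\<^sub>o Y) = Ide C X \<otimes>\<^sub>m Ide C Y"
  by (simp add: tensor_Ide)

lemma tensor_Ide_assoc:
  "\<lbrakk>X \<in> Obj C; Y \<in> Obj C; f \<in> Arr C\<rbrakk>
    \<Longrightarrow> Ide C X \<otimes>\<^sub>m (Ide C Y \<otimes>\<^sub>m f) = Ide C (X \<otimes>\<^sub>o Y) \<otimes>\<^sub>m f"
  by (simp add: tensor_arr_assoc[symmetric] typing tensor_Ide)

lemma whisker_Comp:
  "\<lbrakk>f \<in> Arr C; g \<in> Arr C; Dom C g = Cod C f; X \<in> Obj C\<rbrakk>
    \<Longrightarrow> (g \<cdot> f) \<otimes>\<^sub>m Ide C X = (g \<otimes>\<^sub>m Ide C X) \<cdot> (f \<otimes>\<^sub>m Ide C X)"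
  "\<lbrakk>f \<in> Arr C; g \<in> Arr C; Dom C g = Cod C f; X \<in> Obj C\<rbrakk>
    \<Longrightarrow> Ide C X \<otimes>\<^sub>m (g \<cdot> f) = (Ide C X \<otimes>\<^sub>m g) \<cdot> (Ide C X \<otimes>\<^sub>m f)"
  by (simp_all add: interchange typing Comp_unit)

lemmas base = typing Comp_unit Comp_reassoc tensor_typing tunit_Obj tensor_Obj tensor_obj_assoc
  tensor_arr_assoc tunit_obj_left tunit_obj_right tunit_arr_left tunit_arr_right

lemmas split_Ide = base tensor_Ide_split

text \<open>
  Rewriting in a strict monoidal category uses two normal forms. The rules \<open>merge\<close> split identities of
  tensor products into factors and combine composites by the interchange law, so that arrows acting on
  different factors commute by simplification. The rules \<open>layers\<close> go the opposite way: they
  distribute tensoring with an identity over composition, so that a diagram becomes a composite of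
  layers with one generator each, and regrouping a diagram becomes associativity. Identities of tensor
  products are split in the first form and fused in the second. The rules below remove split identities
  that remain after merging.
\<close>

lemma tensor_Ide_unit:
  assumes "X \<in> Obj C" "Y \<in> Obj C" "f \<in> Arr C"
  shows "Cod C f = X \<otimes>\<^sub>o Y \<Longrightarrow> (Ide C X \<otimes>\<^sub>m Ide C Y) \<cdot> f = f"
    and "Dom C f = X \<otimes>\<^sub>o Y \<Longrightarrow> f \<cdot> (Ide C X \<otimes>\<^sub>m Ide C Y) = f"
    and "\<lbrakk>Z \<in> Obj C; Cod C f = X \<otimes>\<^sub>o (Y \<otimes>\<^sub>o Z)\<rbrakk> \<Longrightarrow> (Ide C X \<otimes>\<^sub>m (Ide C Y \<otimes>\<^sub>m Ide C Z)) \<cdot> f = f"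
    and "\<lbrakk>Z \<in> Obj C; Dom C f = X \<otimes>\<^sub>o (Y \<otimes>\<^sub>o Z)\<rbrakk> \<Longrightarrow> f \<cdot> (Ide C X \<otimes>\<^sub>m (Ide C Y \<otimes>\<^sub>m Ide C Z)) = f"
  using assms by (simp_all add: tensor_Ide tensor_Obj Comp_unit)

lemmas merge = split_Ide interchange interchange_assoc tensor_Ide_unit

lemmas layers = base tensor_Ide tensor_Ide_assoc whisker_Comp

lemma slide_right:
  "\<lbrakk>f \<in> Arr C; g \<in> Arr C; Cod C f = X; Dom C g = Y\<rbrakk> \<Longrightarrow> (Ide C X \<otimes>\<^sub>m g) \<cdot> (f \<otimes>\<^sub>m Ide C Y) = f \<otimes>\<^sub>m g"
  by (auto simp add: merge)

lemma slide_left: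
  "\<lbrakk>f \<in> Arr C; g \<in> Arr C; Dom C f = X; Cod C g = Y\<rbrakk> \<Longrightarrow> (f \<otimes>\<^sub>m Ide C Y) \<cdot> (Ide C X \<otimes>\<^sub>m g) = f \<otimes>\<^sub>m g"
  by (auto simp add: merge)

text \<open>
  The unit object is invisible in a strict monoidal category, so an arrow out of it can be placed next
  to another arrow at any height, and on either side. This cannot be left to the interchange law, which
  needs the missing factor to be written.
\<close>

lemma slide_unit_source:
  "\<lbrakk>f \<in> Arr C; g \<in> Arr C; Cod C f = X; Dom C g = \<bbbone>\<rbrakk> \<Longrightarrow> (Ide C X \<otimes>\<^sub>m g) \<cdot> f = f \<otimes>\<^sub>m g"
  "\<lbrakk>f \<in> Arr C; g \<in> Arr C; Cod C f = X; Dom C g = \<bbbone>\<rbrakk> \<Longrightarrow> (g \<otimes>\<^sub>m Ide C X) \<cdot> f = g \<otimes>\<^sub>m f"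
  using slide_right[of f g X \<bbbone>] slide_left[of g f \<bbbone> X] by (simp_all add: base)

lemma slide_unit_target:
  "\<lbrakk>f \<in> Arr C; g \<in> Arr C; Dom C f = X; Cod C g = \<bbbone>\<rbrakk> \<Longrightarrow> f \<cdot> (Ide C X \<otimes>\<^sub>m g) = f \<otimes>\<^sub>m g"
  "\<lbrakk>f \<in> Arr C; g \<in> Arr C; Dom C f = X; Cod C g = \<bbbone>\<rbrakk> \<Longrightarrow> f \<cdot> (g \<otimes>\<^sub>m Ide C X) = g \<otimes>\<^sub>m f"
  using slide_left[of f g X \<bbbone>] slide_right[of g f \<bbbone> X] by (simp_all add: base)

end

section \<open>Ribbon categories: units and mates\<close>

context ribbon_category
begin

lemma ev_typing:
  "X \<in> Obj C \<Longrightarrow> ev C X \<in> Arr C"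
  "X \<in> Obj C \<Longrightarrow> Dom C (ev C X) = dual_obj C X \<otimes>\<^sub>o X"
  "X \<in> Obj C \<Longrightarrow> Cod C (ev C X) = \<bbbone>"
  using ev_Hom by (auto simp: Hom_def)

lemma coev_typing:
  "X \<in> Obj C \<Longrightarrow> coev C X \<in> Arr C"
  "X \<in> Obj C \<Longrightarrow> Dom C (coev C X) = \<bbbone>"
  "X \<in> Obj C \<Longrightarrow> Cod C (coev C X) = X \<otimes>\<^sub>o dual_obj C X"
  using coev_Hom by (auto simp: Hom_def)

lemma braid_typing:
  "\<lbrakk>X \<in> Obj C; Y \<in> Obj C\<rbrakk> \<Longrightarrow> braid C X Y \<in> Arr C"
  "\<lbrakk>X \<in> Obj C; Y \<in> Obj C\<rbrakk> \<Longrightarrow> Dom C (braid C X Y) = X \<otimes>\<^sub>o Y"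
  "\<lbrakk>X \<in> Obj C; Y \<in> Obj C\<rbrakk> \<Longrightarrow> Cod C (braid C X Y) = Y \<otimes>\<^sub>o X"
  using braid_Hom by (auto simp: Hom_def)

lemma twist_typing:
  "X \<in> Obj C \<Longrightarrow> twist C X \<in> Arr C"
  "X \<in> Obj C \<Longrightarrow> Dom C (twist C X) = X"
  "X \<in> Obj C \<Longrightarrow> Cod C (twist C X) = X"
  using twist_Hom by (auto simp: Hom_def)

lemmas inverse_braid = inverse_of_iso[OF braid_iso]
lemmas inverse_twist = inverse_of_iso[OF twist_iso]

lemmas rib_typing = dual_Obj dual_tunit ev_typing coev_typing braid_typing twist_typing
  inverse_braid(1-3) inverse_twist(1-3)

lemmas rbase = base rib_typing
lemmas rmerge = merge rib_typing
lemmas rlayers = layers rib_typing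

lemma braid_nat:
  "\<lbrakk>f \<in> Arr C; g \<in> Arr C; Cod C f = X'; Cod C g = Y'\<rbrakk>
    \<Longrightarrow> braid C X' Y' \<cdot> (f \<otimes>\<^sub>m g) = (g \<otimes>\<^sub>m f) \<cdot> braid C (Dom C f) (Dom C g)"
  using braid_natural by (auto simp: Hom_def)

lemma twist_nat:
  "\<lbrakk>f \<in> Arr C; Cod C f = Y\<rbrakk> \<Longrightarrow> twist C Y \<cdot> f = f \<cdot> twist C (Dom C f)"
  using twist_natural by (auto simp: Hom_def)

text \<open>
  The hexagon for a tensor product of two units exhibits this braiding as an idempotent isomorphism.
\<close>

lemma braid_unit:
  assumes X[simp]: "X \<in> Obj C"
  shows "braid C X \<bbbone> = Ide C X" "braid C \<bbbone> X = Ide C X"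
proof -
  have "braid C X \<bbbone> \<cdot> braid C X \<bbbone> = braid C X \<bbbone> \<cdot> Ide C X"
    using braid_tensor_right[OF X tunit_Obj tunit_Obj] by (simp add: rbase)
  then show "braid C X \<bbbone> = Ide C X"
    by (rule iso_cancel_left[rotated -1]) (simp_all add: braid_iso rbase)
  have "braid C \<bbbone> X \<cdot> braid C \<bbbone> X = braid C \<bbbone> X \<cdot> Ide C X"
    using braid_tensor_left[OF tunit_Obj tunit_Obj X] by (simp add: rbase)
  then show "braid C \<bbbone> X = Ide C X"
    by (rule iso_cancel_left[rotated -1]) (simp_all add: braid_iso rbase)
qed

text \<open>
  The twist of \<open>\<bbbone> \<otimes> \<bbbone>\<close> equals that of \<open>\<bbbone>\<close>, so the twist of \<open>\<bbbone>\<close> is an idempotent isomorphism.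
\<close>

lemma twist_unit: "twist C \<bbbone> = Ide C \<bbbone>"
proof -
  have "twist C \<bbbone> \<otimes>\<^sub>m twist C \<bbbone> = twist C \<bbbone> \<cdot> twist C \<bbbone>"
    using slide_unit_source(1)[of "twist C \<bbbone>" "twist C \<bbbone>" \<bbbone>] by (simp add: rbase)
  then have "twist C \<bbbone> \<cdot> twist C \<bbbone> = twist C \<bbbone> \<cdot> Ide C \<bbbone>"
    using twist_tensor[OF tunit_Obj tunit_Obj] by (simp add: rbase braid_unit)
  then show ?thesis
    by (rule iso_cancel_left[rotated -1]) (simp_all add: twist_iso rbase)
qed

text \<open>
  Pairings of W with Z correspond to arrows from W to the dual of Z. Dual arrows, the comparison of
  \<open>X' \<otimes> Y'\<close> with the dual of \<open>Y \<otimes> X\<close>, and the map to the bidual are the mates of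
  evident pairings; equations between them are therefore checked on pairings (\<open>mate_eqI\<close>).
\<close>

definition mate where
  "mate W Z b = (b \<otimes>\<^sub>m Ide C (dual_obj C Z)) \<cdot> (Ide C W \<otimes>\<^sub>m coev C Z)"

lemma mate_typing:
  assumes "b \<in> Arr C" "W \<in> Obj C" "Z \<in> Obj C" "Dom C b = W \<otimes>\<^sub>o Z" "Cod C b = \<bbbone>"
  shows "mate W Z b \<in> Arr C" "Dom C (mate W Z b) = W" "Cod C (mate W Z b) = dual_obj C Z"
  using assms by (simp_all add: mate_def rbase)

lemma zigzag_rules:
  "X \<in> Obj C \<Longrightarrow> (Ide C X \<otimes>\<^sub>m ev C X) \<cdot> (coev C X \<otimes>\<^sub>m Ide C X) = Ide C X"
  "X \<in> Obj C \<Longrightarrow> (ev C X \<otimes>\<^sub>m Ide C (dual_obj C X)) \<cdot> (Ide C (dual_obj C X) \<otimes>\<^sub>m coev C X)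
     = Ide C (dual_obj C X)"
  by (simp_all add: zigzag zigzag_dual)

lemma ev_mate:
  assumes [simp]: "b \<in> Arr C" "W \<in> Obj C" "Z \<in> Obj C" "Dom C b = W \<otimes>\<^sub>o Z" "Cod C b = \<bbbone>"
  shows "ev C Z \<cdot> (mate W Z b \<otimes>\<^sub>m Ide C Z) = b"
proof -
  let ?Z = "Ide C Z" and ?Z' = "Ide C (dual_obj C Z)" and ?W = "Ide C W"
  have "mate W Z b \<otimes>\<^sub>m ?Z = (b \<otimes>\<^sub>m ?Z' \<otimes>\<^sub>m ?Z) \<cdot> (?W \<otimes>\<^sub>m coev C Z \<otimes>\<^sub>m ?Z)"
    by (simp add: mate_def rlayers)
  then have "ev C Z \<cdot> (mate W Z b \<otimes>\<^sub>m ?Z)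
      = (ev C Z \<cdot> (b \<otimes>\<^sub>m Ide C (dual_obj C Z \<otimes>\<^sub>o Z))) \<cdot> (?W \<otimes>\<^sub>m coev C Z \<otimes>\<^sub>m ?Z)"
    by (simp add: rlayers)
  also have "ev C Z \<cdot> (b \<otimes>\<^sub>m Ide C (dual_obj C Z \<otimes>\<^sub>o Z)) = b \<otimes>\<^sub>m ev C Z"
    by (rule slide_unit_target) (simp_all add: rbase)
  also have "\<dots> = b \<cdot> (?W \<otimes>\<^sub>m ?Z \<otimes>\<^sub>m ev C Z)"
    using slide_unit_target(1)[of b "ev C Z" "W \<otimes>\<^sub>o Z"] by (simp add: rlayers)
  also have "b \<cdot> (?W \<otimes>\<^sub>m ?Z \<otimes>\<^sub>m ev C Z) \<cdot> (?W \<otimes>\<^sub>m coev C Z \<otimes>\<^sub>m ?Z)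
      = b \<cdot> (?W \<otimes>\<^sub>m ?Z)"
    by (simp add: rmerge zigzag_rules)
  also have "\<dots> = b"
    by (simp add: rlayers)
  finally show ?thesis .
qed

lemma mate_ev:
  assumes [simp]: "u \<in> Arr C" "Z \<in> Obj C" "Dom C u = W" "Cod C u = dual_obj C Z"
  shows "mate W Z (ev C Z \<cdot> (u \<otimes>\<^sub>m Ide C Z)) = u"
proof -
  let ?Z = "Ide C Z" and ?Z' = "Ide C (dual_obj C Z)" and ?W = "Ide C W"
  have [simp]: "W \<in> Obj C"
    using assms(1,3) Dom_Obj by blast
  have "mate W Z (ev C Z \<cdot> (u \<otimes>\<^sub>m ?Z)) = (ev C Z \<otimes>\<^sub>m ?Z') \<cdot> ((u \<otimes>\<^sub>m Ide C (Z \<otimes>\<^sub>o dual_obj C Z)) \<cdot> (?W \<otimes>\<^sub>m coev C Z))"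
    by (simp add: mate_def rlayers)
  also have "(u \<otimes>\<^sub>m Ide C (Z \<otimes>\<^sub>o dual_obj C Z)) \<cdot> (?W \<otimes>\<^sub>m coev C Z) = u \<otimes>\<^sub>m coev C Z"
    by (rule slide_left) (simp_all add: rbase)
  also have "\<dots> = (?Z' \<otimes>\<^sub>m coev C Z) \<cdot> u"
    by (rule slide_unit_source(1)[symmetric]) (simp_all add: rbase)
  also have "(ev C Z \<otimes>\<^sub>m ?Z') \<cdot> \<dots> = ((ev C Z \<otimes>\<^sub>m ?Z') \<cdot> (?Z' \<otimes>\<^sub>m coev C Z)) \<cdot> u"
    by (simp add: rbase)
  finally show ?thesis
    by (simp add: zigzag_rules rbase)
qed

text \<open>
  A pairing and a copairing that satisfy one zigzag identity differ from the chosen duality by the mate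
  of the pairing, since left duals are unique.
\<close>

lemma coev_mate:
  assumes [simp]: "b \<in> Arr C" "W \<in> Obj C" "Z \<in> Obj C" "Dom C b = W \<otimes>\<^sub>o Z" "Cod C b = \<bbbone>"
    "n \<in> Arr C" "Dom C n = \<bbbone>" "Cod C n = Z \<otimes>\<^sub>o W"
    and zz: "(Ide C Z \<otimes>\<^sub>m b) \<cdot> (n \<otimes>\<^sub>m Ide C Z) = Ide C Z"
  shows "(Ide C Z \<otimes>\<^sub>m mate W Z b) \<cdot> n = coev C Z"
proof -
  let ?Z = "Ide C Z" and ?Z' = "Ide C (dual_obj C Z)" and ?W = "Ide C W"
  have "(?Z \<otimes>\<^sub>m mate W Z b) \<cdot> n
      = (?Z \<otimes>\<^sub>m b \<otimes>\<^sub>m ?Z') \<cdot> ((Ide C (Z \<otimes>\<^sub>o W) \<otimes>\<^sub>m coev C Z) \<cdot> n)"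
    by (simp add: mate_def rlayers)
  also have "(Ide C (Z \<otimes>\<^sub>o W) \<otimes>\<^sub>m coev C Z) \<cdot> n = n \<otimes>\<^sub>m coev C Z"
    by (rule slide_unit_source) (simp_all add: rbase)
  also have "\<dots> = (n \<otimes>\<^sub>m Ide C (Z \<otimes>\<^sub>o dual_obj C Z)) \<cdot> coev C Z"
    by (rule slide_unit_source[symmetric]) (simp_all add: rbase)
  also have "(?Z \<otimes>\<^sub>m b \<otimes>\<^sub>m ?Z') \<cdot> \<dots> = (((?Z \<otimes>\<^sub>m b) \<cdot> (n \<otimes>\<^sub>m ?Z)) \<otimes>\<^sub>m ?Z') \<cdot> coev C Z"
    by (simp add: rlayers)
  finally show ?thesis
    by (simp only: zz) (simp add: rlayers)
qed

section \<open>Dual arrows\<close>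

lemma mate_eqI:
  assumes "u \<in> Arr C" "v \<in> Arr C" "Z \<in> Obj C" "Dom C u = W" "Dom C v = W"
    "Cod C u = dual_obj C Z" "Cod C v = dual_obj C Z"
    and "ev C Z \<cdot> (u \<otimes>\<^sub>m Ide C Z) = ev C Z \<cdot> (v \<otimes>\<^sub>m Ide C Z)"
  shows "u = v"
proof -
  have "u = mate W Z (ev C Z \<cdot> (u \<otimes>\<^sub>m Ide C Z))"
    by (rule mate_ev[symmetric]) (fact assms)+
  also have "\<dots> = mate W Z (ev C Z \<cdot> (v \<otimes>\<^sub>m Ide C Z))"
    by (simp only: assms(8))
  also have "\<dots> = v"
    by (rule mate_ev) (fact assms)+
  finally show ?thesis .
qed

lemma dual_arr_mate:
  assumes "f \<in> Arr C" "Dom C f = X" "Cod C f = Y"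
  shows "dual_arr C f = mate (dual_obj C Y) X (ev C Y \<cdot> (Ide C (dual_obj C Y) \<otimes>\<^sub>m f))"
proof -
  have [simp]: "X \<in> Obj C" "Y \<in> Obj C"
    using assms Dom_Obj[of f] Cod_Obj[of f] by auto
  show ?thesis
    using assms by (simp add: dual_arr_def Let_def mate_def rlayers)
qed

lemma dual_arr_typing:
  assumes "f \<in> Arr C"
  shows "dual_arr C f \<in> Arr C" "Dom C (dual_arr C f) = dual_obj C (Cod C f)"
    "Cod C (dual_arr C f) = dual_obj C (Dom C f)"
  unfolding dual_arr_mate[OF assms refl refl]
  using assms by (simp_all add: mate_typing rbase)

lemma dual_tensor_mate:
  assumes "X \<in> Obj C" "Y \<in> Obj C"
  shows "dual_tensor C X Y = mate (dual_obj C X \<otimes>\<^sub>o dual_obj C Y) (Y \<otimes>\<^sub>o X)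
    (ev C X \<cdot> (Ide C (dual_obj C X) \<otimes>\<^sub>m ev C Y \<otimes>\<^sub>m Ide C X))"
  using assms by (simp add: dual_tensor_def Let_def mate_def rlayers)

lemma dual_tensor_typing:
  assumes "X \<in> Obj C" "Y \<in> Obj C"
  shows "dual_tensor C X Y \<in> Arr C" "Dom C (dual_tensor C X Y) = dual_obj C X \<otimes>\<^sub>o dual_obj C Y"
    "Cod C (dual_tensor C X Y) = dual_obj C (Y \<otimes>\<^sub>o X)"
  unfolding dual_tensor_mate[OF assms]
  using assms by (simp_all add: mate_typing rbase)

lemma ev_r_typing:
  "X \<in> Obj C \<Longrightarrow> ev_r C X \<in> Arr C"
  "X \<in> Obj C \<Longrightarrow> Dom C (ev_r C X) = X \<otimes>\<^sub>o dual_obj C X"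
  "X \<in> Obj C \<Longrightarrow> Cod C (ev_r C X) = \<bbbone>"
  by (simp_all add: ev_r_def rbase)

lemma coev_r_typing:
  "X \<in> Obj C \<Longrightarrow> coev_r C X \<in> Arr C"
  "X \<in> Obj C \<Longrightarrow> Dom C (coev_r C X) = \<bbbone>"
  "X \<in> Obj C \<Longrightarrow> Cod C (coev_r C X) = dual_obj C X \<otimes>\<^sub>o X"
  by (simp_all add: coev_r_def rbase)

lemma bidual_mate: "bidual C X = mate X (dual_obj C X) (ev_r C X)"
  by (simp add: bidual_def Let_def mate_def)

lemma bidual_typing:
  assumes "X \<in> Obj C"
  shows "bidual C X \<in> Arr C" "Dom C (bidual C X) = X"
    "Cod C (bidual C X) = dual_obj C (dual_obj C X)"
  unfolding bidual_mate using assms by (simp_all add: mate_typing rbase ev_r_typing)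

lemmas more_typing = dual_arr_typing dual_tensor_typing ev_r_typing coev_r_typing bidual_typing
lemmas dbase = rbase more_typing
lemmas dmerge = rmerge more_typing
lemmas dlayers = rlayers more_typing

lemma ev_dual_arr:
  assumes "f \<in> Arr C" "Dom C f = X" "Cod C f = Y"
  shows "ev C X \<cdot> (dual_arr C f \<otimes>\<^sub>m Ide C X) = ev C Y \<cdot> (Ide C (dual_obj C Y) \<otimes>\<^sub>m f)"
proof -
  have [simp]: "X \<in> Obj C" "Y \<in> Obj C"
    using assms Dom_Obj[of f] Cod_Obj[of f] by auto
  show ?thesis
    unfolding dual_arr_mate[OF assms] by (rule ev_mate) (use assms in \<open>simp_all add: rbase\<close>)
qed

lemma ev_dual_tensor:
  assumes "X \<in> Obj C" "Y \<in> Obj C"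
  shows "ev C (Y \<otimes>\<^sub>o X) \<cdot> (dual_tensor C X Y \<otimes>\<^sub>m Ide C (Y \<otimes>\<^sub>o X))
    = ev C X \<cdot> (Ide C (dual_obj C X) \<otimes>\<^sub>m ev C Y \<otimes>\<^sub>m Ide C X)"
  unfolding dual_tensor_mate[OF assms] by (rule ev_mate) (use assms in \<open>simp_all add: rbase\<close>)

lemma ev_bidual:
  assumes "X \<in> Obj C"
  shows "ev C (dual_obj C X) \<cdot> (bidual C X \<otimes>\<^sub>m Ide C (dual_obj C X)) = ev_r C X"
  unfolding bidual_mate by (rule ev_mate) (use assms in \<open>simp_all add: rbase ev_r_typing\<close>)

text \<open>
  Sliding an arrow around the cup; the proof straightens the strand in the definition of the dual arrow.
\<close>

lemma coev_dual_arr: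
  assumes [simp]: "f \<in> Arr C" "Dom C f = X" "Cod C f = Y"
  shows "(Ide C Y \<otimes>\<^sub>m dual_arr C f) \<cdot> coev C Y = (f \<otimes>\<^sub>m Ide C (dual_obj C X)) \<cdot> coev C X"
proof -
  have [simp]: "X \<in> Obj C" "Y \<in> Obj C"
    using assms Dom_Obj[of f] Cod_Obj[of f] by auto
  let ?X' = "Ide C (dual_obj C X)" and ?Y = "Ide C Y" and ?Y' = "Ide C (dual_obj C Y)"
  define w where "w = (f \<otimes>\<^sub>m ?X') \<cdot> coev C X"
  have [simp]: "w \<in> Arr C" "Dom C w = \<bbbone>" "Cod C w = Y \<otimes>\<^sub>o dual_obj C X"
    by (simp_all add: w_def rbase)
  have "dual_arr C f = (ev C Y \<otimes>\<^sub>m ?X') \<cdot> (?Y' \<otimes>\<^sub>m w)"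
    by (simp add: dual_arr_def Let_def w_def rlayers)
  then have "(?Y \<otimes>\<^sub>m dual_arr C f) \<cdot> coev C Y
      = (?Y \<otimes>\<^sub>m ev C Y \<otimes>\<^sub>m ?X') \<cdot> ((Ide C (Y \<otimes>\<^sub>o dual_obj C Y) \<otimes>\<^sub>m w) \<cdot> coev C Y)"
    by (simp add: rlayers)
  also have "(Ide C (Y \<otimes>\<^sub>o dual_obj C Y) \<otimes>\<^sub>m w) \<cdot> coev C Y = coev C Y \<otimes>\<^sub>m w"
    by (rule slide_unit_source) (simp_all add: rbase)
  also have "\<dots> = (coev C Y \<otimes>\<^sub>m Ide C (Y \<otimes>\<^sub>o dual_obj C X)) \<cdot> w"
    by (rule slide_unit_source[symmetric]) (simp_all add: rbase)
  also have "(?Y \<otimes>\<^sub>m ev C Y \<otimes>\<^sub>m ?X') \<cdot> \<dots>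
      = (((?Y \<otimes>\<^sub>m ev C Y) \<cdot> (coev C Y \<otimes>\<^sub>m ?Y)) \<otimes>\<^sub>m ?X') \<cdot> w"
    by (simp add: rlayers)
  also have "\<dots> = w"
    by (simp only: zigzag_rules \<open>Y \<in> Obj C\<close>) (simp add: rlayers)
  finally show ?thesis
    by (simp add: w_def)
qed

lemma dual_Ide:
  assumes [simp]: "X \<in> Obj C"
  shows "dual_arr C (Ide C X) = Ide C (dual_obj C X)"
  by (rule mate_eqI[of _ _ X "dual_obj C X"])
    (use ev_dual_arr[of "Ide C X" X X] in \<open>simp_all add: dbase\<close>)

lemma dual_Comp:
  assumes [simp]: "f \<in> Arr C" "g \<in> Arr C" "Dom C g = Cod C f"
  shows "dual_arr C (g \<cdot> f) = dual_arr C f \<cdot> dual_arr C g"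
proof (rule mate_eqI[of _ _ "Dom C f" "dual_obj C (Cod C g)"])
  let ?X = "Dom C f" and ?Y = "Cod C f" and ?Z = "Cod C g"
  have "ev C ?X \<cdot> ((dual_arr C f \<cdot> dual_arr C g) \<otimes>\<^sub>m Ide C ?X)
      = (ev C ?X \<cdot> (dual_arr C f \<otimes>\<^sub>m Ide C ?X)) \<cdot> (dual_arr C g \<otimes>\<^sub>m Ide C ?X)"
    by (simp add: dlayers)
  also have "\<dots> = ev C ?Y \<cdot> (Ide C (dual_obj C ?Y) \<otimes>\<^sub>m f) \<cdot> (dual_arr C g \<otimes>\<^sub>m Ide C ?X)"
    by (simp add: ev_dual_arr[OF _ _ refl])
  also have "\<dots> = ev C ?Y \<cdot> (dual_arr C g \<otimes>\<^sub>m Ide C ?Y) \<cdot> (Ide C (dual_obj C ?Z) \<otimes>\<^sub>m f)"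
    by (simp add: dmerge)
  also have "\<dots> = ev C ?Z \<cdot> (Ide C (dual_obj C ?Z) \<otimes>\<^sub>m g) \<cdot> (Ide C (dual_obj C ?Z) \<otimes>\<^sub>m f)"
    using ev_dual_arr[of g ?Y ?Z] by simp
  also have "\<dots> = ev C ?X \<cdot> (dual_arr C (g \<cdot> f) \<otimes>\<^sub>m Ide C ?X)"
    by (simp add: ev_dual_arr[of "g \<cdot> f" ?X ?Z] dlayers)
  finally show "ev C ?X \<cdot> (dual_arr C (g \<cdot> f) \<otimes>\<^sub>m Ide C ?X)
    = ev C ?X \<cdot> ((dual_arr C f \<cdot> dual_arr C g) \<otimes>\<^sub>m Ide C ?X)" ..
qed (simp_all add: dbase)

section \<open>The right duality\<close>

lemma inverse_braid_cancel:
  "\<lbrakk>X \<in> Obj C; Y \<in> Obj C; r \<in> Arr C; Cod C r = X \<otimes>\<^sub>o Y\<rbrakk>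
    \<Longrightarrow> inverse_of C (braid C X Y) \<cdot> (braid C X Y \<cdot> r) = r"
  "\<lbrakk>X \<in> Obj C; Y \<in> Obj C; r \<in> Arr C; Cod C r = Y \<otimes>\<^sub>o X\<rbrakk>
    \<Longrightarrow> braid C X Y \<cdot> (inverse_of C (braid C X Y) \<cdot> r) = r"
  by (simp_all add: Comp_reassoc[symmetric] inverse_braid braid_typing Comp_unit)

lemma inverse_twist_cancel:
  "\<lbrakk>X \<in> Obj C; r \<in> Arr C; Cod C r = X\<rbrakk> \<Longrightarrow> inverse_of C (twist C X) \<cdot> (twist C X \<cdot> r) = r"
  "\<lbrakk>X \<in> Obj C; r \<in> Arr C; Cod C r = X\<rbrakk> \<Longrightarrow> twist C X \<cdot> (inverse_of C (twist C X) \<cdot> r) = r"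
  by (simp_all add: Comp_reassoc[symmetric] inverse_twist twist_typing Comp_unit)

lemmas cancel = inverse_braid_cancel inverse_twist_cancel inverse_braid(4,5) inverse_twist(4,5)

text \<open>
  The definition of \<open>coev_r\<close> uses the inverse braiding and the inverse twist; the braiding and the twist give the
  same arrow because \<open>coev X\<close> starts at the unit object, whose twist is trivial: naturality of the twist and the
  formula for the twist of \<open>X \<otimes> X'\<close> show that a double braiding with two twists has no effect on it.
\<close>

lemma coev_r_alt:
  assumes [simp]: "X \<in> Obj C"
  shows "coev_r C X = braid C X (dual_obj C X) \<cdot> (twist C X \<otimes>\<^sub>m Ide C (dual_obj C X)) \<cdot> coev C X"
proof -
  let ?X' = "dual_obj C X"
  let ?t = "twist C X" and ?I = "Ide C ?X'" and ?c = "coev C X"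
  let ?R = "braid C X ?X' \<cdot> ((?t \<otimes>\<^sub>m ?I) \<cdot> ?c)"
  have t: "(Ide C X \<otimes>\<^sub>m twist C ?X') \<cdot> ?c = (?t \<otimes>\<^sub>m ?I) \<cdot> ?c"
    by (simp add: twist_dual coev_dual_arr[OF _ refl] rbase)
  have "?c = twist C (X \<otimes>\<^sub>o ?X') \<cdot> ?c"
    by (simp add: twist_nat rbase twist_unit)
  also have "\<dots> = braid C ?X' X \<cdot> (braid C X ?X' \<cdot> ((?t \<otimes>\<^sub>m ?I) \<cdot> ((Ide C X \<otimes>\<^sub>m twist C ?X') \<cdot> ?c)))"
    by (simp add: twist_tensor rmerge)
  also have "\<dots> = braid C ?X' X \<cdot> ((braid C X ?X' \<cdot> (?t \<otimes>\<^sub>m ?I)) \<cdot> ((?t \<otimes>\<^sub>m ?I) \<cdot> ?c))"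
    by (simp add: t rbase)
  also have "braid C X ?X' \<cdot> (?t \<otimes>\<^sub>m ?I) = (?I \<otimes>\<^sub>m ?t) \<cdot> braid C X ?X'"
    by (simp add: braid_nat rbase)
  finally have c: "?c = braid C ?X' X \<cdot> ((?I \<otimes>\<^sub>m ?t) \<cdot> ?R)"
    by (simp add: rbase)
  have "coev_r C X = (?I \<otimes>\<^sub>m inverse_of C ?t) \<cdot> (inverse_of C (braid C ?X' X) \<cdot> ?c)"
    by (simp add: coev_r_def rbase)
  also have "inverse_of C (braid C ?X' X) \<cdot> ?c = (?I \<otimes>\<^sub>m ?t) \<cdot> ?R"
    by (subst c) (simp add: cancel rbase)
  also have "(?I \<otimes>\<^sub>m inverse_of C ?t) \<cdot> \<dots> = ((?I \<otimes>\<^sub>m inverse_of C ?t) \<cdot> (?I \<otimes>\<^sub>m ?t)) \<cdot> ?R"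
    by (simp add: rbase)
  also have "(?I \<otimes>\<^sub>m inverse_of C ?t) \<cdot> (?I \<otimes>\<^sub>m ?t) = Ide C (?X' \<otimes>\<^sub>o X)"
    by (simp add: rmerge cancel)
  finally show ?thesis
    by (simp add: rbase)
qed

text \<open>
  The dual arrow, defined by the left duality, is also the dual arrow for the right duality; likewise in
  \<open>coev_r_dual_arr\<close>. This is the pivotal property of ribbon categories.
\<close>

lemma ev_r_dual_arr:
  assumes [simp]: "f \<in> Arr C" "Dom C f = X" "Cod C f = Y"
  shows "ev_r C X \<cdot> (Ide C X \<otimes>\<^sub>m dual_arr C f) = ev_r C Y \<cdot> (f \<otimes>\<^sub>m Ide C (dual_obj C Y))"
proof -
  have [simp]: "X \<in> Obj C" "Y \<in> Obj C"
    using assms Dom_Obj[of f] Cod_Obj[of f] by auto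
  let ?X' = "dual_obj C X" and ?Y' = "dual_obj C Y"
  have "ev_r C Y \<cdot> (f \<otimes>\<^sub>m Ide C ?Y')
      = ev C Y \<cdot> (braid C Y ?Y' \<cdot> ((twist C Y \<cdot> f) \<otimes>\<^sub>m Ide C ?Y'))"
    by (simp add: ev_r_def rlayers)
  also have "\<dots> = ev C Y \<cdot> ((braid C Y ?Y' \<cdot> (f \<otimes>\<^sub>m Ide C ?Y')) \<cdot> (twist C X \<otimes>\<^sub>m Ide C ?Y'))"
    by (simp add: twist_nat rlayers)
  also have "braid C Y ?Y' \<cdot> (f \<otimes>\<^sub>m Ide C ?Y') = (Ide C ?Y' \<otimes>\<^sub>m f) \<cdot> braid C X ?Y'"
    by (simp add: braid_nat rbase)
  also have "ev C Y \<cdot> (\<dots> \<cdot> (twist C X \<otimes>\<^sub>m Ide C ?Y'))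
      = (ev C Y \<cdot> (Ide C ?Y' \<otimes>\<^sub>m f)) \<cdot> (braid C X ?Y' \<cdot> (twist C X \<otimes>\<^sub>m Ide C ?Y'))"
    by (simp add: rbase)
  also have "ev C Y \<cdot> (Ide C ?Y' \<otimes>\<^sub>m f) = ev C X \<cdot> (dual_arr C f \<otimes>\<^sub>m Ide C X)"
    by (simp add: ev_dual_arr[OF _ _ refl])
  also have "\<dots> \<cdot> (braid C X ?Y' \<cdot> (twist C X \<otimes>\<^sub>m Ide C ?Y'))
      = ev C X \<cdot> (((dual_arr C f \<otimes>\<^sub>m Ide C X) \<cdot> braid C X ?Y') \<cdot> (twist C X \<otimes>\<^sub>m Ide C ?Y'))"
    by (simp add: dbase)
  also have "(dual_arr C f \<otimes>\<^sub>m Ide C X) \<cdot> braid C X ?Y' = braid C X ?X' \<cdot> (Ide C X \<otimes>\<^sub>m dual_arr C f)"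
    by (simp add: braid_nat dbase)
  also have "ev C X \<cdot> (\<dots> \<cdot> (twist C X \<otimes>\<^sub>m Ide C ?Y')) = ev_r C X \<cdot> (Ide C X \<otimes>\<^sub>m dual_arr C f)"
    by (simp add: ev_r_def dmerge)
  finally show ?thesis ..
qed

lemma coev_r_dual_arr:
  assumes [simp]: "f \<in> Arr C" "Dom C f = X" "Cod C f = Y"
  shows "(dual_arr C f \<otimes>\<^sub>m Ide C Y) \<cdot> coev_r C Y = (Ide C (dual_obj C X) \<otimes>\<^sub>m f) \<cdot> coev_r C X"
proof -
  have [simp]: "X \<in> Obj C" "Y \<in> Obj C"
    using assms Dom_Obj[of f] Cod_Obj[of f] by auto
  let ?X' = "dual_obj C X" and ?Y' = "dual_obj C Y"
  have "(dual_arr C f \<otimes>\<^sub>m Ide C Y) \<cdot> coev_r C Y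
      = ((dual_arr C f \<otimes>\<^sub>m Ide C Y) \<cdot> braid C Y ?Y') \<cdot> ((twist C Y \<otimes>\<^sub>m Ide C ?Y') \<cdot> coev C Y)"
    by (simp add: coev_r_alt dbase)
  also have "(dual_arr C f \<otimes>\<^sub>m Ide C Y) \<cdot> braid C Y ?Y' = braid C Y ?X' \<cdot> (Ide C Y \<otimes>\<^sub>m dual_arr C f)"
    by (simp add: braid_nat dbase)
  also have "\<dots> \<cdot> ((twist C Y \<otimes>\<^sub>m Ide C ?Y') \<cdot> coev C Y)
      = braid C Y ?X' \<cdot> ((twist C Y \<otimes>\<^sub>m Ide C ?X') \<cdot> ((Ide C Y \<otimes>\<^sub>m dual_arr C f) \<cdot> coev C Y))"
    by (simp add: dmerge)
  also have "(Ide C Y \<otimes>\<^sub>m dual_arr C f) \<cdot> coev C Y = (f \<otimes>\<^sub>m Ide C ?X') \<cdot> coev C X"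
    by (simp add: coev_dual_arr[OF _ refl])
  also have "braid C Y ?X' \<cdot> ((twist C Y \<otimes>\<^sub>m Ide C ?X') \<cdot> \<dots>)
      = braid C Y ?X' \<cdot> (((twist C Y \<cdot> f) \<otimes>\<^sub>m Ide C ?X') \<cdot> coev C X)"
    by (simp add: rlayers)
  also have "\<dots> = (braid C Y ?X' \<cdot> (f \<otimes>\<^sub>m Ide C ?X')) \<cdot> ((twist C X \<otimes>\<^sub>m Ide C ?X') \<cdot> coev C X)"
    by (simp add: twist_nat rlayers)
  also have "braid C Y ?X' \<cdot> (f \<otimes>\<^sub>m Ide C ?X') = (Ide C ?X' \<otimes>\<^sub>m f) \<cdot> braid C X ?X'"
    by (simp add: braid_nat rbase)
  finally show ?thesis
    by (simp add: coev_r_alt dbase)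
qed

text \<open>
  The twist and its inverse can be moved to the two ends of the strand, where they cancel. What remains is
  a strand with the braiding of the cap and the inverse braiding of the cup. Naturality lets the strand X pass
  the whole cup at the price of an inverse braiding of X with itself, and this one and the inverse braiding
  of the cup are undone by passing X through the cap.
\<close>

lemma zigzag_r:
  assumes [simp]: "X \<in> Obj C"
  shows "(ev_r C X \<otimes>\<^sub>m Ide C X) \<cdot> (Ide C X \<otimes>\<^sub>m coev_r C X) = Ide C X"
proof -
  let ?X' = "dual_obj C X"
  let ?A = "braid C X ?X'" and ?B = "braid C ?X' X" and ?V = "braid C X X"
  let ?I = "Ide C X" and ?I' = "Ide C ?X'" and ?t = "twist C X"
  define k where "k = inverse_of C ?B \<cdot> coev C X"
  have [simp]: "k \<in> Arr C" "Dom C k = \<bbbone>" "Cod C k = ?X' \<otimes>\<^sub>o X"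
    by (simp_all add: k_def rbase)
  have A: "?A \<otimes>\<^sub>m ?I = (?I' \<otimes>\<^sub>m inverse_of C ?V) \<cdot> braid C X (?X' \<otimes>\<^sub>o X)"
    by (simp add: braid_tensor_right rmerge cancel)
  have k: "braid C X (?X' \<otimes>\<^sub>o X) \<cdot> (?I \<otimes>\<^sub>m k) = k \<otimes>\<^sub>m ?I"
    by (simp add: braid_nat rbase braid_unit)
  have "braid C \<bbbone> X \<cdot> (ev C X \<otimes>\<^sub>m ?I) = (?I \<otimes>\<^sub>m ev C X) \<cdot> braid C (?X' \<otimes>\<^sub>o X) X"
    by (simp add: braid_nat rbase)
  then have ev: "ev C X \<otimes>\<^sub>m ?I = (?I \<otimes>\<^sub>m ev C X) \<cdot> ((?B \<otimes>\<^sub>m ?I) \<cdot> (?I' \<otimes>\<^sub>m ?V))"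
    by (simp add: braid_tensor_left rbase braid_unit)
  have "(ev C X \<otimes>\<^sub>m ?I) \<cdot> ((?A \<otimes>\<^sub>m ?I) \<cdot> (?I \<otimes>\<^sub>m k))
      = (ev C X \<otimes>\<^sub>m ?I) \<cdot> ((?I' \<otimes>\<^sub>m inverse_of C ?V) \<cdot> (k \<otimes>\<^sub>m ?I))"
    unfolding A k[symmetric] by (simp add: rbase)
  also have "\<dots> = (?I \<otimes>\<^sub>m ev C X) \<cdot> ((?B \<otimes>\<^sub>m ?I)
      \<cdot> (((?I' \<otimes>\<^sub>m ?V) \<cdot> (?I' \<otimes>\<^sub>m inverse_of C ?V)) \<cdot> (k \<otimes>\<^sub>m ?I)))"
    unfolding ev by (simp add: rbase)
  also have "(?I' \<otimes>\<^sub>m ?V) \<cdot> (?I' \<otimes>\<^sub>m inverse_of C ?V) = Ide C (?X' \<otimes>\<^sub>o X \<otimes>\<^sub>o X)"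
    by (simp add: rmerge cancel)
  also have "(?B \<otimes>\<^sub>m ?I) \<cdot> (\<dots> \<cdot> (k \<otimes>\<^sub>m ?I)) = coev C X \<otimes>\<^sub>m ?I"
    by (simp add: k_def rmerge cancel)
  finally have core: "(ev C X \<otimes>\<^sub>m ?I) \<cdot> ((?A \<otimes>\<^sub>m ?I) \<cdot> (?I \<otimes>\<^sub>m k)) = ?I"
    by (simp add: zigzag_rules)
  have "(ev_r C X \<otimes>\<^sub>m ?I) \<cdot> (?I \<otimes>\<^sub>m coev_r C X)
      = ((ev C X \<cdot> ?A) \<otimes>\<^sub>m ?I) \<cdot> (((?t \<otimes>\<^sub>m Ide C (?X' \<otimes>\<^sub>o X))
         \<cdot> (Ide C (X \<otimes>\<^sub>o ?X') \<otimes>\<^sub>m inverse_of C ?t)) \<cdot> (?I \<otimes>\<^sub>m k))"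
    by (simp add: ev_r_def coev_r_def k_def rlayers)
  also have "(?t \<otimes>\<^sub>m Ide C (?X' \<otimes>\<^sub>o X)) \<cdot> (Ide C (X \<otimes>\<^sub>o ?X') \<otimes>\<^sub>m inverse_of C ?t)
      = (Ide C (X \<otimes>\<^sub>o ?X') \<otimes>\<^sub>m inverse_of C ?t) \<cdot> (?t \<otimes>\<^sub>m Ide C (?X' \<otimes>\<^sub>o X))"
    by (simp add: rmerge)
  also have "((ev C X \<cdot> ?A) \<otimes>\<^sub>m ?I) \<cdot> (\<dots> \<cdot> (?I \<otimes>\<^sub>m k))
      = (((ev C X \<cdot> ?A) \<otimes>\<^sub>m ?I) \<cdot> (Ide C (X \<otimes>\<^sub>o ?X') \<otimes>\<^sub>m inverse_of C ?t))
         \<cdot> ((?t \<otimes>\<^sub>m Ide C (?X' \<otimes>\<^sub>o X)) \<cdot> (?I \<otimes>\<^sub>m k))"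
    by (simp add: rlayers)
  also have "((ev C X \<cdot> ?A) \<otimes>\<^sub>m ?I) \<cdot> (Ide C (X \<otimes>\<^sub>o ?X') \<otimes>\<^sub>m inverse_of C ?t)
      = (ev C X \<cdot> ?A) \<otimes>\<^sub>m inverse_of C ?t"
    by (rule slide_left) (simp_all add: rbase)
  also have "\<dots> = inverse_of C ?t \<cdot> ((ev C X \<cdot> ?A) \<otimes>\<^sub>m ?I)"
    by (rule slide_unit_target[symmetric]) (simp_all add: rbase)
  also have "(?t \<otimes>\<^sub>m Ide C (?X' \<otimes>\<^sub>o X)) \<cdot> (?I \<otimes>\<^sub>m k) = ?t \<otimes>\<^sub>m k"
    by (rule slide_left) (simp_all add: rbase)
  also have "\<dots> = (?I \<otimes>\<^sub>m k) \<cdot> ?t"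
    by (rule slide_unit_source[symmetric]) (simp_all add: rbase)
  also have "(inverse_of C ?t \<cdot> ((ev C X \<cdot> ?A) \<otimes>\<^sub>m ?I)) \<cdot> \<dots>
      = inverse_of C ?t \<cdot> (((ev C X \<otimes>\<^sub>m ?I) \<cdot> ((?A \<otimes>\<^sub>m ?I) \<cdot> (?I \<otimes>\<^sub>m k))) \<cdot> ?t)"
    by (simp add: rlayers)
  also have "\<dots> = ?I"
    unfolding core by (simp add: rbase cancel)
  finally show ?thesis .
qed

lemma zigzag_r_dual:
  assumes [simp]: "X \<in> Obj C"
  shows "(Ide C (dual_obj C X) \<otimes>\<^sub>m ev_r C X) \<cdot> (coev_r C X \<otimes>\<^sub>m Ide C (dual_obj C X)) = Ide C (dual_obj C X)"
proof -
  let ?X' = "dual_obj C X"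
  let ?A = "braid C X ?X'" and ?B = "braid C ?X' X" and ?V = "braid C ?X' ?X'"
  let ?I = "Ide C X" and ?I' = "Ide C ?X'" and ?t = "twist C X"
  define k where "k = inverse_of C ?B \<cdot> coev C X"
  have [simp]: "k \<in> Arr C" "Dom C k = \<bbbone>" "Cod C k = ?X' \<otimes>\<^sub>o X"
    by (simp_all add: k_def rbase)
  have A: "?I' \<otimes>\<^sub>m ?A = (inverse_of C ?V \<otimes>\<^sub>m ?I) \<cdot> braid C (?X' \<otimes>\<^sub>o X) ?X'"
    by (simp add: braid_tensor_left rmerge cancel)
  have k: "braid C (?X' \<otimes>\<^sub>o X) ?X' \<cdot> (k \<otimes>\<^sub>m ?I') = ?I' \<otimes>\<^sub>m k"
    by (simp add: braid_nat rbase braid_unit)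
  have "braid C ?X' \<bbbone> \<cdot> (?I' \<otimes>\<^sub>m ev C X) = (ev C X \<otimes>\<^sub>m ?I') \<cdot> braid C ?X' (?X' \<otimes>\<^sub>o X)"
    by (simp add: braid_nat rbase)
  then have ev: "?I' \<otimes>\<^sub>m ev C X = (ev C X \<otimes>\<^sub>m ?I') \<cdot> ((?I' \<otimes>\<^sub>m ?B) \<cdot> (?V \<otimes>\<^sub>m ?I))"
    by (simp add: braid_tensor_right rbase braid_unit)
  have "(?I' \<otimes>\<^sub>m ev_r C X) \<cdot> (coev_r C X \<otimes>\<^sub>m ?I')
      = (?I' \<otimes>\<^sub>m ev C X) \<cdot> ((?I' \<otimes>\<^sub>m ?A) \<cdot> ((?I' \<otimes>\<^sub>m (?t \<cdot> inverse_of C ?t) \<otimes>\<^sub>m ?I') \<cdot> (k \<otimes>\<^sub>m ?I')))"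
    by (simp add: ev_r_def coev_r_def k_def rlayers)
  also have "\<dots> = (?I' \<otimes>\<^sub>m ev C X) \<cdot> ((?I' \<otimes>\<^sub>m ?A) \<cdot> (k \<otimes>\<^sub>m ?I'))"
    by (simp add: cancel rlayers)
  also have "\<dots> = (?I' \<otimes>\<^sub>m ev C X) \<cdot> ((inverse_of C ?V \<otimes>\<^sub>m ?I) \<cdot> (?I' \<otimes>\<^sub>m k))"
    unfolding A k[symmetric] by (simp add: rbase)
  also have "\<dots> = (ev C X \<otimes>\<^sub>m ?I') \<cdot> ((?I' \<otimes>\<^sub>m ?B)
      \<cdot> (((?V \<otimes>\<^sub>m ?I) \<cdot> (inverse_of C ?V \<otimes>\<^sub>m ?I)) \<cdot> (?I' \<otimes>\<^sub>m k)))"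
    unfolding ev by (simp add: rbase)
  also have "(?V \<otimes>\<^sub>m ?I) \<cdot> (inverse_of C ?V \<otimes>\<^sub>m ?I) = Ide C (?X' \<otimes>\<^sub>o ?X' \<otimes>\<^sub>o X)"
    by (simp add: rmerge cancel)
  also have "(?I' \<otimes>\<^sub>m ?B) \<cdot> (\<dots> \<cdot> (?I' \<otimes>\<^sub>m k)) = ?I' \<otimes>\<^sub>m coev C X"
    by (simp add: k_def rmerge cancel)
  finally show ?thesis
    by (simp add: zigzag_rules)
qed

section \<open>Cups of tensor products and of duals\<close>

text \<open>
  Nested cups form a cup for the tensor product, up to the canonical comparison of duals.
\<close>

lemma coev_dual_tensor:
  assumes [simp]: "X \<in> Obj C" "Y \<in> Obj C"
  shows "(Ide C (Y \<otimes>\<^sub>o X) \<otimes>\<^sub>m dual_tensor C X Y)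
      \<cdot> (Ide C Y \<otimes>\<^sub>m coev C X \<otimes>\<^sub>m Ide C (dual_obj C Y)) \<cdot> coev C Y = coev C (Y \<otimes>\<^sub>o X)"
proof -
  let ?X = "Ide C X" and ?Y = "Ide C Y" and ?X' = "Ide C (dual_obj C X)" and ?Y' = "Ide C (dual_obj C Y)"
  let ?b = "ev C X \<cdot> (?X' \<otimes>\<^sub>m ev C Y \<otimes>\<^sub>m ?X)"
  let ?n = "(?Y \<otimes>\<^sub>m coev C X \<otimes>\<^sub>m ?Y') \<cdot> coev C Y"
  let ?Z = "Ide C (Y \<otimes>\<^sub>o X)"
  have "(?Z \<otimes>\<^sub>m ?b) \<cdot> (?n \<otimes>\<^sub>m ?Z)
      = (?Z \<otimes>\<^sub>m ev C X) \<cdot> (((Ide C (Y \<otimes>\<^sub>o X \<otimes>\<^sub>o dual_obj C X) \<otimes>\<^sub>m (ev C Y \<otimes>\<^sub>m ?X))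
        \<cdot> ((?Y \<otimes>\<^sub>m coev C X) \<otimes>\<^sub>m Ide C (dual_obj C Y \<otimes>\<^sub>o Y \<otimes>\<^sub>o X))) \<cdot> (coev C Y \<otimes>\<^sub>m ?Z))"
    by (simp add: rlayers)
  also have "(Ide C (Y \<otimes>\<^sub>o X \<otimes>\<^sub>o dual_obj C X) \<otimes>\<^sub>m (ev C Y \<otimes>\<^sub>m ?X))
        \<cdot> ((?Y \<otimes>\<^sub>m coev C X) \<otimes>\<^sub>m Ide C (dual_obj C Y \<otimes>\<^sub>o Y \<otimes>\<^sub>o X))
      = (?Y \<otimes>\<^sub>m coev C X) \<otimes>\<^sub>m (ev C Y \<otimes>\<^sub>m ?X)"
    by (rule slide_right) (simp_all add: rbase)
  also have "\<dots> = ?Y \<otimes>\<^sub>m ((coev C X \<otimes>\<^sub>m ev C Y) \<otimes>\<^sub>m ?X)"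
    by (simp add: rbase)
  also have "coev C X \<otimes>\<^sub>m ev C Y = coev C X \<cdot> ev C Y"
    using slide_unit_target(2)[of "coev C X" "ev C Y" \<bbbone>] slide_unit_source(2)[of "ev C Y" "coev C X" \<bbbone>]
    by (simp add: rbase)
  also have "(?Z \<otimes>\<^sub>m ev C X) \<cdot> ((?Y \<otimes>\<^sub>m ((coev C X \<cdot> ev C Y) \<otimes>\<^sub>m ?X)) \<cdot> (coev C Y \<otimes>\<^sub>m ?Z))
      = (?Y \<otimes>\<^sub>m ((?X \<otimes>\<^sub>m ev C X) \<cdot> (coev C X \<otimes>\<^sub>m ?X))) \<cdot> (((?Y \<otimes>\<^sub>m ev C Y) \<cdot> (coev C Y \<otimes>\<^sub>m ?Y)) \<otimes>\<^sub>m ?X)"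
    by (simp add: rlayers)
  also have "\<dots> = ?Z"
    by (simp only: zigzag_rules assms) (simp add: rlayers)
  finally have "(Ide C (Y \<otimes>\<^sub>o X) \<otimes>\<^sub>m dual_tensor C X Y) \<cdot> ?n = coev C (Y \<otimes>\<^sub>o X)"
    unfolding dual_tensor_mate[OF assms] by (intro coev_mate) (simp_all add: rbase)
  then show ?thesis
    by (simp add: dbase)
qed

lemma dual_tensor_natural:
  assumes [simp]: "f \<in> Arr C" "Dom C f = X" "Cod C f = W" "g \<in> Arr C" "Dom C g = Y" "Cod C g = Z"
  shows "dual_arr C (g \<otimes>\<^sub>m f) \<cdot> dual_tensor C W Z = dual_tensor C X Y \<cdot> (dual_arr C f \<otimes>\<^sub>m dual_arr C g)"
proof -
  have [simp]: "X \<in> Obj C" "W \<in> Obj C" "Y \<in> Obj C" "Z \<in> Obj C"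
    using Dom_Obj[of f] Cod_Obj[of f] Dom_Obj[of g] Cod_Obj[of g] by auto
  let ?I = "Ide C (Y \<otimes>\<^sub>o X)" and ?J = "Ide C (dual_obj C W \<otimes>\<^sub>o dual_obj C Z)"
  let ?W' = "Ide C (dual_obj C W)" and ?Z' = "Ide C (dual_obj C Z)"
  have "ev C (Y \<otimes>\<^sub>o X) \<cdot> ((dual_arr C (g \<otimes>\<^sub>m f) \<cdot> dual_tensor C W Z) \<otimes>\<^sub>m ?I)
      = (ev C (Y \<otimes>\<^sub>o X) \<cdot> (dual_arr C (g \<otimes>\<^sub>m f) \<otimes>\<^sub>m ?I)) \<cdot> (dual_tensor C W Z \<otimes>\<^sub>m ?I)"
    by (simp add: dlayers)
  also have "ev C (Y \<otimes>\<^sub>o X) \<cdot> (dual_arr C (g \<otimes>\<^sub>m f) \<otimes>\<^sub>m ?I)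
      = ev C (Z \<otimes>\<^sub>o W) \<cdot> (Ide C (dual_obj C (Z \<otimes>\<^sub>o W)) \<otimes>\<^sub>m (g \<otimes>\<^sub>m f))"
    by (rule ev_dual_arr) (simp_all add: rbase)
  also have "\<dots> \<cdot> (dual_tensor C W Z \<otimes>\<^sub>m ?I)
      = (ev C (Z \<otimes>\<^sub>o W) \<cdot> (dual_tensor C W Z \<otimes>\<^sub>m Ide C (Z \<otimes>\<^sub>o W))) \<cdot> (?J \<otimes>\<^sub>m (g \<otimes>\<^sub>m f))"
    using slide_left[of "dual_tensor C W Z" "g \<otimes>\<^sub>m f" _ "Z \<otimes>\<^sub>o W"] slide_right[of "dual_tensor C W Z" "g \<otimes>\<^sub>m f" _ "Y \<otimes>\<^sub>o X"]
    by (simp add: dbase)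
  also have "\<dots> = ev C W \<cdot> (?W' \<otimes>\<^sub>m (ev C Z \<cdot> (?Z' \<otimes>\<^sub>m g)) \<otimes>\<^sub>m f)"
    unfolding ev_dual_tensor[OF \<open>W \<in> Obj C\<close> \<open>Z \<in> Obj C\<close>]
    using interchange[of "?Z' \<otimes>\<^sub>m g" "ev C Z" f "Ide C W"] by (simp add: rmerge)
  also have "ev C Z \<cdot> (?Z' \<otimes>\<^sub>m g) = ev C Y \<cdot> (dual_arr C g \<otimes>\<^sub>m Ide C Y)"
    by (rule ev_dual_arr[symmetric]) simp_all
  also have "ev C W \<cdot> (?W' \<otimes>\<^sub>m (ev C Y \<cdot> (dual_arr C g \<otimes>\<^sub>m Ide C Y)) \<otimes>\<^sub>m f)
     = (ev C W \<cdot> (?W' \<otimes>\<^sub>m f)) \<cdot> (?W' \<otimes>\<^sub>m (ev C Y \<cdot> (dual_arr C g \<otimes>\<^sub>m Ide C Y)) \<otimes>\<^sub>m Ide C X)"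
    using slide_unit_target(2)[of f "ev C Y \<cdot> (dual_arr C g \<otimes>\<^sub>m Ide C Y)" X] by (simp add: dmerge)
  also have "ev C W \<cdot> (?W' \<otimes>\<^sub>m f) = ev C X \<cdot> (dual_arr C f \<otimes>\<^sub>m Ide C X)"
    by (rule ev_dual_arr[symmetric]) simp_all
  also have "\<dots> \<cdot> (?W' \<otimes>\<^sub>m (ev C Y \<cdot> (dual_arr C g \<otimes>\<^sub>m Ide C Y)) \<otimes>\<^sub>m Ide C X)
      = (ev C X \<cdot> (Ide C (dual_obj C X) \<otimes>\<^sub>m ev C Y \<otimes>\<^sub>m Ide C X)) \<cdot> (dual_arr C f \<otimes>\<^sub>m dual_arr C g \<otimes>\<^sub>m ?I)"
    using interchange[of "dual_arr C g \<otimes>\<^sub>m Ide C Y" "ev C Y" "Ide C X" "Ide C X"] by (simp add: dmerge)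
  also have "\<dots> = ev C (Y \<otimes>\<^sub>o X) \<cdot> ((dual_tensor C X Y \<cdot> (dual_arr C f \<otimes>\<^sub>m dual_arr C g)) \<otimes>\<^sub>m ?I)"
    unfolding ev_dual_tensor[OF \<open>X \<in> Obj C\<close> \<open>Y \<in> Obj C\<close>, symmetric] by (simp add: dlayers)
  finally show ?thesis
    by (rule mate_eqI[rotated -1]) (simp_all add: dbase)
qed

lemma bidual_natural:
  assumes [simp]: "f \<in> Arr C" "Dom C f = X" "Cod C f = Y"
  shows "dual_arr C (dual_arr C f) \<cdot> bidual C X = bidual C Y \<cdot> f"
proof -
  have [simp]: "X \<in> Obj C" "Y \<in> Obj C"
    using assms Dom_Obj[of f] Cod_Obj[of f] by auto
  let ?X' = "dual_obj C X" and ?Y' = "dual_obj C Y"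
  have "ev C ?Y' \<cdot> ((dual_arr C (dual_arr C f) \<cdot> bidual C X) \<otimes>\<^sub>m Ide C ?Y')
      = (ev C ?Y' \<cdot> (dual_arr C (dual_arr C f) \<otimes>\<^sub>m Ide C ?Y')) \<cdot> (bidual C X \<otimes>\<^sub>m Ide C ?Y')"
    by (simp add: dlayers)
  also have "ev C ?Y' \<cdot> (dual_arr C (dual_arr C f) \<otimes>\<^sub>m Ide C ?Y')
      = ev C ?X' \<cdot> (Ide C (dual_obj C ?X') \<otimes>\<^sub>m dual_arr C f)"
    by (rule ev_dual_arr) (simp_all add: dbase)
  also have "\<dots> \<cdot> (bidual C X \<otimes>\<^sub>m Ide C ?Y')
      = (ev C ?X' \<cdot> (bidual C X \<otimes>\<^sub>m Ide C ?X')) \<cdot> (Ide C X \<otimes>\<^sub>m dual_arr C f)"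
    by (simp add: dmerge)
  also have "\<dots> = ev_r C Y \<cdot> (f \<otimes>\<^sub>m Ide C ?Y')"
    by (simp add: ev_bidual ev_r_dual_arr[of f X Y])
  also have "\<dots> = (ev C ?Y' \<cdot> (bidual C Y \<otimes>\<^sub>m Ide C ?Y')) \<cdot> (f \<otimes>\<^sub>m Ide C ?Y')"
    by (simp add: ev_bidual)
  also have "\<dots> = ev C ?Y' \<cdot> ((bidual C Y \<cdot> f) \<otimes>\<^sub>m Ide C ?Y')"
    by (simp add: dlayers)
  finally show ?thesis
    by (rule mate_eqI[rotated -1]) (simp_all add: dbase)
qed

text \<open>
  The right cup of X' is the left cup of X, once X is identified with its bidual. By
  \<open>coev_r_alt\<close> the braiding and the twist in \<open>coev_r X'\<close> turn the left cup of X into its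
  right cup, and \<open>bidual X\<close> straightens the latter.
\<close>

lemma coev_r_dual:
  assumes [simp]: "X \<in> Obj C"
  shows "(bidual C X \<otimes>\<^sub>m Ide C (dual_obj C X)) \<cdot> coev C X = coev_r C (dual_obj C X)"
proof -
  let ?X' = "dual_obj C X" and ?X'' = "dual_obj C (dual_obj C X)"
  let ?I' = "Ide C ?X'"
  let ?N = "(bidual C X \<otimes>\<^sub>m ?I') \<cdot> coev C X"
  have "(?I' \<otimes>\<^sub>m bidual C X) \<cdot> coev_r C X
      = ((?I' \<otimes>\<^sub>m ev_r C X) \<otimes>\<^sub>m Ide C ?X'') \<cdot> ((Ide C (?X' \<otimes>\<^sub>o X) \<otimes>\<^sub>m coev C ?X') \<cdot> coev_r C X)"
    by (simp add: bidual_mate mate_def dlayers)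
  also have "(Ide C (?X' \<otimes>\<^sub>o X) \<otimes>\<^sub>m coev C ?X') \<cdot> coev_r C X = coev_r C X \<otimes>\<^sub>m coev C ?X'"
    by (rule slide_unit_source) (simp_all add: dbase)
  also have "\<dots> = (coev_r C X \<otimes>\<^sub>m Ide C (?X' \<otimes>\<^sub>o ?X'')) \<cdot> coev C ?X'"
    by (rule slide_unit_source[symmetric]) (simp_all add: dbase)
  also have "((?I' \<otimes>\<^sub>m ev_r C X) \<otimes>\<^sub>m Ide C ?X'') \<cdot> \<dots>
      = (((?I' \<otimes>\<^sub>m ev_r C X) \<cdot> (coev_r C X \<otimes>\<^sub>m ?I')) \<otimes>\<^sub>m Ide C ?X'') \<cdot> coev C ?X'"
    by (simp add: dlayers)
  also have "\<dots> = coev C ?X'"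
    by (simp only: zigzag_r_dual assms) (simp add: rlayers)
  finally have b: "(?I' \<otimes>\<^sub>m bidual C X) \<cdot> coev_r C X = coev C ?X'" .
  have "braid C ?X'' ?X' \<cdot> ((Ide C ?X'' \<otimes>\<^sub>m twist C ?X') \<cdot> ?N)
      = (braid C ?X'' ?X' \<cdot> (bidual C X \<otimes>\<^sub>m ?I')) \<cdot> ((Ide C X \<otimes>\<^sub>m twist C ?X') \<cdot> coev C X)"
    by (simp add: dmerge)
  also have "(Ide C X \<otimes>\<^sub>m twist C ?X') \<cdot> coev C X = (twist C X \<otimes>\<^sub>m ?I') \<cdot> coev C X"
    by (simp add: twist_dual coev_dual_arr[OF _ refl] rbase)
  also have "braid C ?X'' ?X' \<cdot> (bidual C X \<otimes>\<^sub>m ?I') = (?I' \<otimes>\<^sub>m bidual C X) \<cdot> braid C X ?X'"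
    by (simp add: braid_nat dbase)
  also have "\<dots> \<cdot> ((twist C X \<otimes>\<^sub>m ?I') \<cdot> coev C X) = (?I' \<otimes>\<^sub>m bidual C X) \<cdot> coev_r C X"
    by (simp add: coev_r_alt dbase)
  finally have "braid C ?X'' ?X' \<cdot> ((Ide C ?X'' \<otimes>\<^sub>m twist C ?X') \<cdot> ?N) = coev C ?X'"
    by (simp add: b)
  then have "coev_r C ?X' = (Ide C ?X'' \<otimes>\<^sub>m inverse_of C (twist C ?X'))
      \<cdot> (inverse_of C (braid C ?X'' ?X') \<cdot> (braid C ?X'' ?X' \<cdot> ((Ide C ?X'' \<otimes>\<^sub>m twist C ?X') \<cdot> ?N)))"
    by (simp add: coev_r_def dbase)
  also have "\<dots> = ((Ide C ?X'' \<otimes>\<^sub>m inverse_of C (twist C ?X')) \<cdot> (Ide C ?X'' \<otimes>\<^sub>m twist C ?X')) \<cdot> ?N"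
    by (simp add: dbase cancel)
  also have "(Ide C ?X'' \<otimes>\<^sub>m inverse_of C (twist C ?X')) \<cdot> (Ide C ?X'' \<otimes>\<^sub>m twist C ?X') = Ide C (?X'' \<otimes>\<^sub>o ?X')"
    by (simp add: dmerge cancel)
  finally show ?thesis
    by (simp add: dbase)
qed

text \<open>
  A circle can be closed on either side: moving the twist and the braiding from the cap to the cup gives
  \<open>ev_r Y \<cdot> coev Y = ev Y \<cdot> coev_r Y\<close>. For \<open>Y = X'\<close> the identification of X with its bidual turns the
  right-hand side into a circle on X.
\<close>

lemma trace_Ide_dual:
  assumes [simp]: "X \<in> Obj C"
  shows "ev_r C (dual_obj C X) \<cdot> coev C (dual_obj C X) = ev_r C X \<cdot> coev C X"
proof -
  have *: "ev_r C Y \<cdot> coev C Y = ev C Y \<cdot> coev_r C Y" if "Y \<in> Obj C" for Y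
    using that by (simp add: ev_r_def coev_r_alt dbase)
  let ?X' = "dual_obj C X"
  have "ev_r C ?X' \<cdot> coev C ?X' = (ev C ?X' \<cdot> (bidual C X \<otimes>\<^sub>m Ide C ?X')) \<cdot> coev C X"
    by (simp add: * dbase coev_r_dual[symmetric])
  then show ?thesis
    by (simp add: ev_bidual)
qed

text \<open>
  Duality is full, because a strand can be bent back.
\<close>

lemma dual_arr_full:
  assumes [simp]: "u \<in> Arr C" "X \<in> Obj C" "Y \<in> Obj C" "Dom C u = dual_obj C Y" "Cod C u = dual_obj C X"
  obtains f where "f \<in> Hom C X Y" "dual_arr C f = u"
proof -
  let ?X = "Ide C X" and ?Y = "Ide C Y" and ?Y' = "Ide C (dual_obj C Y)"
  define f where "f = (?Y \<otimes>\<^sub>m (ev C X \<cdot> (u \<otimes>\<^sub>m ?X))) \<cdot> (coev C Y \<otimes>\<^sub>m ?X)"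
  have [simp]: "f \<in> Arr C" "Dom C f = X" "Cod C f = Y"
    by (simp_all add: f_def rbase)
  let ?b = "ev C X \<cdot> (u \<otimes>\<^sub>m ?X)"
  have "ev C X \<cdot> (dual_arr C f \<otimes>\<^sub>m ?X) = ev C Y \<cdot> (?Y' \<otimes>\<^sub>m f)"
    by (rule ev_dual_arr) simp_all
  also have "\<dots> = (ev C Y \<cdot> (Ide C (dual_obj C Y \<otimes>\<^sub>o Y) \<otimes>\<^sub>m ?b)) \<cdot> (?Y' \<otimes>\<^sub>m coev C Y \<otimes>\<^sub>m ?X)"
    by (simp add: f_def rlayers)
  also have "ev C Y \<cdot> (Ide C (dual_obj C Y \<otimes>\<^sub>o Y) \<otimes>\<^sub>m ?b) = ev C Y \<otimes>\<^sub>m ?b"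
    by (rule slide_unit_target) (simp_all add: rbase)
  also have "\<dots> = ?b \<cdot> (ev C Y \<otimes>\<^sub>m Ide C (dual_obj C Y \<otimes>\<^sub>o X))"
    by (rule slide_unit_target[symmetric]) (simp_all add: rbase)
  also have "\<dots> \<cdot> (?Y' \<otimes>\<^sub>m coev C Y \<otimes>\<^sub>m ?X) = ?b \<cdot> (((ev C Y \<otimes>\<^sub>m ?Y') \<cdot> (?Y' \<otimes>\<^sub>m coev C Y)) \<otimes>\<^sub>m ?X)"
    by (simp add: rlayers)
  also have "\<dots> = ?b"
    by (simp only: zigzag_rules assms) (simp add: rlayers)
  finally have "dual_arr C f = u"
    by (rule mate_eqI[rotated -1]) (simp_all add: dbase)
  then show thesis
    using that[of f] by (simp add: Hom_def)
qed

text \<open>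
  Nested right cups form a right cup. The argument undoes the right cup of \<open>Y \<otimes> X\<close>: a twist of
  \<open>Y \<otimes> X\<close> is a double braiding of Y with X and the two single twists, which turn the nested right
  cups into nested cups \<open>k Y\<close> and \<open>k X\<close> that are one crossing away from left cups. The double
  braiding then lets one cup leave the other, and the crossings that remain are those of \<open>coev X\<close> with a
  strand Y, past which it slides.
\<close>

lemma coev_r_tensor:
  assumes [simp]: "X \<in> Obj C" "Y \<in> Obj C"
  shows "coev_r C (Y \<otimes>\<^sub>o X) = (dual_tensor C X Y \<otimes>\<^sub>m Ide C (Y \<otimes>\<^sub>o X))
    \<cdot> (Ide C (dual_obj C X) \<otimes>\<^sub>m coev_r C Y \<otimes>\<^sub>m Ide C X) \<cdot> coev_r C X"
proof -
  let ?X' = "dual_obj C X" and ?Y' = "dual_obj C Y"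
  let ?Z = "Y \<otimes>\<^sub>o X" and ?W = "?X' \<otimes>\<^sub>o ?Y'"
  \<comment> \<open>The right cup of A without its twist; one braiding turns it into the left cup.\<close>
  define k where "k A = (Ide C (dual_obj C A) \<otimes>\<^sub>m twist C A) \<cdot> coev_r C A" for A
  have k_typing: "k A \<in> Arr C" "Dom C (k A) = \<bbbone>" "Cod C (k A) = dual_obj C A \<otimes>\<^sub>o A"
    if "A \<in> Obj C" for A
    using that by (simp_all add: k_def dbase)
  have braid_k: "braid C (dual_obj C A) A \<cdot> k A = coev C A" if "A \<in> Obj C" for A
    using that by (simp add: k_def coev_r_def dmerge cancel)
  note kbase = dbase k_typing
  note kmerge = dmerge k_typing
  note klayers = dlayers k_typing
  define M where "M = (Ide C ?X' \<otimes>\<^sub>m coev_r C Y \<otimes>\<^sub>m Ide C X) \<cdot> coev_r C X"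
  have M_typing [simp]: "M \<in> Arr C" "Dom C M = \<bbbone>" "Cod C M = ?X' \<otimes>\<^sub>o (?Y' \<otimes>\<^sub>o (Y \<otimes>\<^sub>o X))"
    by (simp_all add: M_def dbase)
  have 1: "(Ide C ?W \<otimes>\<^sub>m twist C Y \<otimes>\<^sub>m twist C X) \<cdot> M = (Ide C ?X' \<otimes>\<^sub>m k Y \<otimes>\<^sub>m Ide C X) \<cdot> k X"
  proof -
    have "(Ide C ?W \<otimes>\<^sub>m twist C Y \<otimes>\<^sub>m twist C X) \<cdot> M
        = (Ide C ?X' \<otimes>\<^sub>m (((Ide C ?Y' \<otimes>\<^sub>m twist C Y) \<otimes>\<^sub>m twist C X) \<cdot> (coev_r C Y \<otimes>\<^sub>m Ide C X))) \<cdot> coev_r C X"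
      by (simp add: M_def dmerge)
    also have "((Ide C ?Y' \<otimes>\<^sub>m twist C Y) \<otimes>\<^sub>m twist C X) \<cdot> (coev_r C Y \<otimes>\<^sub>m Ide C X) = k Y \<otimes>\<^sub>m twist C X"
      using interchange[of "coev_r C Y" "Ide C ?Y' \<otimes>\<^sub>m twist C Y" "Ide C X" "twist C X"]
      by (simp add: k_def dbase)
    also have "\<dots> = (k Y \<otimes>\<^sub>m Ide C X) \<cdot> twist C X"
      by (rule slide_unit_source[symmetric]) (simp_all add: kbase)
    finally show ?thesis
      by (simp add: k_def[of X] klayers)
  qed
  \<comment> \<open>One crossing of the double braiding of Y with X lets the cup of Y leave the cup of X.\<close>
  have 2: "(Ide C ?W \<otimes>\<^sub>m braid C Y X) \<cdot> ((Ide C ?X' \<otimes>\<^sub>m k Y \<otimes>\<^sub>m Ide C X) \<cdot> k X)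
      = (Ide C ?X' \<otimes>\<^sub>m inverse_of C (braid C ?Y' X) \<otimes>\<^sub>m Ide C Y) \<cdot> ((Ide C (?X' \<otimes>\<^sub>o X) \<otimes>\<^sub>m k Y) \<cdot> k X)"
  proof -
    have "Ide C X \<otimes>\<^sub>m k Y = braid C (?Y' \<otimes>\<^sub>o Y) X \<cdot> (k Y \<otimes>\<^sub>m Ide C X)"
      by (simp add: braid_nat kbase braid_unit)
    also have "\<dots> = (braid C ?Y' X \<otimes>\<^sub>m Ide C Y) \<cdot> ((Ide C ?Y' \<otimes>\<^sub>m braid C Y X) \<cdot> (k Y \<otimes>\<^sub>m Ide C X))"
      by (simp add: braid_tensor_left kbase)
    finally have "(inverse_of C (braid C ?Y' X) \<otimes>\<^sub>m Ide C Y) \<cdot> (Ide C X \<otimes>\<^sub>m k Y)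
        = ((inverse_of C (braid C ?Y' X) \<otimes>\<^sub>m Ide C Y) \<cdot> (braid C ?Y' X \<otimes>\<^sub>m Ide C Y))
          \<cdot> ((Ide C ?Y' \<otimes>\<^sub>m braid C Y X) \<cdot> (k Y \<otimes>\<^sub>m Ide C X))"
      by (simp add: kbase)
    also have "(inverse_of C (braid C ?Y' X) \<otimes>\<^sub>m Ide C Y) \<cdot> (braid C ?Y' X \<otimes>\<^sub>m Ide C Y)
        = Ide C (?Y' \<otimes>\<^sub>o X \<otimes>\<^sub>o Y)"
      by (simp add: kmerge cancel)
    finally have "(inverse_of C (braid C ?Y' X) \<otimes>\<^sub>m Ide C Y) \<cdot> (Ide C X \<otimes>\<^sub>m k Y)
        = (Ide C ?Y' \<otimes>\<^sub>m braid C Y X) \<cdot> (k Y \<otimes>\<^sub>m Ide C X)"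
      by (simp add: kbase)
    then have "(Ide C ?X' \<otimes>\<^sub>m ((inverse_of C (braid C ?Y' X) \<otimes>\<^sub>m Ide C Y) \<cdot> (Ide C X \<otimes>\<^sub>m k Y))) \<cdot> k X
        = (Ide C ?X' \<otimes>\<^sub>m ((Ide C ?Y' \<otimes>\<^sub>m braid C Y X) \<cdot> (k Y \<otimes>\<^sub>m Ide C X))) \<cdot> k X"
      by simp
    then show ?thesis
      by (simp add: klayers)
  qed
  \<comment> \<open>The crossing of Y' with X created by the previous step cancels.\<close>
  have 3: "braid C ?W (X \<otimes>\<^sub>o Y) \<cdot> (Ide C ?X' \<otimes>\<^sub>m inverse_of C (braid C ?Y' X) \<otimes>\<^sub>m Ide C Y)
      = (Ide C X \<otimes>\<^sub>m braid C ?W Y) \<cdot> (braid C ?X' X \<otimes>\<^sub>m Ide C (?Y' \<otimes>\<^sub>o Y))"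
  proof -
    have i: "(Ide C ?X' \<otimes>\<^sub>m braid C ?Y' X \<otimes>\<^sub>m Ide C Y)
        \<cdot> (Ide C ?X' \<otimes>\<^sub>m inverse_of C (braid C ?Y' X) \<otimes>\<^sub>m Ide C Y) = Ide C (?X' \<otimes>\<^sub>o X \<otimes>\<^sub>o ?Y' \<otimes>\<^sub>o Y)"
      by (simp add: kmerge cancel)
    have "braid C ?W (X \<otimes>\<^sub>o Y) \<cdot> (Ide C ?X' \<otimes>\<^sub>m inverse_of C (braid C ?Y' X) \<otimes>\<^sub>m Ide C Y)
      = (Ide C X \<otimes>\<^sub>m braid C ?W Y) \<cdot> ((braid C ?X' X \<otimes>\<^sub>m Ide C (?Y' \<otimes>\<^sub>o Y))
        \<cdot> ((Ide C ?X' \<otimes>\<^sub>m braid C ?Y' X \<otimes>\<^sub>m Ide C Y)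
          \<cdot> (Ide C ?X' \<otimes>\<^sub>m inverse_of C (braid C ?Y' X) \<otimes>\<^sub>m Ide C Y)))"
      by (simp add: braid_tensor_right[of _ X Y] braid_tensor_left[of _ _ X] klayers)
    then show ?thesis
      unfolding i by (simp add: klayers)
  qed
  have 4: "(braid C ?X' X \<otimes>\<^sub>m Ide C (?Y' \<otimes>\<^sub>o Y)) \<cdot> ((Ide C (?X' \<otimes>\<^sub>o X) \<otimes>\<^sub>m k Y) \<cdot> k X)
      = (Ide C (X \<otimes>\<^sub>o ?X') \<otimes>\<^sub>m k Y) \<cdot> coev C X"
  proof -
    have "(braid C ?X' X \<otimes>\<^sub>m Ide C (?Y' \<otimes>\<^sub>o Y)) \<cdot> (Ide C (?X' \<otimes>\<^sub>o X) \<otimes>\<^sub>m k Y) = braid C ?X' X \<otimes>\<^sub>m k Y"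
      by (rule slide_left) (simp_all add: kbase)
    also have "\<dots> = (Ide C (X \<otimes>\<^sub>o ?X') \<otimes>\<^sub>m k Y) \<cdot> braid C ?X' X"
      by (rule slide_unit_source[symmetric]) (simp_all add: kbase)
    finally have "((braid C ?X' X \<otimes>\<^sub>m Ide C (?Y' \<otimes>\<^sub>o Y)) \<cdot> (Ide C (?X' \<otimes>\<^sub>o X) \<otimes>\<^sub>m k Y)) \<cdot> k X
        = ((Ide C (X \<otimes>\<^sub>o ?X') \<otimes>\<^sub>m k Y) \<cdot> braid C ?X' X) \<cdot> k X"
      by simp
    then show ?thesis
      by (simp add: kbase braid_k)
  qed
  have 5: "(Ide C X \<otimes>\<^sub>m braid C ?W Y) \<cdot> ((Ide C (X \<otimes>\<^sub>o ?X') \<otimes>\<^sub>m k Y) \<cdot> coev C X)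
      = (Ide C X \<otimes>\<^sub>m braid C ?X' Y \<otimes>\<^sub>m Ide C ?Y') \<cdot> ((coev C X \<otimes>\<^sub>m Ide C (Y \<otimes>\<^sub>o ?Y')) \<cdot> coev C Y)"
  proof -
    have "(Ide C X \<otimes>\<^sub>m braid C ?W Y) \<cdot> ((Ide C (X \<otimes>\<^sub>o ?X') \<otimes>\<^sub>m k Y) \<cdot> coev C X)
        = (Ide C X \<otimes>\<^sub>m braid C ?X' Y \<otimes>\<^sub>m Ide C ?Y')
          \<cdot> ((Ide C (X \<otimes>\<^sub>o ?X') \<otimes>\<^sub>m (braid C ?Y' Y \<cdot> k Y)) \<cdot> coev C X)"
      by (simp add: braid_tensor_left klayers)
    also have "braid C ?Y' Y \<cdot> k Y = coev C Y"
      by (simp add: braid_k)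
    also have "(Ide C (X \<otimes>\<^sub>o ?X') \<otimes>\<^sub>m coev C Y) \<cdot> coev C X = coev C X \<otimes>\<^sub>m coev C Y"
      by (rule slide_unit_source) (simp_all add: kbase)
    also have "\<dots> = (coev C X \<otimes>\<^sub>m Ide C (Y \<otimes>\<^sub>o ?Y')) \<cdot> coev C Y"
      by (rule slide_unit_source[symmetric]) (simp_all add: kbase)
    finally show ?thesis .
  qed
  \<comment> \<open>The remaining crossings of Y with X and X' form a braiding, through which \<open>coev X\<close> passes.\<close>
  have 6: "(braid C X Y \<otimes>\<^sub>m Ide C ?W)
        \<cdot> ((Ide C X \<otimes>\<^sub>m braid C ?X' Y \<otimes>\<^sub>m Ide C ?Y') \<cdot> ((coev C X \<otimes>\<^sub>m Ide C (Y \<otimes>\<^sub>o ?Y')) \<cdot> coev C Y))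
      = (Ide C Y \<otimes>\<^sub>m coev C X \<otimes>\<^sub>m Ide C ?Y') \<cdot> coev C Y"
  proof -
    have "braid C (X \<otimes>\<^sub>o ?X') Y \<cdot> (coev C X \<otimes>\<^sub>m Ide C Y) = Ide C Y \<otimes>\<^sub>m coev C X"
      by (simp add: braid_nat kbase braid_unit)
    then have "(Ide C Y \<otimes>\<^sub>m coev C X \<otimes>\<^sub>m Ide C ?Y') \<cdot> coev C Y
        = ((((braid C X Y \<otimes>\<^sub>m Ide C ?X') \<cdot> (Ide C X \<otimes>\<^sub>m braid C ?X' Y)) \<cdot> (coev C X \<otimes>\<^sub>m Ide C Y)) \<otimes>\<^sub>m Ide C ?Y') \<cdot> coev C Y"
      by (simp add: braid_tensor_left dual_Obj)
    then show ?thesis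
      by (simp add: klayers)
  qed
  have "braid C ?W ?Z \<cdot> ((Ide C ?W \<otimes>\<^sub>m twist C ?Z) \<cdot> M)
      = (braid C ?W ?Z \<cdot> (Ide C ?W \<otimes>\<^sub>m braid C X Y))
        \<cdot> ((Ide C ?W \<otimes>\<^sub>m braid C Y X) \<cdot> ((Ide C ?W \<otimes>\<^sub>m twist C Y \<otimes>\<^sub>m twist C X) \<cdot> M))"
    by (simp add: twist_tensor klayers)
  also have "braid C ?W ?Z \<cdot> (Ide C ?W \<otimes>\<^sub>m braid C X Y) = (braid C X Y \<otimes>\<^sub>m Ide C ?W) \<cdot> braid C ?W (X \<otimes>\<^sub>o Y)"
    using braid_nat[of "Ide C ?W" "braid C X Y" ?W ?Z] by (simp add: kbase)
  also have "\<dots> \<cdot> ((Ide C ?W \<otimes>\<^sub>m braid C Y X) \<cdot> ((Ide C ?W \<otimes>\<^sub>m twist C Y \<otimes>\<^sub>m twist C X) \<cdot> M))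
      = (braid C X Y \<otimes>\<^sub>m Ide C ?W) \<cdot> ((braid C ?W (X \<otimes>\<^sub>o Y)
        \<cdot> (Ide C ?X' \<otimes>\<^sub>m inverse_of C (braid C ?Y' X) \<otimes>\<^sub>m Ide C Y)) \<cdot> ((Ide C (?X' \<otimes>\<^sub>o X) \<otimes>\<^sub>m k Y) \<cdot> k X))"
    unfolding 1 2 by (simp add: kbase)
  also have "\<dots> = (braid C X Y \<otimes>\<^sub>m Ide C ?W) \<cdot> ((Ide C X \<otimes>\<^sub>m braid C ?W Y)
      \<cdot> ((braid C ?X' X \<otimes>\<^sub>m Ide C (?Y' \<otimes>\<^sub>o Y)) \<cdot> ((Ide C (?X' \<otimes>\<^sub>o X) \<otimes>\<^sub>m k Y) \<cdot> k X)))"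
    unfolding 3 by (simp add: kbase)
  also have "\<dots> = (Ide C Y \<otimes>\<^sub>m coev C X \<otimes>\<^sub>m Ide C ?Y') \<cdot> coev C Y"
    unfolding 4 5 6 ..
  finally have core: "braid C ?W ?Z \<cdot> ((Ide C ?W \<otimes>\<^sub>m twist C ?Z) \<cdot> M)
      = (Ide C Y \<otimes>\<^sub>m coev C X \<otimes>\<^sub>m Ide C ?Y') \<cdot> coev C Y" .
  let ?Z' = "dual_obj C ?Z" and ?g = "dual_tensor C X Y"
  have "braid C ?Z' ?Z \<cdot> ((Ide C ?Z' \<otimes>\<^sub>m twist C ?Z) \<cdot> ((?g \<otimes>\<^sub>m Ide C ?Z) \<cdot> M))
      = braid C ?Z' ?Z \<cdot> (((Ide C ?Z' \<otimes>\<^sub>m twist C ?Z) \<cdot> (?g \<otimes>\<^sub>m Ide C ?Z)) \<cdot> M)"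
    by (simp add: dbase)
  also have "(Ide C ?Z' \<otimes>\<^sub>m twist C ?Z) \<cdot> (?g \<otimes>\<^sub>m Ide C ?Z) = ?g \<otimes>\<^sub>m twist C ?Z"
    by (rule slide_right) (simp_all add: dbase)
  also have "\<dots> = (?g \<otimes>\<^sub>m Ide C ?Z) \<cdot> (Ide C ?W \<otimes>\<^sub>m twist C ?Z)"
    by (rule slide_left[symmetric]) (simp_all add: dbase)
  also have "braid C ?Z' ?Z \<cdot> (\<dots> \<cdot> M)
      = (braid C ?Z' ?Z \<cdot> (?g \<otimes>\<^sub>m Ide C ?Z)) \<cdot> ((Ide C ?W \<otimes>\<^sub>m twist C ?Z) \<cdot> M)"
    by (simp add: dbase)
  also have "braid C ?Z' ?Z \<cdot> (?g \<otimes>\<^sub>m Ide C ?Z) = (Ide C ?Z \<otimes>\<^sub>m ?g) \<cdot> braid C ?W ?Z"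
    using braid_nat[of ?g "Ide C ?Z" ?Z' ?Z] by (simp add: dbase)
  also have "\<dots> \<cdot> ((Ide C ?W \<otimes>\<^sub>m twist C ?Z) \<cdot> M)
      = (Ide C ?Z \<otimes>\<^sub>m ?g) \<cdot> (braid C ?W ?Z \<cdot> ((Ide C ?W \<otimes>\<^sub>m twist C ?Z) \<cdot> M))"
    by (simp add: dbase)
  also have "\<dots> = (Ide C ?Z \<otimes>\<^sub>m ?g) \<cdot> (Ide C Y \<otimes>\<^sub>m coev C X \<otimes>\<^sub>m Ide C ?Y') \<cdot> coev C Y"
    unfolding core by (simp add: dbase)
  also have "\<dots> = coev C ?Z"
    by (rule coev_dual_tensor) simp_all
  finally have c: "braid C ?Z' ?Z \<cdot> ((Ide C ?Z' \<otimes>\<^sub>m twist C ?Z) \<cdot> ((?g \<otimes>\<^sub>m Ide C ?Z) \<cdot> M)) = coev C ?Z" .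
  have "coev_r C ?Z = (Ide C ?Z' \<otimes>\<^sub>m inverse_of C (twist C ?Z)) \<cdot> (inverse_of C (braid C ?Z' ?Z) \<cdot> coev C ?Z)"
    by (simp add: coev_r_def dbase)
  also have "\<dots> = ((Ide C ?Z' \<otimes>\<^sub>m inverse_of C (twist C ?Z)) \<cdot> (Ide C ?Z' \<otimes>\<^sub>m twist C ?Z)) \<cdot> ((?g \<otimes>\<^sub>m Ide C ?Z) \<cdot> M)"
    unfolding c[symmetric] by (simp add: dbase inverse_braid_cancel)
  also have "(Ide C ?Z' \<otimes>\<^sub>m inverse_of C (twist C ?Z)) \<cdot> (Ide C ?Z' \<otimes>\<^sub>m twist C ?Z) = Ide C (?Z' \<otimes>\<^sub>o ?Z)"
    by (simp add: whisker_Comp(2)[symmetric] dbase cancel tensor_Ide)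
  finally show ?thesis
    by (simp add: M_def dbase)
qed

section \<open>Traces and bending\<close>

definition trace_arr where
  "trace_arr f = ev_r C (Dom C f) \<cdot> (f \<otimes>\<^sub>m Ide C (dual_obj C (Dom C f))) \<cdot> coev C (Dom C f)"

text \<open>
  For arrows out of \<open>M \<otimes> X\<close> the leg X is bent to the right of the target, and \<open>bend_down\<close> reverses
  this. For arrows into \<open>M \<otimes> X\<close>, \<open>bend_up_r\<close> bends the leg to the right of the source, which needs the
  right duality.
\<close>

definition bend_up where
  "bend_up M X f = (f \<otimes>\<^sub>m Ide C (dual_obj C X)) \<cdot> (Ide C M \<otimes>\<^sub>m coev C X)"

definition bend_down where
  "bend_down N X g = (Ide C N \<otimes>\<^sub>m ev C X) \<cdot> (g \<otimes>\<^sub>m Ide C X)"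

definition bend_up_r where
  "bend_up_r M X g = (Ide C M \<otimes>\<^sub>m ev_r C X) \<cdot> (g \<otimes>\<^sub>m Ide C (dual_obj C X))"

text \<open>
  This identifies endomorphisms of \<open>N \<otimes> X'\<close> with arrows from \<open>X' \<otimes> X\<close> to \<open>N' \<otimes> N\<close>: the
  strand N is bent to the left and X' to the right. Components of maps into the coend are compared
  after undoing this bending.
\<close>

definition unroll where
  "unroll N X h = (Ide C (dual_obj C N \<otimes>\<^sub>o N) \<otimes>\<^sub>m ev C X)
     \<cdot> (Ide C (dual_obj C N) \<otimes>\<^sub>m h \<otimes>\<^sub>m Ide C X) \<cdot> (coev_r C N \<otimes>\<^sub>m Ide C (dual_obj C X \<otimes>\<^sub>o X))"

lemma bend_up_typing:
  assumes "f \<in> Arr C" "M \<in> Obj C" "X \<in> Obj C" "Dom C f = M \<otimes>\<^sub>o X"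
  shows "bend_up M X f \<in> Arr C" "Dom C (bend_up M X f) = M"
    "Cod C (bend_up M X f) = Cod C f \<otimes>\<^sub>o dual_obj C X"
  using assms by (simp_all add: bend_up_def rbase)

lemma bend_down_typing:
  assumes "g \<in> Arr C" "N \<in> Obj C" "X \<in> Obj C" "Cod C g = N \<otimes>\<^sub>o dual_obj C X"
  shows "bend_down N X g \<in> Arr C" "Dom C (bend_down N X g) = Dom C g \<otimes>\<^sub>o X"
    "Cod C (bend_down N X g) = N"
  using assms by (simp_all add: bend_down_def rbase)

lemma bend_up_r_typing:
  assumes "g \<in> Arr C" "M \<in> Obj C" "X \<in> Obj C" "Cod C g = M \<otimes>\<^sub>o X"
  shows "bend_up_r M X g \<in> Arr C" "Dom C (bend_up_r M X g) = Dom C g \<otimes>\<^sub>o dual_obj C X"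
    "Cod C (bend_up_r M X g) = M"
  using assms by (simp_all add: bend_up_r_def dbase)

lemma unroll_typing:
  assumes "h \<in> Arr C" "N \<in> Obj C" "X \<in> Obj C" "Dom C h = N \<otimes>\<^sub>o dual_obj C X" "Cod C h = N \<otimes>\<^sub>o dual_obj C X"
  shows "unroll N X h \<in> Arr C" "Dom C (unroll N X h) = dual_obj C X \<otimes>\<^sub>o X"
    "Cod C (unroll N X h) = dual_obj C N \<otimes>\<^sub>o N"
  using assms by (simp_all add: unroll_def dbase)

lemma trace_arr_typing:
  assumes "f \<in> Hom C X X"
  shows "trace_arr f \<in> Hom C \<bbbone> \<bbbone>"
proof -
  have "X \<in> Obj C" by (rule Hom_Obj(1)[OF assms])
  then show ?thesis
    using assms by (simp add: trace_arr_def Hom_def dbase)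
qed

lemma trace_cyclic:
  assumes "f \<in> Hom C X Y" "g \<in> Hom C Y X"
  shows "trace_arr (g \<cdot> f) = trace_arr (f \<cdot> g)"
proof -
  have [simp]: "f \<in> Arr C" "Dom C f = X" "Cod C f = Y" "g \<in> Arr C" "Dom C g = Y" "Cod C g = X"
    "X \<in> Obj C" "Y \<in> Obj C"
    using assms Hom_Obj[OF assms(1)] by (auto simp: Hom_def)
  let ?X' = "Ide C (dual_obj C X)" and ?Y' = "Ide C (dual_obj C Y)"
  have "trace_arr (g \<cdot> f) = ev_r C X \<cdot> ((g \<otimes>\<^sub>m ?X') \<cdot> ((f \<otimes>\<^sub>m ?X') \<cdot> coev C X))"
    by (simp add: trace_arr_def dlayers)
  also have "(f \<otimes>\<^sub>m ?X') \<cdot> coev C X = (Ide C Y \<otimes>\<^sub>m dual_arr C f) \<cdot> coev C Y"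
    by (rule coev_dual_arr[symmetric]) simp_all
  also have "ev_r C X \<cdot> ((g \<otimes>\<^sub>m ?X') \<cdot> \<dots>)
      = (ev_r C X \<cdot> (Ide C X \<otimes>\<^sub>m dual_arr C f)) \<cdot> ((g \<otimes>\<^sub>m ?Y') \<cdot> coev C Y)"
    by (simp add: dmerge)
  also have "ev_r C X \<cdot> (Ide C X \<otimes>\<^sub>m dual_arr C f) = ev_r C Y \<cdot> (f \<otimes>\<^sub>m ?Y')"
    by (rule ev_r_dual_arr) simp_all
  finally show ?thesis
    by (simp add: trace_arr_def dlayers)
qed

lemma bend_up_down:
  assumes [simp]: "g \<in> Arr C" "N \<in> Obj C" "X \<in> Obj C" "Dom C g = M" "Cod C g = N \<otimes>\<^sub>o dual_obj C X"
  shows "bend_up M X (bend_down N X g) = g"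
proof -
  have [simp]: "M \<in> Obj C"
    using Dom_Obj[of g] by simp
  have "bend_up M X (bend_down N X g) = (Ide C N \<otimes>\<^sub>m ev C X \<otimes>\<^sub>m Ide C (dual_obj C X))
      \<cdot> ((g \<otimes>\<^sub>m Ide C (X \<otimes>\<^sub>o dual_obj C X)) \<cdot> (Ide C M \<otimes>\<^sub>m coev C X))"
    by (simp add: bend_up_def bend_down_def rlayers)
  also have "(g \<otimes>\<^sub>m Ide C (X \<otimes>\<^sub>o dual_obj C X)) \<cdot> (Ide C M \<otimes>\<^sub>m coev C X) = g \<otimes>\<^sub>m coev C X"
    by (rule slide_left) (simp_all add: rbase)
  also have "\<dots> = (Ide C (N \<otimes>\<^sub>o dual_obj C X) \<otimes>\<^sub>m coev C X) \<cdot> g"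
    by (rule slide_unit_source[symmetric]) (simp_all add: rbase)
  also have "(Ide C N \<otimes>\<^sub>m ev C X \<otimes>\<^sub>m Ide C (dual_obj C X)) \<cdot> \<dots>
      = (Ide C N \<otimes>\<^sub>m ((ev C X \<otimes>\<^sub>m Ide C (dual_obj C X)) \<cdot> (Ide C (dual_obj C X) \<otimes>\<^sub>m coev C X))) \<cdot> g"
    by (simp add: rlayers)
  also have "\<dots> = g"
    by (simp only: zigzag_rules assms(3)) (simp add: rlayers)
  finally show ?thesis .
qed

lemma bend_down_up:
  assumes [simp]: "f \<in> Arr C" "M \<in> Obj C" "X \<in> Obj C" "Dom C f = M \<otimes>\<^sub>o X" "Cod C f = N"
  shows "bend_down N X (bend_up M X f) = f"
proof -
  have [simp]: "N \<in> Obj C"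
    using Cod_Obj[of f] by simp
  have "bend_down N X (bend_up M X f)
      = ((Ide C N \<otimes>\<^sub>m ev C X) \<cdot> (f \<otimes>\<^sub>m Ide C (dual_obj C X \<otimes>\<^sub>o X))) \<cdot> (Ide C M \<otimes>\<^sub>m coev C X \<otimes>\<^sub>m Ide C X)"
    by (simp add: bend_up_def bend_down_def rlayers)
  also have "(Ide C N \<otimes>\<^sub>m ev C X) \<cdot> (f \<otimes>\<^sub>m Ide C (dual_obj C X \<otimes>\<^sub>o X)) = f \<otimes>\<^sub>m ev C X"
    by (rule slide_right) (simp_all add: rbase)
  also have "\<dots> = f \<cdot> (Ide C (M \<otimes>\<^sub>o X) \<otimes>\<^sub>m ev C X)"
    by (rule slide_unit_target[symmetric]) (simp_all add: rbase)
  also have "\<dots> \<cdot> (Ide C M \<otimes>\<^sub>m coev C X \<otimes>\<^sub>m Ide C X)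
      = f \<cdot> (Ide C M \<otimes>\<^sub>m ((Ide C X \<otimes>\<^sub>m ev C X) \<cdot> (coev C X \<otimes>\<^sub>m Ide C X)))"
    by (simp add: rlayers)
  also have "\<dots> = f"
    by (simp only: zigzag_rules assms(3)) (simp add: rlayers)
  finally show ?thesis .
qed

text \<open>
  Two ways of bending both ends of q: slide q through the cup of N, or bend N first. They agree since the
  cup of \<open>M \<otimes> X\<close> is nested (\<open>coev_r_tensor\<close>) and the zigzag straightens the strand X.
\<close>

lemma bend_up_r_coev_r:
  assumes [simp]: "q \<in> Arr C" "M \<in> Obj C" "X \<in> Obj C" "Dom C q = N" "Cod C q = M \<otimes>\<^sub>o X"
  shows "(Ide C (dual_obj C N) \<otimes>\<^sub>m bend_up_r M X q) \<cdot> (coev_r C N \<otimes>\<^sub>m Ide C (dual_obj C X))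
    = ((dual_arr C q \<cdot> dual_tensor C X M) \<otimes>\<^sub>m Ide C M) \<cdot> (Ide C (dual_obj C X) \<otimes>\<^sub>m coev_r C M)"
proof -
  have [simp]: "N \<in> Obj C"
    using Dom_Obj[of q] by simp
  let ?X' = "dual_obj C X" and ?M' = "dual_obj C M" and ?N' = "dual_obj C N"
  let ?g = "dual_arr C q \<cdot> dual_tensor C X M"
  have "(Ide C ?N' \<otimes>\<^sub>m bend_up_r M X q) \<cdot> (coev_r C N \<otimes>\<^sub>m Ide C ?X')
      = (Ide C (?N' \<otimes>\<^sub>o M) \<otimes>\<^sub>m ev_r C X) \<cdot> (((Ide C ?N' \<otimes>\<^sub>m q) \<cdot> coev_r C N) \<otimes>\<^sub>m Ide C ?X')"
    by (simp add: bend_up_r_def dlayers)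
  also have "(Ide C ?N' \<otimes>\<^sub>m q) \<cdot> coev_r C N = (dual_arr C q \<otimes>\<^sub>m Ide C (M \<otimes>\<^sub>o X)) \<cdot> coev_r C (M \<otimes>\<^sub>o X)"
    by (rule coev_r_dual_arr[symmetric]) (simp_all add: dbase)
  also have "(Ide C (?N' \<otimes>\<^sub>o M) \<otimes>\<^sub>m ev_r C X) \<cdot> (\<dots> \<otimes>\<^sub>m Ide C ?X')
      = ((Ide C (?N' \<otimes>\<^sub>o M) \<otimes>\<^sub>m ev_r C X) \<cdot> ((?g \<otimes>\<^sub>m Ide C M) \<otimes>\<^sub>m Ide C (X \<otimes>\<^sub>o ?X')))
        \<cdot> ((Ide C ?X' \<otimes>\<^sub>m coev_r C M \<otimes>\<^sub>m Ide C (X \<otimes>\<^sub>o ?X')) \<cdot> (coev_r C X \<otimes>\<^sub>m Ide C ?X'))"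
    by (simp add: coev_r_tensor dlayers)
  also have "(Ide C (?N' \<otimes>\<^sub>o M) \<otimes>\<^sub>m ev_r C X) \<cdot> ((?g \<otimes>\<^sub>m Ide C M) \<otimes>\<^sub>m Ide C (X \<otimes>\<^sub>o ?X'))
      = (?g \<otimes>\<^sub>m Ide C M) \<otimes>\<^sub>m ev_r C X"
    by (rule slide_right) (simp_all add: dbase)
  also have "\<dots> = (?g \<otimes>\<^sub>m Ide C M) \<cdot> (Ide C (?X' \<otimes>\<^sub>o ?M' \<otimes>\<^sub>o M) \<otimes>\<^sub>m ev_r C X)"
    by (rule slide_unit_target[symmetric]) (simp_all add: dbase)
  also have "\<dots> \<cdot> ((Ide C ?X' \<otimes>\<^sub>m coev_r C M \<otimes>\<^sub>m Ide C (X \<otimes>\<^sub>o ?X')) \<cdot> (coev_r C X \<otimes>\<^sub>m Ide C ?X'))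
      = (?g \<otimes>\<^sub>m Ide C M) \<cdot> (((Ide C (?X' \<otimes>\<^sub>o ?M' \<otimes>\<^sub>o M) \<otimes>\<^sub>m ev_r C X)
          \<cdot> ((Ide C ?X' \<otimes>\<^sub>m coev_r C M) \<otimes>\<^sub>m Ide C (X \<otimes>\<^sub>o ?X'))) \<cdot> (coev_r C X \<otimes>\<^sub>m Ide C ?X'))"
    by (simp add: dlayers)
  also have "(Ide C (?X' \<otimes>\<^sub>o ?M' \<otimes>\<^sub>o M) \<otimes>\<^sub>m ev_r C X) \<cdot> ((Ide C ?X' \<otimes>\<^sub>m coev_r C M) \<otimes>\<^sub>m Ide C (X \<otimes>\<^sub>o ?X'))
      = (Ide C ?X' \<otimes>\<^sub>m coev_r C M) \<otimes>\<^sub>m ev_r C X"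
    by (rule slide_right) (simp_all add: dbase)
  also have "\<dots> = (Ide C ?X' \<otimes>\<^sub>m coev_r C M) \<cdot> (Ide C ?X' \<otimes>\<^sub>m ev_r C X)"
    using slide_unit_target(1)[of "Ide C ?X' \<otimes>\<^sub>m coev_r C M" "ev_r C X" ?X'] by (simp add: dbase)
  also have "(?g \<otimes>\<^sub>m Ide C M) \<cdot> (\<dots> \<cdot> (coev_r C X \<otimes>\<^sub>m Ide C ?X'))
      = (?g \<otimes>\<^sub>m Ide C M) \<cdot> ((Ide C ?X' \<otimes>\<^sub>m coev_r C M) \<cdot> ((Ide C ?X' \<otimes>\<^sub>m ev_r C X) \<cdot> (coev_r C X \<otimes>\<^sub>m Ide C ?X')))"
    by (simp add: dbase)
  finally show ?thesis
    by (simp add: zigzag_r_dual dbase)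
qed

text \<open>
  The right-hand side is what a summand N of \<open>M \<otimes> X\<close> contributes when the strands M and X run in
  parallel; the left-hand side expresses it through the bent projection and injection.
\<close>

lemma unroll_bend:
  assumes [simp]: "p \<in> Arr C" "q \<in> Arr C" "M \<in> Obj C" "X \<in> Obj C"
    "Dom C p = M \<otimes>\<^sub>o X" "Cod C p = N" "Dom C q = N" "Cod C q = M \<otimes>\<^sub>o X"
  shows "unroll N X (bend_up M X p \<cdot> bend_up_r M X q)
    = ((dual_arr C q \<cdot> dual_tensor C X M) \<otimes>\<^sub>m p) \<cdot> (Ide C (dual_obj C X) \<otimes>\<^sub>m coev_r C M \<otimes>\<^sub>m Ide C X)"
proof -
  have [simp]: "N \<in> Obj C"
    using Dom_Obj[of q] by simp
  let ?X' = "dual_obj C X" and ?M' = "dual_obj C M" and ?N' = "dual_obj C N"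
  let ?g = "dual_arr C q \<cdot> dual_tensor C X M"
  note bbase = dbase bend_up_typing bend_up_r_typing
  note blayers = dlayers bend_up_typing bend_up_r_typing
  have "unroll N X (bend_up M X p \<cdot> bend_up_r M X q)
      = (Ide C ?N' \<otimes>\<^sub>m bend_down N X (bend_up M X p))
        \<cdot> (((Ide C ?N' \<otimes>\<^sub>m bend_up_r M X q) \<cdot> (coev_r C N \<otimes>\<^sub>m Ide C ?X')) \<otimes>\<^sub>m Ide C X)"
    by (simp add: unroll_def bend_down_def blayers)
  also have "bend_down N X (bend_up M X p) = p"
    by (rule bend_down_up) simp_all
  also have "(Ide C ?N' \<otimes>\<^sub>m bend_up_r M X q) \<cdot> (coev_r C N \<otimes>\<^sub>m Ide C ?X')
     = (?g \<otimes>\<^sub>m Ide C M) \<cdot> (Ide C ?X' \<otimes>\<^sub>m coev_r C M)"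
    by (rule bend_up_r_coev_r) simp_all
  also have "(Ide C ?N' \<otimes>\<^sub>m p) \<cdot> (((?g \<otimes>\<^sub>m Ide C M) \<cdot> (Ide C ?X' \<otimes>\<^sub>m coev_r C M)) \<otimes>\<^sub>m Ide C X)
      = ((Ide C ?N' \<otimes>\<^sub>m p) \<cdot> (?g \<otimes>\<^sub>m Ide C (M \<otimes>\<^sub>o X))) \<cdot> (Ide C ?X' \<otimes>\<^sub>m coev_r C M \<otimes>\<^sub>m Ide C X)"
    by (simp add: dlayers)
  also have "(Ide C ?N' \<otimes>\<^sub>m p) \<cdot> (?g \<otimes>\<^sub>m Ide C (M \<otimes>\<^sub>o X)) = ?g \<otimes>\<^sub>m p"
    by (rule slide_right) (simp_all add: dbase)
  finally show ?thesis .
qed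

lemma unroll_Ide:
  assumes [simp]: "N \<in> Obj C" "X \<in> Obj C"
  shows "unroll N X (Ide C (N \<otimes>\<^sub>o dual_obj C X)) = coev_r C N \<cdot> ev C X"
proof -
  have "unroll N X (Ide C (N \<otimes>\<^sub>o dual_obj C X))
      = (Ide C (dual_obj C N \<otimes>\<^sub>o N) \<otimes>\<^sub>m ev C X) \<cdot> (coev_r C N \<otimes>\<^sub>m Ide C (dual_obj C X \<otimes>\<^sub>o X))"
    by (simp add: unroll_def dlayers)
  also have "\<dots> = coev_r C N \<otimes>\<^sub>m ev C X"
    by (rule slide_right) (simp_all add: dbase)
  also have "\<dots> = coev_r C N \<cdot> ev C X"
    using slide_unit_target(1)[of "coev_r C N" "ev C X" \<bbbone>] by (simp add: dbase)
  finally show ?thesis .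
qed

lemma ev_r_bend_up_r:
  assumes [simp]: "q \<in> Arr C" "M \<in> Obj C" "X \<in> Obj C" "Dom C q = N" "Cod C q = M \<otimes>\<^sub>o X"
  shows "ev_r C M \<cdot> (bend_up_r M X q \<otimes>\<^sub>m Ide C (dual_obj C M))
    = ev_r C N \<cdot> (Ide C N \<otimes>\<^sub>m (dual_arr C q \<cdot> dual_tensor C X M))"
proof -
  have [simp]: "N \<in> Obj C"
    using Dom_Obj[of q] by simp
  let ?X' = "dual_obj C X" and ?M' = "dual_obj C M" and ?N' = "dual_obj C N"
  let ?g = "dual_arr C q \<cdot> dual_tensor C X M" and ?q = "bend_up_r M X q"
  note bbase = dbase bend_up_r_typing
  note blayers = dlayers bend_up_r_typing
  have "?q = ?q \<cdot> (((ev_r C N \<otimes>\<^sub>m Ide C N) \<cdot> (Ide C N \<otimes>\<^sub>m coev_r C N)) \<otimes>\<^sub>m Ide C ?X')"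
    by (simp add: zigzag_r tensor_Ide bbase)
  also have "\<dots> = (?q \<cdot> (ev_r C N \<otimes>\<^sub>m Ide C (N \<otimes>\<^sub>o ?X'))) \<cdot> (Ide C N \<otimes>\<^sub>m coev_r C N \<otimes>\<^sub>m Ide C ?X')"
    by (simp add: blayers)
  also have "?q \<cdot> (ev_r C N \<otimes>\<^sub>m Ide C (N \<otimes>\<^sub>o ?X')) = ev_r C N \<otimes>\<^sub>m ?q"
    by (rule slide_unit_target) (simp_all add: bbase)
  also have "\<dots> = (ev_r C N \<otimes>\<^sub>m Ide C M) \<cdot> (Ide C (N \<otimes>\<^sub>o ?N') \<otimes>\<^sub>m ?q)"
    by (rule slide_left[symmetric]) (simp_all add: bbase)
  also have "\<dots> \<cdot> (Ide C N \<otimes>\<^sub>m coev_r C N \<otimes>\<^sub>m Ide C ?X')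
      = (ev_r C N \<otimes>\<^sub>m Ide C M) \<cdot> (Ide C N \<otimes>\<^sub>m ((Ide C ?N' \<otimes>\<^sub>m ?q) \<cdot> (coev_r C N \<otimes>\<^sub>m Ide C ?X')))"
    by (simp add: blayers)
  also have "(Ide C ?N' \<otimes>\<^sub>m ?q) \<cdot> (coev_r C N \<otimes>\<^sub>m Ide C ?X')
     = (?g \<otimes>\<^sub>m Ide C M) \<cdot> (Ide C ?X' \<otimes>\<^sub>m coev_r C M)"
    by (rule bend_up_r_coev_r) simp_all
  also have "(ev_r C N \<otimes>\<^sub>m Ide C M) \<cdot> (Ide C N \<otimes>\<^sub>m \<dots>)
      = ((ev_r C N \<cdot> (Ide C N \<otimes>\<^sub>m ?g)) \<otimes>\<^sub>m Ide C M) \<cdot> (Ide C (N \<otimes>\<^sub>o ?X') \<otimes>\<^sub>m coev_r C M)"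
    by (simp add: blayers)
  finally have q: "?q = ((ev_r C N \<cdot> (Ide C N \<otimes>\<^sub>m ?g)) \<otimes>\<^sub>m Ide C M) \<cdot> (Ide C (N \<otimes>\<^sub>o ?X') \<otimes>\<^sub>m coev_r C M)" .
  let ?h = "ev_r C N \<cdot> (Ide C N \<otimes>\<^sub>m ?g)"
  have "ev_r C M \<cdot> (?q \<otimes>\<^sub>m Ide C ?M') = (ev_r C M \<cdot> (?h \<otimes>\<^sub>m Ide C (M \<otimes>\<^sub>o ?M')))
      \<cdot> (Ide C (N \<otimes>\<^sub>o ?X') \<otimes>\<^sub>m coev_r C M \<otimes>\<^sub>m Ide C ?M')"
    unfolding q by (simp add: dlayers)
  also have "ev_r C M \<cdot> (?h \<otimes>\<^sub>m Ide C (M \<otimes>\<^sub>o ?M')) = ?h \<otimes>\<^sub>m ev_r C M"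
    by (rule slide_unit_target) (simp_all add: dbase)
  also have "\<dots> = ?h \<cdot> (Ide C (N \<otimes>\<^sub>o ?X' \<otimes>\<^sub>o ?M') \<otimes>\<^sub>m ev_r C M)"
    by (rule slide_unit_target[symmetric]) (simp_all add: dbase)
  also have "\<dots> \<cdot> (Ide C (N \<otimes>\<^sub>o ?X') \<otimes>\<^sub>m coev_r C M \<otimes>\<^sub>m Ide C ?M')
      = ?h \<cdot> (Ide C (N \<otimes>\<^sub>o ?X') \<otimes>\<^sub>m ((Ide C ?M' \<otimes>\<^sub>m ev_r C M) \<cdot> (coev_r C M \<otimes>\<^sub>m Ide C ?M')))"
    by (simp add: dlayers)
  also have "\<dots> = ?h"
    by (simp only: zigzag_r_dual assms(2)) (simp add: dlayers)
  finally show ?thesis .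
qed

text \<open>
  Both sides are values of the same closed diagram, cut open at M or at N.
\<close>

lemma trace_bend:
  assumes "i \<in> Hom C (M \<otimes>\<^sub>o X) N" "q \<in> Hom C N (M \<otimes>\<^sub>o X)" and [simp]: "M \<in> Obj C" "X \<in> Obj C"
  shows "trace_arr (bend_up_r M X q \<cdot> bend_up M X i) = trace_arr (i \<cdot> q)"
proof -
  have [simp]: "i \<in> Arr C" "Dom C i = M \<otimes>\<^sub>o X" "Cod C i = N" "q \<in> Arr C" "Dom C q = N"
    "Cod C q = M \<otimes>\<^sub>o X" "N \<in> Obj C"
    using assms Hom_Obj[OF assms(1)] by (auto simp: Hom_def)
  let ?X' = "dual_obj C X" and ?M' = "dual_obj C M" and ?N' = "dual_obj C N" and ?Z' = "dual_obj C (M \<otimes>\<^sub>o X)"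
  let ?g = "dual_tensor C X M"
  note bbase = dbase bend_up_typing bend_up_r_typing
  note blayers = dlayers bend_up_typing bend_up_r_typing
  have "trace_arr (bend_up_r M X q \<cdot> bend_up M X i)
      = (ev_r C M \<cdot> (bend_up_r M X q \<otimes>\<^sub>m Ide C ?M')) \<cdot> ((bend_up M X i \<otimes>\<^sub>m Ide C ?M') \<cdot> coev C M)"
    by (simp add: trace_arr_def blayers)
  also have "ev_r C M \<cdot> (bend_up_r M X q \<otimes>\<^sub>m Ide C ?M')
      = ev_r C N \<cdot> (Ide C N \<otimes>\<^sub>m (dual_arr C q \<cdot> ?g))"
    by (rule ev_r_bend_up_r) simp_all
  also have "\<dots> \<cdot> ((bend_up M X i \<otimes>\<^sub>m Ide C ?M') \<cdot> coev C M)
      = ev_r C N \<cdot> ((Ide C N \<otimes>\<^sub>m dual_arr C q) \<cdot> (((Ide C N \<otimes>\<^sub>m ?g) \<cdot> (i \<otimes>\<^sub>m Ide C (?X' \<otimes>\<^sub>o ?M')))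
        \<cdot> ((Ide C M \<otimes>\<^sub>m coev C X \<otimes>\<^sub>m Ide C ?M') \<cdot> coev C M)))"
    by (simp add: bend_up_def dlayers)
  also have "(Ide C N \<otimes>\<^sub>m ?g) \<cdot> (i \<otimes>\<^sub>m Ide C (?X' \<otimes>\<^sub>o ?M')) = i \<otimes>\<^sub>m ?g"
    by (rule slide_right) (simp_all add: dbase)
  also have "\<dots> = (i \<otimes>\<^sub>m Ide C ?Z') \<cdot> (Ide C (M \<otimes>\<^sub>o X) \<otimes>\<^sub>m ?g)"
    by (rule slide_left[symmetric]) (simp_all add: dbase)
  also have "ev_r C N \<cdot> ((Ide C N \<otimes>\<^sub>m dual_arr C q) \<cdot> (\<dots> \<cdot> ((Ide C M \<otimes>\<^sub>m coev C X \<otimes>\<^sub>m Ide C ?M') \<cdot> coev C M)))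
      = ev_r C N \<cdot> (((Ide C N \<otimes>\<^sub>m dual_arr C q) \<cdot> (i \<otimes>\<^sub>m Ide C ?Z')) \<cdot>
        ((Ide C (M \<otimes>\<^sub>o X) \<otimes>\<^sub>m ?g) \<cdot> (Ide C M \<otimes>\<^sub>m coev C X \<otimes>\<^sub>m Ide C ?M') \<cdot> coev C M))"
    by (simp add: dbase)
  also have "(Ide C (M \<otimes>\<^sub>o X) \<otimes>\<^sub>m ?g) \<cdot> (Ide C M \<otimes>\<^sub>m coev C X \<otimes>\<^sub>m Ide C ?M') \<cdot> coev C M = coev C (M \<otimes>\<^sub>o X)"
    by (rule coev_dual_tensor) simp_all
  also have "(Ide C N \<otimes>\<^sub>m dual_arr C q) \<cdot> (i \<otimes>\<^sub>m Ide C ?Z') = i \<otimes>\<^sub>m dual_arr C q"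
    by (rule slide_right) (simp_all add: dbase)
  also have "\<dots> = (i \<otimes>\<^sub>m Ide C ?N') \<cdot> (Ide C (M \<otimes>\<^sub>o X) \<otimes>\<^sub>m dual_arr C q)"
    by (rule slide_left[symmetric]) (simp_all add: dbase)
  also have "ev_r C N \<cdot> (\<dots> \<cdot> coev C (M \<otimes>\<^sub>o X))
      = ev_r C N \<cdot> ((i \<otimes>\<^sub>m Ide C ?N') \<cdot> ((Ide C (M \<otimes>\<^sub>o X) \<otimes>\<^sub>m dual_arr C q) \<cdot> coev C (M \<otimes>\<^sub>o X)))"
    by (simp add: dbase)
  also have "(Ide C (M \<otimes>\<^sub>o X) \<otimes>\<^sub>m dual_arr C q) \<cdot> coev C (M \<otimes>\<^sub>o X) = (q \<otimes>\<^sub>m Ide C ?N') \<cdot> coev C N"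
    by (rule coev_dual_arr) (simp_all add: dbase)
  finally show ?thesis
    by (simp add: trace_arr_def dlayers)
qed

end

section \<open>Linearity\<close>

context k_category
begin

lemma Hom_module_simps:
  "carrier (Hom_module C X Y) = Hom C X Y"
  "\<zero>\<^bsub>Hom_module C X Y\<^esub> = arr_zero C X Y"
  "f \<oplus>\<^bsub>Hom_module C X Y\<^esub> g = f \<oplus>\<^sub>m g"
  "a \<odot>\<^bsub>Hom_module C X Y\<^esub> f = a \<odot>\<^sub>m f"
  by (simp_all add: Hom_module_def)

lemma Hom_abelian: "\<lbrakk>X \<in> Obj C; Y \<in> Obj C\<rbrakk> \<Longrightarrow> abelian_group (Hom_module C X Y)"
  using Hom_vector_space module.axioms(2) by blast

lemma Hom_linear:
  assumes "X \<in> Obj C" "Y \<in> Obj C"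
  shows arr_zero_Hom: "arr_zero C X Y \<in> Hom C X Y"
    and arr_add_Hom: "\<lbrakk>f \<in> Hom C X Y; g \<in> Hom C X Y\<rbrakk> \<Longrightarrow> f \<oplus>\<^sub>m g \<in> Hom C X Y"
    and arr_smult_Hom: "\<lbrakk>a \<in> carrier K; f \<in> Hom C X Y\<rbrakk> \<Longrightarrow> a \<odot>\<^sub>m f \<in> Hom C X Y"
    and arr_smult_smult: "\<lbrakk>a \<in> carrier K; b \<in> carrier K; f \<in> Hom C X Y\<rbrakk> \<Longrightarrow> (a \<otimes>\<^bsub>K\<^esub> b) \<odot>\<^sub>m f = a \<odot>\<^sub>m (b \<odot>\<^sub>m f)"
    and arr_smult_one: "f \<in> Hom C X Y \<Longrightarrow> \<one>\<^bsub>K\<^esub> \<odot>\<^sub>m f = f"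
    and arr_smult_null: "f \<in> Hom C X Y \<Longrightarrow> \<zero>\<^bsub>K\<^esub> \<odot>\<^sub>m f = arr_zero C X Y"
    and arr_smult_zero: "a \<in> carrier K \<Longrightarrow> a \<odot>\<^sub>m arr_zero C X Y = arr_zero C X Y"
proof -
  interpret M: module K "Hom_module C X Y"
    by (rule Hom_vector_space[OF assms])
  note s = Hom_module_simps[of X Y]
  show "arr_zero C X Y \<in> Hom C X Y"
    using M.zero_closed by (simp add: s)
  show "\<lbrakk>f \<in> Hom C X Y; g \<in> Hom C X Y\<rbrakk> \<Longrightarrow> f \<oplus>\<^sub>m g \<in> Hom C X Y"
    using M.add.m_closed[of f g] by (simp add: s)
  show "\<lbrakk>a \<in> carrier K; f \<in> Hom C X Y\<rbrakk> \<Longrightarrow> a \<odot>\<^sub>m f \<in> Hom C X Y"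
    using M.smult_closed[of a f] by (simp add: s)
  show "\<lbrakk>a \<in> carrier K; b \<in> carrier K; f \<in> Hom C X Y\<rbrakk> \<Longrightarrow> (a \<otimes>\<^bsub>K\<^esub> b) \<odot>\<^sub>m f = a \<odot>\<^sub>m (b \<odot>\<^sub>m f)"
    using M.smult_assoc1[of a b f] by (simp add: s)
  show "f \<in> Hom C X Y \<Longrightarrow> \<one>\<^bsub>K\<^esub> \<odot>\<^sub>m f = f"
    using M.smult_one[of f] by (simp add: s)
  show "f \<in> Hom C X Y \<Longrightarrow> \<zero>\<^bsub>K\<^esub> \<odot>\<^sub>m f = arr_zero C X Y"
    using M.smult_l_null[of f] by (simp add: s)
  show "a \<in> carrier K \<Longrightarrow> a \<odot>\<^sub>m arr_zero C X Y = arr_zero C X Y"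
    using M.smult_r_null[of a] by (simp add: s)
qed

lemma arr_zero_typing:
  assumes "X \<in> Obj C" "Y \<in> Obj C"
  shows "arr_zero C X Y \<in> Arr C" "Dom C (arr_zero C X Y) = X" "Cod C (arr_zero C X Y) = Y"
  using arr_zero_Hom[OF assms] by (simp_all add: Hom_def)

definition linear_map where
  "linear_map X Y X' Y' F \<longleftrightarrow>
     X \<in> Obj C \<and> Y \<in> Obj C \<and> X' \<in> Obj C \<and> Y' \<in> Obj C \<and>
     (\<forall>f \<in> Hom C X Y. F f \<in> Hom C X' Y') \<and>
     (\<forall>f \<in> Hom C X Y. \<forall>g \<in> Hom C X Y. F (f \<oplus>\<^sub>m g) = F f \<oplus>\<^sub>m F g) \<and>
     (\<forall>a \<in> carrier K. \<forall>f \<in> Hom C X Y. F (a \<odot>\<^sub>m f) = a \<odot>\<^sub>m F f)"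

lemma linear_map_Hom: "\<lbrakk>linear_map X Y X' Y' F; f \<in> Hom C X Y\<rbrakk> \<Longrightarrow> F f \<in> Hom C X' Y'"
  by (simp add: linear_map_def)

lemma linear_map_smult:
  "\<lbrakk>linear_map X Y X' Y' F; a \<in> carrier K; f \<in> Hom C X Y\<rbrakk> \<Longrightarrow> F (a \<odot>\<^sub>m f) = a \<odot>\<^sub>m F f"
  by (simp add: linear_map_def)

lemma linear_map_zero:
  assumes F: "linear_map X Y X' Y' F"
  shows "F (arr_zero C X Y) = arr_zero C X' Y'"
proof -
  have o: "X \<in> Obj C" "Y \<in> Obj C" "X' \<in> Obj C" "Y' \<in> Obj C"
    using F by (simp_all add: linear_map_def)
  have "F (\<zero>\<^bsub>K\<^esub> \<odot>\<^sub>m arr_zero C X Y) = \<zero>\<^bsub>K\<^esub> \<odot>\<^sub>m F (arr_zero C X Y)"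
    using F arr_zero_Hom[OF o(1,2)] by (simp add: linear_map_def)
  then show ?thesis
    using arr_smult_null[OF o(1,2)] arr_smult_null[OF o(3,4)] linear_map_Hom[OF F] arr_zero_Hom[OF o(1,2)]
    by simp
qed

lemma linear_map_compose:
  "\<lbrakk>linear_map X Y X' Y' F; linear_map X' Y' X'' Y'' G\<rbrakk> \<Longrightarrow> linear_map X Y X'' Y'' (\<lambda>f. G (F f))"
  by (simp add: linear_map_def)

lemma linear_map_cong:
  "\<lbrakk>linear_map X Y X' Y' F; \<And>f. f \<in> Hom C X Y \<Longrightarrow> G f = F f\<rbrakk> \<Longrightarrow> linear_map X Y X' Y' G"
  using arr_add_Hom arr_smult_Hom by (simp add: linear_map_def)

lemma linear_Comp_left: "\<lbrakk>g \<in> Hom C Y Z; X \<in> Obj C\<rbrakk> \<Longrightarrow> linear_map X Y X Z (\<lambda>f. g \<cdot> f)"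
  using Hom_Obj[of g Y Z] Comp_Hom Comp_add_right Comp_smult_right by (auto simp: linear_map_def)

lemma linear_Comp_right: "\<lbrakk>f \<in> Hom C X Y; Z \<in> Obj C\<rbrakk> \<Longrightarrow> linear_map Y Z X Z (\<lambda>g. g \<cdot> f)"
  using Hom_Obj[of f X Y] Comp_Hom Comp_add_left Comp_smult_left by (auto simp: linear_map_def)

lemma linear_smult:
  assumes "a \<in> carrier K" "X \<in> Obj C" "Y \<in> Obj C"
  shows "linear_map X Y X Y (\<lambda>f. a \<odot>\<^sub>m f)"
proof -
  interpret M: module K "Hom_module C X Y"
    by (rule Hom_vector_space[OF assms(2,3)])
  have "a \<odot>\<^sub>m (b \<odot>\<^sub>m f) = b \<odot>\<^sub>m (a \<odot>\<^sub>m f)" if "b \<in> carrier K" "f \<in> Hom C X Y" for b f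
    using that assms arr_smult_smult[OF assms(2,3), symmetric] m_comm by simp
  then show ?thesis
    using assms arr_smult_Hom M.smult_r_distr by (auto simp: linear_map_def Hom_module_simps)
qed

lemma finsum_Hom:
  assumes "X \<in> Obj C" "Y \<in> Obj C" "\<And>k. k \<in> I \<Longrightarrow> f k \<in> Hom C X Y"
  shows "(\<Oplus>\<^bsub>Hom_module C X Y\<^esub>k\<in>I. f k) \<in> Hom C X Y"
proof -
  interpret M: abelian_group "Hom_module C X Y"
    by (rule Hom_abelian[OF assms(1,2)])
  show ?thesis
    using M.finsum_closed[of f I] assms(3) by (auto simp: Hom_module_simps)
qed

lemma finsum_Hom_cong:
  assumes "X \<in> Obj C" "Y \<in> Obj C" "\<And>k. k \<in> I \<Longrightarrow> g k \<in> Hom C X Y" "\<And>k. k \<in> I \<Longrightarrow> f k = g k"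
  shows "(\<Oplus>\<^bsub>Hom_module C X Y\<^esub>k\<in>I. f k) = (\<Oplus>\<^bsub>Hom_module C X Y\<^esub>k\<in>I. g k)"
proof -
  interpret M: abelian_group "Hom_module C X Y"
    by (rule Hom_abelian[OF assms(1,2)])
  show ?thesis
    by (rule M.finsum_cong') (use assms(3,4) in \<open>auto simp: Hom_module_simps\<close>)
qed

lemma linear_map_finsum:
  assumes F: "linear_map X Y X' Y' F" and f: "\<And>k. k \<in> I \<Longrightarrow> f k \<in> Hom C X Y"
  shows "F (\<Oplus>\<^bsub>Hom_module C X Y\<^esub>k\<in>I. f k) = (\<Oplus>\<^bsub>Hom_module C X' Y'\<^esub>k\<in>I. F (f k))"
proof -
  have o: "X \<in> Obj C" "Y \<in> Obj C" "X' \<in> Obj C" "Y' \<in> Obj C"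
    using F by (simp_all add: linear_map_def)
  interpret M: abelian_group "Hom_module C X Y"
    by (rule Hom_abelian[OF o(1,2)])
  interpret M': abelian_group "Hom_module C X' Y'"
    by (rule Hom_abelian[OF o(3,4)])
  show ?thesis
    using f
  proof (induction I rule: infinite_finite_induct)
    case (infinite A)
    then show ?case
      using linear_map_zero[OF F] by (simp add: Hom_module_simps)
  next
    case empty
    then show ?case
      using linear_map_zero[OF F] by (simp add: Hom_module_simps)
  next
    case (insert x A)
    have f: "f \<in> A \<rightarrow> carrier (Hom_module C X Y)" "f x \<in> carrier (Hom_module C X Y)"
      using insert.prems by (auto simp: Hom_module_simps)
    have Ff: "(\<lambda>k. F (f k)) \<in> A \<rightarrow> carrier (Hom_module C X' Y')" "F (f x) \<in> carrier (Hom_module C X' Y')"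
      using insert.prems linear_map_Hom[OF F] by (auto simp: Hom_module_simps)
    have "F (\<Oplus>\<^bsub>Hom_module C X Y\<^esub>k\<in>insert x A. f k) = F (f x \<oplus>\<^sub>m (\<Oplus>\<^bsub>Hom_module C X Y\<^esub>k\<in>A. f k))"
      using M.finsum_insert[OF insert.hyps f] by (simp add: Hom_module_simps)
    also have "\<dots> = F (f x) \<oplus>\<^sub>m F (\<Oplus>\<^bsub>Hom_module C X Y\<^esub>k\<in>A. f k)"
      using F f(2) M.finsum_closed[OF f(1)] by (simp add: linear_map_def Hom_module_simps)
    also have "\<dots> = F (f x) \<oplus>\<^sub>m (\<Oplus>\<^bsub>Hom_module C X' Y'\<^esub>k\<in>A. F (f k))"
      using insert by simp
    also have "\<dots> = (\<Oplus>\<^bsub>Hom_module C X' Y'\<^esub>k\<in>insert x A. F (f k))"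
      using M'.finsum_insert[OF insert.hyps Ff] by (simp add: Hom_module_simps)
    finally show ?case .
  qed
qed

text \<open>
  Equalities of sums are proved in this form throughout: two linear maps of a morphism that agree on
  the summands.
\<close>

lemma linear_maps_eq_on_finsum:
  assumes "linear_map X Y X' Y' F" "linear_map X Y X' Y' G"
    and "\<And>k. k \<in> I \<Longrightarrow> f k \<in> Hom C X Y" "\<And>k. k \<in> I \<Longrightarrow> F (f k) = G (f k)"
  shows "F (\<Oplus>\<^bsub>Hom_module C X Y\<^esub>k\<in>I. f k) = G (\<Oplus>\<^bsub>Hom_module C X Y\<^esub>k\<in>I. f k)"
proof -
  have "(\<Oplus>\<^bsub>Hom_module C X' Y'\<^esub>k\<in>I. F (f k)) = (\<Oplus>\<^bsub>Hom_module C X' Y'\<^esub>k\<in>I. G (f k))"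
    using assms by (intro finsum_Hom_cong) (auto simp: linear_map_def)
  then show ?thesis
    using linear_map_finsum[of X Y X' Y' F I f] linear_map_finsum[of X Y X' Y' G I f] assms by simp
qed

lemma finsum_Hom_delta:
  assumes "X \<in> Obj C" "Y \<in> Obj C" "finite I" "\<And>k. k \<in> I \<Longrightarrow> f k \<in> Hom C X Y"
  shows "(\<Oplus>\<^bsub>Hom_module C X Y\<^esub>k\<in>I. if k = i then f k else arr_zero C X Y)
    = (if i \<in> I then f i else arr_zero C X Y)"
proof -
  interpret M: abelian_group "Hom_module C X Y"
    by (rule Hom_abelian[OF assms(1,2)])
  note s = Hom_module_simps[of X Y]
  show ?thesis
  proof (cases "i \<in> I")
    case True
    then show ?thesis
      using M.add.finprod_singleton_swap[of i I f] assms(3,4) unfolding s(1,2) by auto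
  next
    case False
    have "(\<Oplus>\<^bsub>Hom_module C X Y\<^esub>k\<in>I. if k = i then f k else arr_zero C X Y)
        = (\<Oplus>\<^bsub>Hom_module C X Y\<^esub>k\<in>I. arr_zero C X Y)"
      using False assms arr_zero_Hom by (intro finsum_Hom_cong) auto
    then show ?thesis
      using False M.finsum_zero[of I] by (simp add: s)
  qed
qed

lemma direct_sum_ext:
  assumes "direct_sum C I S X p q" "f \<in> Hom C X Y" "g \<in> Hom C X Y"
    and "\<And>k. k \<in> I \<Longrightarrow> f \<cdot> q k = g \<cdot> q k"
  shows "f = g"
proof -
  have X: "X \<in> Obj C" and Y: "Y \<in> Obj C"
    using Hom_Obj[OF assms(2)] by auto
  have pq: "p k \<in> Hom C X (S k)" "q k \<in> Hom C (S k) X" if "k \<in> I" for k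
    using assms(1) that by (auto simp: direct_sum_def)
  have Id: "(\<Oplus>\<^bsub>Hom_module C X X\<^esub>k \<in> I. q k \<cdot> p k) = Ide C X"
    using assms(1) by (simp add: direct_sum_def)
  have "f \<cdot> (\<Oplus>\<^bsub>Hom_module C X X\<^esub>k \<in> I. q k \<cdot> p k) = g \<cdot> (\<Oplus>\<^bsub>Hom_module C X X\<^esub>k \<in> I. q k \<cdot> p k)"
  proof (rule linear_maps_eq_on_finsum)
    show "linear_map X X X Y (\<lambda>h. f \<cdot> h)" "linear_map X X X Y (\<lambda>h. g \<cdot> h)"
      by (rule linear_Comp_left; fact assms X)+
    show "q k \<cdot> p k \<in> Hom C X X" if "k \<in> I" for k
      using pq[OF that] by (rule Comp_Hom)
    show "f \<cdot> (q k \<cdot> p k) = g \<cdot> (q k \<cdot> p k)" if "k \<in> I" for k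
      using Comp_assoc[OF pq[OF that] assms(2)] Comp_assoc[OF pq[OF that] assms(3)] assms(4)[OF that] by simp
  qed
  then show ?thesis
    using assms(2,3) by (simp add: Id Ide_right)
qed

lemma direct_sum_ext_left:
  assumes "direct_sum C I S X p q" "f \<in> Hom C Y X" "g \<in> Hom C Y X"
    and "\<And>k. k \<in> I \<Longrightarrow> p k \<cdot> f = p k \<cdot> g"
  shows "f = g"
proof -
  have X: "X \<in> Obj C" and Y: "Y \<in> Obj C"
    using Hom_Obj[OF assms(2)] by auto
  have pq: "p k \<in> Hom C X (S k)" "q k \<in> Hom C (S k) X" if "k \<in> I" for k
    using assms(1) that by (auto simp: direct_sum_def)
  have Id: "(\<Oplus>\<^bsub>Hom_module C X X\<^esub>k \<in> I. q k \<cdot> p k) = Ide C X"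
    using assms(1) by (simp add: direct_sum_def)
  have "(\<Oplus>\<^bsub>Hom_module C X X\<^esub>k \<in> I. q k \<cdot> p k) \<cdot> f = (\<Oplus>\<^bsub>Hom_module C X X\<^esub>k \<in> I. q k \<cdot> p k) \<cdot> g"
  proof (rule linear_maps_eq_on_finsum)
    show "linear_map X X Y X (\<lambda>h. h \<cdot> f)" "linear_map X X Y X (\<lambda>h. h \<cdot> g)"
      by (rule linear_Comp_right; fact assms X)+
    show "q k \<cdot> p k \<in> Hom C X X" if "k \<in> I" for k
      using pq[OF that] by (rule Comp_Hom)
    show "(q k \<cdot> p k) \<cdot> f = (q k \<cdot> p k) \<cdot> g" if "k \<in> I" for k
      using Comp_assoc[OF assms(2) pq[OF that]] Comp_assoc[OF assms(3) pq[OF that]] assms(4)[OF that] by simp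
  qed
  then show ?thesis
    using assms(2,3) by (simp add: Id Ide_left)
qed

end

context ribbon_k_category
begin

lemma linear_tensor_left: "\<lbrakk>g \<in> Hom C X' Y'; X \<in> Obj C; Y \<in> Obj C\<rbrakk> \<Longrightarrow> linear_map X Y (X \<otimes>\<^sub>o X') (Y \<otimes>\<^sub>o Y') (\<lambda>f. f \<otimes>\<^sub>m g)"
  using Hom_Obj[of g X' Y'] tensor_Hom tensor_add_left tensor_smult_left
  by (auto simp: linear_map_def tensor_Obj)

lemma linear_tensor_right: "\<lbrakk>f \<in> Hom C X Y; X' \<in> Obj C; Y' \<in> Obj C\<rbrakk> \<Longrightarrow> linear_map X' Y' (X \<otimes>\<^sub>o X') (Y \<otimes>\<^sub>o Y') (\<lambda>g. f \<otimes>\<^sub>m g)"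
  using Hom_Obj[of f X Y] tensor_Hom tensor_add_right tensor_smult_right
  by (auto simp: linear_map_def tensor_Obj)

lemma linear_dual_arr:
  assumes "X \<in> Obj C" "Y \<in> Obj C"
  shows "linear_map X Y (dual_obj C Y) (dual_obj C X) (dual_arr C)"
proof -
  let ?X' = "dual_obj C X" and ?Y' = "dual_obj C Y"
  note o = assms assms[THEN dual_Obj]
  have 1: "linear_map X Y (?Y' \<otimes>\<^sub>o X) (?Y' \<otimes>\<^sub>o Y) (\<lambda>f. Ide C ?Y' \<otimes>\<^sub>m f)"
    using o by (intro linear_tensor_right Ide_Hom)
  have 2: "linear_map (?Y' \<otimes>\<^sub>o X) (?Y' \<otimes>\<^sub>o Y) (?Y' \<otimes>\<^sub>o X \<otimes>\<^sub>o ?X') (?Y' \<otimes>\<^sub>o Y \<otimes>\<^sub>o ?X') (\<lambda>f. f \<otimes>\<^sub>m Ide C ?X')"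
    using o by (intro linear_tensor_left Ide_Hom tensor_Obj)
  have 3: "linear_map (?Y' \<otimes>\<^sub>o X \<otimes>\<^sub>o ?X') (?Y' \<otimes>\<^sub>o Y \<otimes>\<^sub>o ?X') (?Y' \<otimes>\<^sub>o X \<otimes>\<^sub>o ?X') ?X' (\<lambda>f. (ev C Y \<otimes>\<^sub>m Ide C ?X') \<cdot> f)"
    using o by (intro linear_Comp_left) (simp_all add: Hom_def rbase)
  have 4: "linear_map (?Y' \<otimes>\<^sub>o X \<otimes>\<^sub>o ?X') ?X' ?Y' ?X' (\<lambda>f. f \<cdot> (Ide C ?Y' \<otimes>\<^sub>m coev C X))"
    using o by (intro linear_Comp_right) (simp_all add: Hom_def rbase)
  show ?thesis
    by (rule linear_map_cong[OF linear_map_compose[OF linear_map_compose[OF linear_map_compose[OF 1 2] 3] 4]])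
      (auto simp: dual_arr_def Let_def Hom_def)
qed

lemma linear_bend_up:
  assumes "M \<in> Obj C" "X \<in> Obj C" "N \<in> Obj C"
  shows "linear_map (M \<otimes>\<^sub>o X) N M (N \<otimes>\<^sub>o dual_obj C X) (bend_up M X)"
proof -
  let ?X' = "dual_obj C X"
  note o = assms dual_Obj[OF assms(2)]
  have 1: "linear_map (M \<otimes>\<^sub>o X) N (M \<otimes>\<^sub>o X \<otimes>\<^sub>o ?X') (N \<otimes>\<^sub>o ?X') (\<lambda>f. f \<otimes>\<^sub>m Ide C ?X')"
    using o by (intro linear_tensor_left Ide_Hom tensor_Obj)
  have 2: "linear_map (M \<otimes>\<^sub>o X \<otimes>\<^sub>o ?X') (N \<otimes>\<^sub>o ?X') M (N \<otimes>\<^sub>o ?X') (\<lambda>f. f \<cdot> (Ide C M \<otimes>\<^sub>m coev C X))"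
    using o by (intro linear_Comp_right) (simp_all add: Hom_def rbase)
  show ?thesis
    by (rule linear_map_cong[OF linear_map_compose[OF 1 2]]) (simp add: bend_up_def)
qed

lemma linear_unroll:
  assumes "X \<in> Obj C" "N \<in> Obj C"
  shows "linear_map (N \<otimes>\<^sub>o dual_obj C X) (N \<otimes>\<^sub>o dual_obj C X) (dual_obj C X \<otimes>\<^sub>o X) (dual_obj C N \<otimes>\<^sub>o N) (unroll N X)"
proof -
  let ?X' = "dual_obj C X" and ?N' = "dual_obj C N" and ?Z = "N \<otimes>\<^sub>o dual_obj C X"
  note o = assms assms[THEN dual_Obj]
  have 1: "linear_map ?Z ?Z (?N' \<otimes>\<^sub>o ?Z) (?N' \<otimes>\<^sub>o ?Z) (\<lambda>f. Ide C ?N' \<otimes>\<^sub>m f)"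
    using o by (intro linear_tensor_right Ide_Hom tensor_Obj)
  have 2: "linear_map (?N' \<otimes>\<^sub>o ?Z) (?N' \<otimes>\<^sub>o ?Z) (?N' \<otimes>\<^sub>o ?Z \<otimes>\<^sub>o X) (?N' \<otimes>\<^sub>o ?Z \<otimes>\<^sub>o X) (\<lambda>f. f \<otimes>\<^sub>m Ide C X)"
    using o by (intro linear_tensor_left Ide_Hom tensor_Obj)
  have 3: "linear_map (?N' \<otimes>\<^sub>o ?Z \<otimes>\<^sub>o X) (?N' \<otimes>\<^sub>o ?Z \<otimes>\<^sub>o X) (?N' \<otimes>\<^sub>o ?Z \<otimes>\<^sub>o X) (?N' \<otimes>\<^sub>o N)
      (\<lambda>f. (Ide C (?N' \<otimes>\<^sub>o N) \<otimes>\<^sub>m ev C X) \<cdot> f)"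
    using o by (intro linear_Comp_left) (simp_all add: Hom_def rbase)
  have 4: "linear_map (?N' \<otimes>\<^sub>o ?Z \<otimes>\<^sub>o X) (?N' \<otimes>\<^sub>o N) (?X' \<otimes>\<^sub>o X) (?N' \<otimes>\<^sub>o N)
      (\<lambda>f. f \<cdot> (coev_r C N \<otimes>\<^sub>m Ide C (?X' \<otimes>\<^sub>o X)))"
    using o by (intro linear_Comp_right) (simp_all add: Hom_def dbase)
  show ?thesis
    by (rule linear_map_cong[OF linear_map_compose[OF linear_map_compose[OF linear_map_compose[OF 1 2] 3] 4]])
      (simp add: unroll_def)
qed

lemma linear_trace_arr:
  assumes "X \<in> Obj C"
  shows "linear_map X X \<bbbone> \<bbbone> trace_arr"
proof -
  let ?X' = "dual_obj C X"
  note o = assms assms[THEN dual_Obj]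
  have 1: "linear_map X X (X \<otimes>\<^sub>o ?X') (X \<otimes>\<^sub>o ?X') (\<lambda>f. f \<otimes>\<^sub>m Ide C ?X')"
    using o by (intro linear_tensor_left Ide_Hom)
  have 2: "linear_map (X \<otimes>\<^sub>o ?X') (X \<otimes>\<^sub>o ?X') (X \<otimes>\<^sub>o ?X') \<bbbone> (\<lambda>f. ev_r C X \<cdot> f)"
    using o by (intro linear_Comp_left) (simp_all add: Hom_def dbase)
  have 3: "linear_map (X \<otimes>\<^sub>o ?X') \<bbbone> \<bbbone> \<bbbone> (\<lambda>f. f \<cdot> coev C X)"
    using o by (intro linear_Comp_right) (simp_all add: Hom_def rbase)
  show ?thesis
    by (rule linear_map_cong[OF linear_map_compose[OF linear_map_compose[OF 1 2] 3]])
      (auto simp add: trace_arr_def Hom_def)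
qed

lemma smult_Ide_inject:
  assumes "scalar_object K C X" "a \<in> carrier K" "b \<in> carrier K" "a \<odot>\<^sub>m Ide C X = b \<odot>\<^sub>m Ide C X"
  shows "a = b"
  using assms by (auto simp: scalar_object_def bij_betw_def inj_on_def)

lemma scalar_obtain:
  assumes "scalar_object K C X" "f \<in> Hom C X X"
  obtains a where "a \<in> carrier K" "f = a \<odot>\<^sub>m Ide C X"
  using assms by (auto simp: scalar_object_def bij_betw_def)

text \<open>
  The description of \<open>tr_q\<close> is uniquely satisfied because the unit object is scalar.
\<close>

lemma tr_q_trace_arr:
  assumes "f \<in> Hom C X X"
  shows "tr_q K C f \<in> carrier K" "tr_q K C f \<odot>\<^sub>m Ide C \<bbbone> = trace_arr f"
proof -
  obtain a where a: "a \<in> carrier K" "trace_arr f = a \<odot>\<^sub>m Ide C \<bbbone>"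
    by (rule scalar_obtain[OF scalar_tunit trace_arr_typing[OF assms]])
  have tr: "tr_q K C f = (THE a. a \<in> carrier K \<and> a \<odot>\<^sub>m Ide C \<bbbone> = trace_arr f)"
    using assms by (simp add: tr_q_def Let_def trace_arr_def)
  have "tr_q K C f = a"
    unfolding tr
  proof (rule the_equality)
    show "a \<in> carrier K \<and> a \<odot>\<^sub>m Ide C \<bbbone> = trace_arr f"
      using a by simp
    show "b = a" if "b \<in> carrier K \<and> b \<odot>\<^sub>m Ide C \<bbbone> = trace_arr f" for b
      using that a by (intro smult_Ide_inject[OF scalar_tunit]) auto
  qed
  then show "tr_q K C f \<in> carrier K" "tr_q K C f \<odot>\<^sub>m Ide C \<bbbone> = trace_arr f"
    using a by auto
qed

lemma tr_q_eqI:
  assumes "f \<in> Hom C X X" "g \<in> Hom C Y Y" "trace_arr f = trace_arr g"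
  shows "tr_q K C f = tr_q K C g"
  using assms tr_q_trace_arr[OF assms(1)] tr_q_trace_arr[OF assms(2)]
  by (intro smult_Ide_inject[OF scalar_tunit]) auto

lemma dim_q_closed: "X \<in> Obj C \<Longrightarrow> dim_q K C X \<in> carrier K"
  unfolding dim_q_def by (rule tr_q_trace_arr(1)[OF Ide_Hom])

lemma dim_q_trace_arr: "X \<in> Obj C \<Longrightarrow> dim_q K C X \<odot>\<^sub>m Ide C \<bbbone> = trace_arr (Ide C X)"
  unfolding dim_q_def by (rule tr_q_trace_arr(2)[OF Ide_Hom])

lemma dim_q_dual:
  assumes "X \<in> Obj C"
  shows "dim_q K C (dual_obj C X) = dim_q K C X"
  unfolding dim_q_def
proof (rule tr_q_eqI)
  show "Ide C (dual_obj C X) \<in> Hom C (dual_obj C X) (dual_obj C X)" "Ide C X \<in> Hom C X X"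
    using assms by (simp_all add: Ide_Hom dual_Obj)
  show "trace_arr (Ide C (dual_obj C X)) = trace_arr (Ide C X)"
    using trace_Ide_dual[OF assms] assms by (simp add: trace_arr_def dlayers)
qed

lemma dim_q_iso:
  assumes u: "u \<in> Hom C X Y" "v \<in> Hom C Y X" "v \<cdot> u = Ide C X" "u \<cdot> v = Ide C Y"
  shows "dim_q K C X = dim_q K C Y"
  unfolding dim_q_def
proof (rule tr_q_eqI)
  show "Ide C X \<in> Hom C X X" "Ide C Y \<in> Hom C Y Y"
    using Hom_Obj[OF u(1)] by (auto intro: Ide_Hom)
  show "trace_arr (Ide C X) = trace_arr (Ide C Y)"
    using trace_cyclic[OF u(1,2)] u(3,4) by simp
qed

lemma negligible_zero:
  assumes "X \<in> Obj C" "Y \<in> Obj C"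
  shows "negligible K C (arr_zero C X Y)"
  unfolding negligible_def
proof (intro conjI ballI)
  note z = arr_zero_typing[OF assms]
  show "arr_zero C X Y \<in> Arr C"
    by (rule z)
  fix g assume "g \<in> Hom C (Cod C (arr_zero C X Y)) (Dom C (arr_zero C X Y))"
  then have g: "g \<in> Hom C Y X"
    by (simp add: z)
  have 0: "g \<cdot> arr_zero C X Y = arr_zero C X X"
    using linear_map_zero[OF linear_Comp_left[OF g assms(1)]] by simp
  have "tr_q K C (arr_zero C X X) \<odot>\<^sub>m Ide C \<bbbone> = arr_zero C \<bbbone> \<bbbone>"
    using tr_q_trace_arr(2)[OF arr_zero_Hom[OF assms(1,1)]] linear_map_zero[OF linear_trace_arr[OF assms(1)]]
    by simp
  also have "\<dots> = \<zero>\<^bsub>K\<^esub> \<odot>\<^sub>m Ide C \<bbbone>"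
    using arr_smult_null[OF tunit_Obj tunit_Obj Ide_Hom[OF tunit_Obj]] by simp
  finally show "tr_q K C (g \<cdot> arr_zero C X Y) = \<zero>\<^bsub>K\<^esub>"
    unfolding 0 using tr_q_trace_arr(1)[OF arr_zero_Hom[OF assms(1,1)]]
    by (intro smult_Ide_inject[OF scalar_tunit]) auto
qed

lemma negligible_minus_self:
  assumes "f \<in> Hom C X Y"
  shows "negligible K C (f \<ominus>\<^bsub>Hom_module C X Y\<^esub> f)"
proof -
  note o = Hom_Obj[OF assms]
  interpret M: abelian_group "Hom_module C X Y"
    by (rule Hom_abelian[OF o])
  show ?thesis
    using negligible_zero[OF o] M.r_neg[of f] assms by (simp add: a_minus_def Hom_module_simps)
qed

end

context ribbon_k_category
begin

lemma arr_add_rules: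
  assumes "f \<in> Arr C" "g \<in> Arr C" "Dom C f = Dom C g" "Cod C f = Cod C g"
  shows "f \<oplus>\<^sub>m g \<in> Arr C" "Dom C (f \<oplus>\<^sub>m g) = Dom C g" "Cod C (f \<oplus>\<^sub>m g) = Cod C g"
    "\<lbrakk>h \<in> Arr C; Dom C h = Cod C g\<rbrakk> \<Longrightarrow> h \<cdot> (f \<oplus>\<^sub>m g) = h \<cdot> f \<oplus>\<^sub>m h \<cdot> g"
    "\<lbrakk>h \<in> Arr C; Cod C h = Dom C g\<rbrakk> \<Longrightarrow> (f \<oplus>\<^sub>m g) \<cdot> h = f \<cdot> h \<oplus>\<^sub>m g \<cdot> h"
    "h \<in> Arr C \<Longrightarrow> h \<otimes>\<^sub>m (f \<oplus>\<^sub>m g) = h \<otimes>\<^sub>m f \<oplus>\<^sub>m h \<otimes>\<^sub>m g"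
    "h \<in> Arr C \<Longrightarrow> (f \<oplus>\<^sub>m g) \<otimes>\<^sub>m h = f \<otimes>\<^sub>m h \<oplus>\<^sub>m g \<otimes>\<^sub>m h"
    "dual_arr C (f \<oplus>\<^sub>m g) = dual_arr C f \<oplus>\<^sub>m dual_arr C g"
proof -
  have o: "Dom C g \<in> Obj C" "Cod C g \<in> Obj C"
    using assms(2) by (auto intro: Dom_Obj Cod_Obj)
  have H: "f \<in> Hom C (Dom C g) (Cod C g)" "g \<in> Hom C (Dom C g) (Cod C g)"
    using assms by (simp_all add: Hom_def)
  have "f \<oplus>\<^sub>m g \<in> Hom C (Dom C g) (Cod C g)"
    using arr_add_Hom[OF o H] .
  then show "f \<oplus>\<^sub>m g \<in> Arr C" "Dom C (f \<oplus>\<^sub>m g) = Dom C g" "Cod C (f \<oplus>\<^sub>m g) = Cod C g"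
    by (simp_all add: Hom_def)
  show "h \<cdot> (f \<oplus>\<^sub>m g) = h \<cdot> f \<oplus>\<^sub>m h \<cdot> g" if "h \<in> Arr C" "Dom C h = Cod C g"
    by (rule Comp_add_right[OF H]) (use that in \<open>simp add: Hom_def\<close>)
  show "(f \<oplus>\<^sub>m g) \<cdot> h = f \<cdot> h \<oplus>\<^sub>m g \<cdot> h" if "h \<in> Arr C" "Cod C h = Dom C g"
    by (rule Comp_add_left[OF _ H]) (use that in \<open>simp add: Hom_def\<close>)
  show "h \<otimes>\<^sub>m (f \<oplus>\<^sub>m g) = h \<otimes>\<^sub>m f \<oplus>\<^sub>m h \<otimes>\<^sub>m g" if "h \<in> Arr C"
    by (rule tensor_add_right[OF _ H, of _ "Dom C h" "Cod C h"]) (use that in \<open>simp add: Hom_def\<close>)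
  show "(f \<oplus>\<^sub>m g) \<otimes>\<^sub>m h = f \<otimes>\<^sub>m h \<oplus>\<^sub>m g \<otimes>\<^sub>m h" if "h \<in> Arr C"
    by (rule tensor_add_left[OF H, of _ "Dom C h" "Cod C h"]) (use that in \<open>simp add: Hom_def\<close>)
  show "dual_arr C (f \<oplus>\<^sub>m g) = dual_arr C f \<oplus>\<^sub>m dual_arr C g"
    using linear_dual_arr[OF o] H by (simp add: linear_map_def)
qed

lemma arr_smult_rules:
  assumes "a \<in> carrier K" "f \<in> Arr C"
  shows "a \<odot>\<^sub>m f \<in> Arr C" "Dom C (a \<odot>\<^sub>m f) = Dom C f" "Cod C (a \<odot>\<^sub>m f) = Cod C f"
    "\<lbrakk>h \<in> Arr C; Dom C h = Cod C f\<rbrakk> \<Longrightarrow> h \<cdot> (a \<odot>\<^sub>m f) = a \<odot>\<^sub>m (h \<cdot> f)"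
    "\<lbrakk>h \<in> Arr C; Cod C h = Dom C f\<rbrakk> \<Longrightarrow> (a \<odot>\<^sub>m f) \<cdot> h = a \<odot>\<^sub>m (f \<cdot> h)"
    "h \<in> Arr C \<Longrightarrow> h \<otimes>\<^sub>m (a \<odot>\<^sub>m f) = a \<odot>\<^sub>m (h \<otimes>\<^sub>m f)"
    "h \<in> Arr C \<Longrightarrow> (a \<odot>\<^sub>m f) \<otimes>\<^sub>m h = a \<odot>\<^sub>m (f \<otimes>\<^sub>m h)"
    "dual_arr C (a \<odot>\<^sub>m f) = a \<odot>\<^sub>m dual_arr C f"
proof -
  have o: "Dom C f \<in> Obj C" "Cod C f \<in> Obj C"
    using assms(2) by (auto intro: Dom_Obj Cod_Obj)
  have H: "f \<in> Hom C (Dom C f) (Cod C f)"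
    using assms by (simp_all add: Hom_def)
  have "a \<odot>\<^sub>m f \<in> Hom C (Dom C f) (Cod C f)"
    using arr_smult_Hom[OF o assms(1) H] .
  then show "a \<odot>\<^sub>m f \<in> Arr C" "Dom C (a \<odot>\<^sub>m f) = Dom C f" "Cod C (a \<odot>\<^sub>m f) = Cod C f"
    by (simp_all add: Hom_def)
  show "h \<cdot> (a \<odot>\<^sub>m f) = a \<odot>\<^sub>m (h \<cdot> f)" if "h \<in> Arr C" "Dom C h = Cod C f"
    by (rule Comp_smult_right[OF assms(1) H]) (use that in \<open>simp add: Hom_def\<close>)
  show "(a \<odot>\<^sub>m f) \<cdot> h = a \<odot>\<^sub>m (f \<cdot> h)" if "h \<in> Arr C" "Cod C h = Dom C f"
    by (rule Comp_smult_left[OF assms(1) _ H]) (use that in \<open>simp add: Hom_def\<close>)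
  show "h \<otimes>\<^sub>m (a \<odot>\<^sub>m f) = a \<odot>\<^sub>m (h \<otimes>\<^sub>m f)" if "h \<in> Arr C"
    by (rule tensor_smult_right[OF assms(1) _ H, of _ "Dom C h" "Cod C h"]) (use that in \<open>simp add: Hom_def\<close>)
  show "(a \<odot>\<^sub>m f) \<otimes>\<^sub>m h = a \<odot>\<^sub>m (f \<otimes>\<^sub>m h)" if "h \<in> Arr C"
    by (rule tensor_smult_left[OF assms(1) H, of _ "Dom C h" "Cod C h"]) (use that in \<open>simp add: Hom_def\<close>)
  show "dual_arr C (a \<odot>\<^sub>m f) = a \<odot>\<^sub>m dual_arr C f"
    using linear_dual_arr[OF o] H assms(1) by (simp add: linear_map_def)
qed

lemmas linearity = linear_map_def Hom_def arr_add_rules arr_smult_rules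

end

section \<open>The universal property of the coend\<close>

text \<open>
  The semisimple part of the setting: a finite set of pairwise \<open>Hom\<close>-orthogonal scalar objects, of which
  every object is a finite direct sum. The last condition is part of \<open>semisimple_coend\<close>, which assigns
  to each object such a decomposition.
\<close>

locale scalar_semisimple_coend = ribbon_k_category K C
  for K :: "('k, 'r) ring_scheme" and C :: "('k, 'o, 'm, 'z) ribbon_category_scheme" (structure) +
  fixes L :: "'o set" and B :: 'o and p q j :: "'o \<Rightarrow> 'm"
  assumes scalar_L: "l \<in> L \<Longrightarrow> scalar_object K C l"
    and schur: "\<lbrakk>l \<in> L; m \<in> L; l \<noteq> m; f \<in> Hom C l m\<rbrakk> \<Longrightarrow> f = arr_zero C l m"
    and coend: "semisimple_coend C L B p q j"
begin

lemma L_Obj: "l \<in> L \<Longrightarrow> l \<in> Obj C"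
  using scalar_L by (simp add: scalar_object_def)

lemma B_sum: "direct_sum C L (\<lambda>l. dual_obj C l \<otimes>\<^sub>o l) B p q"
  using coend by (simp add: semisimple_coend_def)

lemma B_typing:
  "finite L" "B \<in> Obj C"
  "l \<in> L \<Longrightarrow> p l \<in> Arr C" "l \<in> L \<Longrightarrow> Dom C (p l) = B" "l \<in> L \<Longrightarrow> Cod C (p l) = dual_obj C l \<otimes>\<^sub>o l"
  "l \<in> L \<Longrightarrow> q l \<in> Arr C" "l \<in> L \<Longrightarrow> Dom C (q l) = dual_obj C l \<otimes>\<^sub>o l" "l \<in> L \<Longrightarrow> Cod C (q l) = B"
  using B_sum by (auto simp: direct_sum_def Hom_def)

lemma p_q: "\<lbrakk>l \<in> L; m \<in> L\<rbrakk> \<Longrightarrow>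
    p l \<cdot> q m = (if l = m then Ide C (dual_obj C l \<otimes>\<^sub>o l) else arr_zero C (dual_obj C m \<otimes>\<^sub>o m) (dual_obj C l \<otimes>\<^sub>o l))"
  using B_sum by (simp add: direct_sum_def)

lemma decomposition:
  assumes "X \<in> Obj C"
  obtains n :: nat and S p' q' where "\<forall>k<n. S k \<in> L" "direct_sum C {..<n} S X p' q'"
    "j X = (\<Oplus>\<^bsub>Hom_module C (dual_obj C X \<otimes>\<^sub>o X) B\<^esub>k \<in> {..<n}. q (S k) \<cdot> (dual_arr C (q' k) \<otimes>\<^sub>m p' k))"
  using coend assms by (force simp: semisimple_coend_def)

lemma direct_sum_typing:
  assumes "direct_sum C I S X p' q'" "k \<in> I"
  shows "S k \<in> Obj C" "p' k \<in> Arr C" "Dom C (p' k) = X" "Cod C (p' k) = S k"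
    "q' k \<in> Arr C" "Dom C (q' k) = S k" "Cod C (q' k) = X"
  using assms by (auto simp: direct_sum_def Hom_def)

lemma j_typing:
  assumes "X \<in> Obj C"
  shows "j X \<in> Arr C" "Dom C (j X) = dual_obj C X \<otimes>\<^sub>o X" "Cod C (j X) = B"
proof -
  obtain n :: nat and S p' q' where d: "\<forall>k<n. S k \<in> L" "direct_sum C {..<n} S X p' q'"
    "j X = (\<Oplus>\<^bsub>Hom_module C (dual_obj C X \<otimes>\<^sub>o X) B\<^esub>k \<in> {..<n}. q (S k) \<cdot> (dual_arr C (q' k) \<otimes>\<^sub>m p' k))"
    by (rule decomposition[OF assms])
  have "j X \<in> Hom C (dual_obj C X \<otimes>\<^sub>o X) B"
    unfolding d(3) using assms d(1) direct_sum_typing[OF d(2)]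
    by (intro finsum_Hom) (simp_all add: dbase B_typing Hom_def)
  then show "j X \<in> Arr C" "Dom C (j X) = dual_obj C X \<otimes>\<^sub>o X" "Cod C (j X) = B"
    by (simp_all add: Hom_def)
qed

lemmas cbase = dbase B_typing L_Obj j_typing
lemmas cmerge = dmerge B_typing L_Obj j_typing
lemmas clayers = dlayers B_typing L_Obj j_typing

text \<open>
  Between the chosen simple objects there are only zero arrows and multiples of identities.
\<close>

lemma q_dinatural:
  assumes S: "S \<in> L" and T: "T \<in> L" and u: "u \<in> Hom C S T"
  shows "q T \<cdot> (Ide C (dual_obj C T) \<otimes>\<^sub>m u) = q S \<cdot> (dual_arr C u \<otimes>\<^sub>m Ide C S)"
proof -
  let ?F = "\<lambda>u. q T \<cdot> (Ide C (dual_obj C T) \<otimes>\<^sub>m u)" and ?G = "\<lambda>u. q S \<cdot> (dual_arr C u \<otimes>\<^sub>m Ide C S)"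
  have F: "linear_map S T (dual_obj C T \<otimes>\<^sub>o S) B ?F" and G: "linear_map S T (dual_obj C T \<otimes>\<^sub>o S) B ?G"
    using S T by (auto simp: linearity cbase)
  show ?thesis
  proof (cases "S = T")
    case True
    obtain a where "a \<in> carrier K" "u = a \<odot>\<^sub>m Ide C S"
      using scalar_obtain[OF scalar_L[OF S]] u True by blast
    moreover have "?F (Ide C S) = ?G (Ide C S)"
      using S True by (simp add: dual_Ide L_Obj)
    ultimately show ?thesis
      using linear_map_smult[OF F, of a "Ide C S"] linear_map_smult[OF G, of a "Ide C S"] S True
      by (simp add: Ide_Hom L_Obj)
  next
    case False
    then show ?thesis
      using schur[OF S T False u] linear_map_zero[OF F] linear_map_zero[OF G] by simp
  qed
qed

text \<open>
  Although \<open>j X\<close> is computed from an arbitrary decomposition of X, its value on the dual of an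
  arrow out of X that factors through a simple object S depends only on the factorization. Both
  dinaturality of \<open>j\<close> and \<open>j l = q l\<close> are special cases.
\<close>

lemma j_through_simple:
  assumes S: "S \<in> L" and g: "g \<in> Hom C X S" and v: "v \<in> Hom C S Y"
  shows "j X \<cdot> (dual_arr C (v \<cdot> g) \<otimes>\<^sub>m Ide C X) = q S \<cdot> (dual_arr C v \<otimes>\<^sub>m g)"
proof -
  have [simp]: "g \<in> Arr C" "Dom C g = X" "Cod C g = S" "v \<in> Arr C" "Dom C v = S" "Cod C v = Y"
    "X \<in> Obj C" "Y \<in> Obj C" "S \<in> Obj C" "S \<in> L"
    using S g v Hom_Obj[OF g] Hom_Obj[OF v] by (auto simp: Hom_def)
  obtain n :: nat and T p' q' where T: "\<forall>k<n. T k \<in> L" and d: "direct_sum C {..<n} T X p' q'"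
    and jX: "j X = (\<Oplus>\<^bsub>Hom_module C (dual_obj C X \<otimes>\<^sub>o X) B\<^esub>k \<in> {..<n}. q (T k) \<cdot> (dual_arr C (q' k) \<otimes>\<^sub>m p' k))"
    by (rule decomposition[OF \<open>X \<in> Obj C\<close>])
  note t = direct_sum_typing[OF d]
  let ?F = "\<lambda>f. f \<cdot> (dual_arr C (v \<cdot> g) \<otimes>\<^sub>m Ide C X)"
  let ?G = "\<lambda>h. q S \<cdot> (dual_arr C v \<otimes>\<^sub>m (g \<cdot> h))"
  have F: "linear_map (dual_obj C X \<otimes>\<^sub>o X) B (dual_obj C Y \<otimes>\<^sub>o X) B ?F"
    by (auto simp: linearity cbase)
  have G: "linear_map X X (dual_obj C Y \<otimes>\<^sub>o X) B ?G"
    by (auto simp: linearity cbase)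
  have eq: "?F (q (T k) \<cdot> (dual_arr C (q' k) \<otimes>\<^sub>m p' k)) = ?G (q' k \<cdot> p' k)" if "k < n" for k
  proof -
    have [simp]: "T k \<in> L" "T k \<in> Obj C" "p' k \<in> Arr C" "Dom C (p' k) = X" "Cod C (p' k) = T k"
      "q' k \<in> Arr C" "Dom C (q' k) = T k" "Cod C (q' k) = X"
      using that T t[of k] by auto
    let ?u = "g \<cdot> q' k"
    have "?F (q (T k) \<cdot> (dual_arr C (q' k) \<otimes>\<^sub>m p' k))
        = (q (T k) \<cdot> (dual_arr C ?u \<otimes>\<^sub>m Ide C (T k))) \<cdot> (dual_arr C v \<otimes>\<^sub>m p' k)"
      by (simp add: dual_Comp cmerge)
    also have "q (T k) \<cdot> (dual_arr C ?u \<otimes>\<^sub>m Ide C (T k)) = q S \<cdot> (Ide C (dual_obj C S) \<otimes>\<^sub>m ?u)"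
      by (rule q_dinatural[symmetric]) (simp_all add: Hom_def cbase)
    finally show ?thesis
      by (simp add: cmerge)
  qed
  have "j X \<cdot> (dual_arr C (v \<cdot> g) \<otimes>\<^sub>m Ide C X)
      = (\<Oplus>\<^bsub>Hom_module C (dual_obj C Y \<otimes>\<^sub>o X) B\<^esub>k \<in> {..<n}. ?F (q (T k) \<cdot> (dual_arr C (q' k) \<otimes>\<^sub>m p' k)))"
    unfolding jX by (rule linear_map_finsum[OF F]) (use T t in \<open>simp add: Hom_def cbase\<close>)
  also have "\<dots> = (\<Oplus>\<^bsub>Hom_module C (dual_obj C Y \<otimes>\<^sub>o X) B\<^esub>k \<in> {..<n}. ?G (q' k \<cdot> p' k))"
    by (rule finsum_Hom_cong) (use T t eq in \<open>simp_all add: Hom_def cbase\<close>)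
  also have "\<dots> = ?G (\<Oplus>\<^bsub>Hom_module C X X\<^esub>k \<in> {..<n}. q' k \<cdot> p' k)"
    by (rule linear_map_finsum[OF G, symmetric]) (use T t in \<open>simp add: Hom_def cbase\<close>)
  also have "\<dots> = ?G (Ide C X)"
    using d by (simp add: direct_sum_def)
  finally show ?thesis
    by (simp add: cbase)
qed

lemma j_simple:
  assumes "l \<in> L"
  shows "j l = q l"
  using j_through_simple[OF assms Ide_Hom[OF L_Obj[OF assms]] Ide_Hom[OF L_Obj[OF assms]]] assms
  by (simp add: dual_Ide L_Obj Comp_unit Ide_typing clayers)

lemma j_dinatural:
  assumes f: "f \<in> Hom C X Y"
  shows "j Y \<cdot> (Ide C (dual_obj C Y) \<otimes>\<^sub>m f) = j X \<cdot> (dual_arr C f \<otimes>\<^sub>m Ide C X)"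
proof -
  have [simp]: "f \<in> Arr C" "Dom C f = X" "Cod C f = Y" "X \<in> Obj C" "Y \<in> Obj C"
    using f Hom_Obj[OF f] by (auto simp: Hom_def)
  obtain n :: nat and T p' q' where T: "\<forall>k<n. T k \<in> L" and d: "direct_sum C {..<n} T Y p' q'"
    and jY: "j Y = (\<Oplus>\<^bsub>Hom_module C (dual_obj C Y \<otimes>\<^sub>o Y) B\<^esub>k \<in> {..<n}. q (T k) \<cdot> (dual_arr C (q' k) \<otimes>\<^sub>m p' k))"
    by (rule decomposition[OF \<open>Y \<in> Obj C\<close>])
  note t = direct_sum_typing[OF d]
  let ?F = "\<lambda>h. h \<cdot> (Ide C (dual_obj C Y) \<otimes>\<^sub>m f)"
  let ?G = "\<lambda>h. j X \<cdot> (dual_arr C (h \<cdot> f) \<otimes>\<^sub>m Ide C X)"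
  have F: "linear_map (dual_obj C Y \<otimes>\<^sub>o Y) B (dual_obj C Y \<otimes>\<^sub>o X) B ?F"
    by (auto simp: linearity cbase)
  have G: "linear_map Y Y (dual_obj C Y \<otimes>\<^sub>o X) B ?G"
    by (auto simp: linearity cbase)
  have eq: "?F (q (T k) \<cdot> (dual_arr C (q' k) \<otimes>\<^sub>m p' k)) = ?G (q' k \<cdot> p' k)" if "k < n" for k
  proof -
    have [simp]: "T k \<in> L" "T k \<in> Obj C" "p' k \<in> Arr C" "Dom C (p' k) = Y" "Cod C (p' k) = T k"
      "q' k \<in> Arr C" "Dom C (q' k) = T k" "Cod C (q' k) = Y"
      using that T t[of k] by auto
    have "?G (q' k \<cdot> p' k) = j X \<cdot> (dual_arr C (q' k \<cdot> (p' k \<cdot> f)) \<otimes>\<^sub>m Ide C X)"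
      by (simp add: cbase)
    also have "\<dots> = q (T k) \<cdot> (dual_arr C (q' k) \<otimes>\<^sub>m (p' k \<cdot> f))"
      by (rule j_through_simple[of _ _ _ _ Y]) (simp_all add: Hom_def cbase)
    finally show ?thesis
      by (simp add: cmerge)
  qed
  have "j Y \<cdot> (Ide C (dual_obj C Y) \<otimes>\<^sub>m f)
      = (\<Oplus>\<^bsub>Hom_module C (dual_obj C Y \<otimes>\<^sub>o X) B\<^esub>k \<in> {..<n}. ?F (q (T k) \<cdot> (dual_arr C (q' k) \<otimes>\<^sub>m p' k)))"
    unfolding jY by (rule linear_map_finsum[OF F]) (use T t in \<open>simp add: Hom_def cbase\<close>)
  also have "\<dots> = (\<Oplus>\<^bsub>Hom_module C (dual_obj C Y \<otimes>\<^sub>o X) B\<^esub>k \<in> {..<n}. ?G (q' k \<cdot> p' k))"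
    by (rule finsum_Hom_cong) (use T t eq in \<open>simp_all add: Hom_def cbase\<close>)
  also have "\<dots> = ?G (\<Oplus>\<^bsub>Hom_module C Y Y\<^esub>k \<in> {..<n}. q' k \<cdot> p' k)"
    by (rule linear_map_finsum[OF G, symmetric]) (use T t in \<open>simp add: Hom_def cbase\<close>)
  also have "\<dots> = ?G (Ide C Y)"
    using d by (simp add: direct_sum_def)
  finally show ?thesis
    by (simp add: cbase)
qed

text \<open>
  Tensoring preserves the coend, because it is a direct sum. The objects U and V next to B allow the
  universal property to be applied in one factor of a tensor product at a time; so does \<open>coend_factor\<close>.
\<close>

lemma coend_ext:
  assumes "U \<in> Obj C" "V \<in> Obj C"
    and d: "d \<in> Hom C (U \<otimes>\<^sub>o B \<otimes>\<^sub>o V) Z" and d': "d' \<in> Hom C (U \<otimes>\<^sub>o B \<otimes>\<^sub>o V) Z"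
    and eq: "\<And>l. l \<in> L \<Longrightarrow> d \<cdot> (Ide C U \<otimes>\<^sub>m j l \<otimes>\<^sub>m Ide C V) = d' \<cdot> (Ide C U \<otimes>\<^sub>m j l \<otimes>\<^sub>m Ide C V)"
  shows "d = d'"
proof -
  have [simp]: "U \<in> Obj C" "V \<in> Obj C" "Z \<in> Obj C" "d \<in> Arr C" "d' \<in> Arr C" "Cod C d = Z" "Cod C d' = Z"
    "Dom C d = U \<otimes>\<^sub>o B \<otimes>\<^sub>o V" "Dom C d' = U \<otimes>\<^sub>o B \<otimes>\<^sub>o V"
    using assms Hom_Obj[OF d] by (auto simp: Hom_def)
  let ?F = "\<lambda>d h. d \<cdot> (Ide C U \<otimes>\<^sub>m h \<otimes>\<^sub>m Ide C V)"
  have F: "linear_map B B (U \<otimes>\<^sub>o B \<otimes>\<^sub>o V) Z (?F d)" "linear_map B B (U \<otimes>\<^sub>o B \<otimes>\<^sub>o V) Z (?F d')"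
    by (auto simp: linearity cbase)
  have "?F d (\<Oplus>\<^bsub>Hom_module C B B\<^esub>l \<in> L. q l \<cdot> p l) = ?F d' (\<Oplus>\<^bsub>Hom_module C B B\<^esub>l \<in> L. q l \<cdot> p l)"
  proof (rule linear_maps_eq_on_finsum[OF F])
    fix l assume [simp]: "l \<in> L"
    show "q l \<cdot> p l \<in> Hom C B B"
      by (simp add: Hom_def cbase)
    have r: "?F h (q l \<cdot> p l) = (h \<cdot> (Ide C U \<otimes>\<^sub>m j l \<otimes>\<^sub>m Ide C V)) \<cdot> (Ide C U \<otimes>\<^sub>m p l \<otimes>\<^sub>m Ide C V)"
      if "h \<in> Arr C" "Dom C h = U \<otimes>\<^sub>o B \<otimes>\<^sub>o V" for h
      using that by (simp add: clayers j_simple)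
    show "?F d (q l \<cdot> p l) = ?F d' (q l \<cdot> p l)"
      by (subst (1 2) r) (simp_all only: eq \<open>l \<in> L\<close>, simp_all add: cbase)
  qed
  moreover have "(\<Oplus>\<^bsub>Hom_module C B B\<^esub>l \<in> L. q l \<cdot> p l) = Ide C B"
    using B_sum by (simp add: direct_sum_def)
  ultimately show ?thesis
    by (simp add: clayers)
qed

text \<open>
  The arrow is determined by its values on the simple objects. That it has the right value on X follows by
  writing the identity of X as a sum over a decomposition and moving the injections across by
  dinaturality.
\<close>

lemma coend_factor:
  assumes "U \<in> Obj C" "V \<in> Obj C"
    and f: "\<And>X. X \<in> Obj C \<Longrightarrow> f X \<in> Hom C (U \<otimes>\<^sub>o (dual_obj C X \<otimes>\<^sub>o X) \<otimes>\<^sub>o V) Z"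
    and din: "\<And>X Y g. g \<in> Hom C X Y \<Longrightarrow>
      f Y \<cdot> (Ide C U \<otimes>\<^sub>m (Ide C (dual_obj C Y) \<otimes>\<^sub>m g) \<otimes>\<^sub>m Ide C V)
      = f X \<cdot> (Ide C U \<otimes>\<^sub>m (dual_arr C g \<otimes>\<^sub>m Ide C X) \<otimes>\<^sub>m Ide C V)"
  obtains d where "d \<in> Hom C (U \<otimes>\<^sub>o B \<otimes>\<^sub>o V) Z"
    "\<And>X. X \<in> Obj C \<Longrightarrow> d \<cdot> (Ide C U \<otimes>\<^sub>m j X \<otimes>\<^sub>m Ide C V) = f X"
proof -
  have [simp]: "U \<in> Obj C" "V \<in> Obj C" "Z \<in> Obj C"
    using assms(1,2) Hom_Obj(2)[OF f[OF tunit_Obj]] by auto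
  have f_typing: "f X \<in> Arr C" "Dom C (f X) = U \<otimes>\<^sub>o (dual_obj C X \<otimes>\<^sub>o X) \<otimes>\<^sub>o V" "Cod C (f X) = Z"
    if "X \<in> Obj C" for X
    using f[OF that] by (auto simp: Hom_def)
  note fbase = cbase f_typing
  let ?W = "\<lambda>h. Ide C U \<otimes>\<^sub>m h \<otimes>\<^sub>m Ide C V"
  define d where "d = (\<Oplus>\<^bsub>Hom_module C (U \<otimes>\<^sub>o B \<otimes>\<^sub>o V) Z\<^esub>l \<in> L. f l \<cdot> ?W (p l))"
  have d: "d \<in> Hom C (U \<otimes>\<^sub>o B \<otimes>\<^sub>o V) Z"
    unfolding d_def by (rule finsum_Hom) (simp_all add: fbase Hom_def)
  then have d_typing [simp]: "d \<in> Arr C" "Dom C d = U \<otimes>\<^sub>o (B \<otimes>\<^sub>o V)" "Cod C d = Z"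
    by (auto simp: Hom_def fbase)
  have dq: "d \<cdot> ?W (q m) = f m" if [simp]: "m \<in> L" for m
  proof -
    let ?Z = "U \<otimes>\<^sub>o (dual_obj C m \<otimes>\<^sub>o m) \<otimes>\<^sub>o V"
    have F: "linear_map (U \<otimes>\<^sub>o B \<otimes>\<^sub>o V) Z ?Z Z (\<lambda>h. h \<cdot> ?W (q m))"
      by (auto simp: linearity fbase)
    have G: "linear_map (dual_obj C m \<otimes>\<^sub>o m) (dual_obj C l \<otimes>\<^sub>o l) ?Z Z (\<lambda>h. f l \<cdot> ?W h)" if "l \<in> L" for l
      using that by (auto simp: linearity fbase)
    have "d \<cdot> ?W (q m) = (\<Oplus>\<^bsub>Hom_module C ?Z Z\<^esub>l \<in> L. (f l \<cdot> ?W (p l)) \<cdot> ?W (q m))"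
      unfolding d_def by (rule linear_map_finsum[OF F]) (simp add: fbase Hom_def)
    also have "\<dots> = (\<Oplus>\<^bsub>Hom_module C ?Z Z\<^esub>l \<in> L. if l = m then f m else arr_zero C ?Z Z)"
    proof (rule finsum_Hom_cong)
      fix l assume [simp]: "l \<in> L"
      show "(if l = m then f m else arr_zero C ?Z Z) \<in> Hom C ?Z Z"
        using f[of m] by (simp add: fbase arr_zero_Hom)
      have "(f l \<cdot> ?W (p l)) \<cdot> ?W (q m) = f l \<cdot> ?W (p l \<cdot> q m)"
        using clayers f_typing by (simp add: f_typing clayers)
      also have "\<dots> = (if l = m then f m else arr_zero C ?Z Z)"
        using linear_map_zero[OF G[of l]] by (simp add: p_q clayers f_typing)
      finally show "(f l \<cdot> ?W (p l)) \<cdot> ?W (q m) = (if l = m then f m else arr_zero C ?Z Z)" .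
    qed (simp_all add: fbase)
    also have "\<dots> = (if m \<in> L then f m else arr_zero C ?Z Z)"
      using finsum_Hom_delta[of ?Z Z L "\<lambda>_. f m" m] f[of m] by (simp add: fbase)
    finally show ?thesis
      by simp
  qed
  show thesis
  proof (rule that[OF d])
    fix X assume [simp]: "X \<in> Obj C"
    obtain n :: nat and T p' q' where T: "\<forall>k<n. T k \<in> L" and ds: "direct_sum C {..<n} T X p' q'"
      and jX: "j X = (\<Oplus>\<^bsub>Hom_module C (dual_obj C X \<otimes>\<^sub>o X) B\<^esub>k \<in> {..<n}. q (T k) \<cdot> (dual_arr C (q' k) \<otimes>\<^sub>m p' k))"
      by (rule decomposition[OF \<open>X \<in> Obj C\<close>])
    note t = direct_sum_typing[OF ds]
    let ?Z = "U \<otimes>\<^sub>o (dual_obj C X \<otimes>\<^sub>o X) \<otimes>\<^sub>o V"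
    let ?F = "\<lambda>h. d \<cdot> ?W h" and ?G = "\<lambda>h. f X \<cdot> ?W (Ide C (dual_obj C X) \<otimes>\<^sub>m h)"
    have F: "linear_map (dual_obj C X \<otimes>\<^sub>o X) B ?Z Z ?F"
      by (auto simp: linearity fbase)
    have G: "linear_map X X ?Z Z ?G"
      by (auto simp: linearity fbase)
    have eq: "?F (q (T k) \<cdot> (dual_arr C (q' k) \<otimes>\<^sub>m p' k)) = ?G (q' k \<cdot> p' k)" if "k < n" for k
    proof -
      have [simp]: "T k \<in> L" "T k \<in> Obj C" "p' k \<in> Arr C" "Dom C (p' k) = X" "Cod C (p' k) = T k"
        "q' k \<in> Arr C" "Dom C (q' k) = T k" "Cod C (q' k) = X"
        using that T t[of k] by auto
      have "dual_arr C (q' k) \<otimes>\<^sub>m p' k = (dual_arr C (q' k) \<otimes>\<^sub>m Ide C (T k)) \<cdot> (Ide C (dual_obj C X) \<otimes>\<^sub>m p' k)"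
        by (simp add: cmerge)
      then have "?F (q (T k) \<cdot> (dual_arr C (q' k) \<otimes>\<^sub>m p' k))
          = ((d \<cdot> ?W (q (T k))) \<cdot> ?W (dual_arr C (q' k) \<otimes>\<^sub>m Ide C (T k))) \<cdot> ?W (Ide C (dual_obj C X) \<otimes>\<^sub>m p' k)"
        by (simp add: clayers)
      also have "(d \<cdot> ?W (q (T k))) \<cdot> ?W (dual_arr C (q' k) \<otimes>\<^sub>m Ide C (T k))
          = f X \<cdot> ?W (Ide C (dual_obj C X) \<otimes>\<^sub>m q' k)"
        unfolding dq[OF \<open>T k \<in> L\<close>] by (rule din[symmetric]) (simp add: Hom_def)
      finally show ?thesis
        by (simp add: clayers f_typing)
    qed
    have "d \<cdot> ?W (j X) = (\<Oplus>\<^bsub>Hom_module C ?Z Z\<^esub>k \<in> {..<n}. ?F (q (T k) \<cdot> (dual_arr C (q' k) \<otimes>\<^sub>m p' k)))"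
      unfolding jX by (rule linear_map_finsum[OF F]) (use T t in \<open>simp add: Hom_def cbase\<close>)
    also have "\<dots> = (\<Oplus>\<^bsub>Hom_module C ?Z Z\<^esub>k \<in> {..<n}. ?G (q' k \<cdot> p' k))"
      by (rule finsum_Hom_cong) (use T t eq in \<open>simp_all add: Hom_def fbase\<close>)
    also have "\<dots> = ?G (\<Oplus>\<^bsub>Hom_module C X X\<^esub>k \<in> {..<n}. q' k \<cdot> p' k)"
      by (rule linear_map_finsum[OF G, symmetric]) (use T t in \<open>simp add: Hom_def cbase\<close>)
    also have "\<dots> = ?G (Ide C X)"
      using ds by (simp add: direct_sum_def)
    also have "\<dots> = f X"
      by (simp add: clayers f_typing)
    finally show "d \<cdot> ?W (j X) = f X" .
  qed
qed

end

section \<open>The Hopf algebra structure\<close>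

context scalar_semisimple_coend
begin

lemma coend_ext_plain:
  assumes "d \<in> Hom C B Z" "d' \<in> Hom C B Z" "\<And>l. l \<in> L \<Longrightarrow> d \<cdot> j l = d' \<cdot> j l"
  shows "d = d'"
  by (rule coend_ext[of \<bbbone> \<bbbone>]) (use assms in \<open>simp_all add: cbase\<close>)

lemma coend_factor_plain:
  assumes f: "\<And>X. X \<in> Obj C \<Longrightarrow> f X \<in> Hom C (dual_obj C X \<otimes>\<^sub>o X) Z"
    and din: "\<And>X Y g. g \<in> Hom C X Y \<Longrightarrow>
      f Y \<cdot> (Ide C (dual_obj C Y) \<otimes>\<^sub>m g) = f X \<cdot> (dual_arr C g \<otimes>\<^sub>m Ide C X)"
  shows "\<exists>!d. d \<in> Hom C B Z \<and> (\<forall>X \<in> Obj C. d \<cdot> j X = f X)"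
proof -
  obtain d where d: "d \<in> Hom C (\<bbbone> \<otimes>\<^sub>o B \<otimes>\<^sub>o \<bbbone>) Z"
    "\<And>X. X \<in> Obj C \<Longrightarrow> d \<cdot> (Ide C \<bbbone> \<otimes>\<^sub>m j X \<otimes>\<^sub>m Ide C \<bbbone>) = f X"
  proof (rule coend_factor[of \<bbbone> \<bbbone> f Z])
    fix X Y g assume g: "g \<in> Hom C X Y"
    then have "g \<in> Arr C" "Dom C g = X" "Cod C g = Y" "X \<in> Obj C" "Y \<in> Obj C"
      using Hom_Obj[OF g] by (auto simp: Hom_def)
    then show "f Y \<cdot> (Ide C \<bbbone> \<otimes>\<^sub>m (Ide C (dual_obj C Y) \<otimes>\<^sub>m g) \<otimes>\<^sub>m Ide C \<bbbone>)
      = f X \<cdot> (Ide C \<bbbone> \<otimes>\<^sub>m (dual_arr C g \<otimes>\<^sub>m Ide C X) \<otimes>\<^sub>m Ide C \<bbbone>)"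
      using din[OF g] by (simp add: cbase)
  qed (use f in \<open>simp_all add: cbase\<close>)
  show ?thesis
  proof (rule ex1I[of _ d])
    show "d \<in> Hom C B Z \<and> (\<forall>X \<in> Obj C. d \<cdot> j X = f X)"
      using d by (simp add: cbase)
    show "d' = d" if "d' \<in> Hom C B Z \<and> (\<forall>X \<in> Obj C. d' \<cdot> j X = f X)" for d'
      using d that by (intro coend_ext_plain[of d' Z d]) (simp_all add: cbase)
  qed
qed

lemma comult:
  shows comult_Hom: "coend_comult C B j \<in> Hom C B (B \<otimes>\<^sub>o B)"
    and comult_j: "X \<in> Obj C \<Longrightarrow> coend_comult C B j \<cdot> j X
      = (j X \<otimes>\<^sub>m j X) \<cdot> (Ide C (dual_obj C X) \<otimes>\<^sub>m coev C X \<otimes>\<^sub>m Ide C X)"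
proof -
  let ?f = "\<lambda>X. (j X \<otimes>\<^sub>m j X) \<cdot> (Ide C (dual_obj C X) \<otimes>\<^sub>m coev C X \<otimes>\<^sub>m Ide C X)"
  have "\<exists>!d. d \<in> Hom C B (B \<otimes>\<^sub>o B) \<and> (\<forall>X \<in> Obj C. d \<cdot> j X = ?f X)"
  proof (rule coend_factor_plain)
    show "?f X \<in> Hom C (dual_obj C X \<otimes>\<^sub>o X) (B \<otimes>\<^sub>o B)" if "X \<in> Obj C" for X
      using that by (simp add: Hom_def cbase)
  next
    fix X Y g assume g: "g \<in> Hom C X Y"
    then have [simp]: "g \<in> Arr C" "Dom C g = X" "Cod C g = Y" "X \<in> Obj C" "Y \<in> Obj C"
      using Hom_Obj[OF g] by (auto simp: Hom_def)
    let ?X' = "dual_obj C X" and ?Y' = "dual_obj C Y"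
    have "(Ide C ?Y' \<otimes>\<^sub>m coev C Y \<otimes>\<^sub>m Ide C Y) \<cdot> (Ide C ?Y' \<otimes>\<^sub>m g) = (Ide C ?Y' \<otimes>\<^sub>m coev C Y) \<otimes>\<^sub>m g"
      by (rule slide_left) (simp_all add: cbase)
    also have "\<dots> = (Ide C (?Y' \<otimes>\<^sub>o Y \<otimes>\<^sub>o ?Y') \<otimes>\<^sub>m g) \<cdot> (Ide C ?Y' \<otimes>\<^sub>m coev C Y \<otimes>\<^sub>m Ide C X)"
      by (rule slide_right[symmetric]) (simp_all add: cbase)
    finally have "?f Y \<cdot> (Ide C ?Y' \<otimes>\<^sub>m g)
        = (j Y \<otimes>\<^sub>m j Y) \<cdot> ((Ide C (?Y' \<otimes>\<^sub>o Y \<otimes>\<^sub>o ?Y') \<otimes>\<^sub>m g) \<cdot> (Ide C ?Y' \<otimes>\<^sub>m coev C Y \<otimes>\<^sub>m Ide C X))"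
      by (simp add: cbase)
    also have "\<dots> = ((j Y \<otimes>\<^sub>m j Y) \<cdot> (Ide C (?Y' \<otimes>\<^sub>o Y) \<otimes>\<^sub>m (Ide C ?Y' \<otimes>\<^sub>m g))) \<cdot> (Ide C ?Y' \<otimes>\<^sub>m coev C Y \<otimes>\<^sub>m Ide C X)"
      by (simp add: clayers)
    also have "(j Y \<otimes>\<^sub>m j Y) \<cdot> (Ide C (?Y' \<otimes>\<^sub>o Y) \<otimes>\<^sub>m (Ide C ?Y' \<otimes>\<^sub>m g)) = j Y \<otimes>\<^sub>m (j Y \<cdot> (Ide C ?Y' \<otimes>\<^sub>m g))"
      using interchange[of "Ide C (?Y' \<otimes>\<^sub>o Y)" "j Y" "Ide C ?Y' \<otimes>\<^sub>m g" "j Y"] by (simp add: cbase)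
    also have "j Y \<cdot> (Ide C ?Y' \<otimes>\<^sub>m g) = j X \<cdot> (dual_arr C g \<otimes>\<^sub>m Ide C X)"
      by (rule j_dinatural[OF g])
    also have "j Y \<otimes>\<^sub>m \<dots> = (j Y \<otimes>\<^sub>m j X) \<cdot> (Ide C (?Y' \<otimes>\<^sub>o Y) \<otimes>\<^sub>m (dual_arr C g \<otimes>\<^sub>m Ide C X))"
      using interchange[of "Ide C (?Y' \<otimes>\<^sub>o Y)" "j Y" "dual_arr C g \<otimes>\<^sub>m Ide C X" "j X"] by (simp add: cbase)
    also have "\<dots> \<cdot> (Ide C ?Y' \<otimes>\<^sub>m coev C Y \<otimes>\<^sub>m Ide C X)
        = (j Y \<otimes>\<^sub>m j X) \<cdot> (Ide C ?Y' \<otimes>\<^sub>m ((Ide C Y \<otimes>\<^sub>m dual_arr C g) \<cdot> coev C Y) \<otimes>\<^sub>m Ide C X)"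
      by (simp add: clayers)
    also have "(Ide C Y \<otimes>\<^sub>m dual_arr C g) \<cdot> coev C Y = (g \<otimes>\<^sub>m Ide C ?X') \<cdot> coev C X"
      by (rule coev_dual_arr) simp_all
    also have "(j Y \<otimes>\<^sub>m j X) \<cdot> (Ide C ?Y' \<otimes>\<^sub>m \<dots> \<otimes>\<^sub>m Ide C X)
        = ((j Y \<otimes>\<^sub>m j X) \<cdot> ((Ide C ?Y' \<otimes>\<^sub>m g) \<otimes>\<^sub>m Ide C (?X' \<otimes>\<^sub>o X))) \<cdot> (Ide C ?Y' \<otimes>\<^sub>m coev C X \<otimes>\<^sub>m Ide C X)"
      by (simp add: clayers)
    also have "(j Y \<otimes>\<^sub>m j X) \<cdot> ((Ide C ?Y' \<otimes>\<^sub>m g) \<otimes>\<^sub>m Ide C (?X' \<otimes>\<^sub>o X)) = (j Y \<cdot> (Ide C ?Y' \<otimes>\<^sub>m g)) \<otimes>\<^sub>m j X"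
      using interchange[of "Ide C ?Y' \<otimes>\<^sub>m g" "j Y" "Ide C (?X' \<otimes>\<^sub>o X)" "j X"] by (simp add: cbase)
    also have "j Y \<cdot> (Ide C ?Y' \<otimes>\<^sub>m g) = j X \<cdot> (dual_arr C g \<otimes>\<^sub>m Ide C X)"
      by (rule j_dinatural[OF g])
    also have "\<dots> \<otimes>\<^sub>m j X = (j X \<otimes>\<^sub>m j X) \<cdot> ((dual_arr C g \<otimes>\<^sub>m Ide C X) \<otimes>\<^sub>m Ide C (?X' \<otimes>\<^sub>o X))"
      using interchange[of "dual_arr C g \<otimes>\<^sub>m Ide C X" "j X" "Ide C (?X' \<otimes>\<^sub>o X)" "j X"] by (simp add: cbase)
    also have "\<dots> \<cdot> (Ide C ?Y' \<otimes>\<^sub>m coev C X \<otimes>\<^sub>m Ide C X) = ?f X \<cdot> (dual_arr C g \<otimes>\<^sub>m Ide C X)"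
      by (simp add: cmerge)
    finally show "?f Y \<cdot> (Ide C ?Y' \<otimes>\<^sub>m g) = ?f X \<cdot> (dual_arr C g \<otimes>\<^sub>m Ide C X)" .
  qed
  from theI'[OF this]
  show "coend_comult C B j \<in> Hom C B (B \<otimes>\<^sub>o B)"
    and "X \<in> Obj C \<Longrightarrow> coend_comult C B j \<cdot> j X = ?f X"
    unfolding coend_comult_def by simp_all
qed

lemma antipode:
  shows antipode_Hom: "coend_antipode C B j \<in> Hom C B B"
    and antipode_j: "X \<in> Obj C \<Longrightarrow> coend_antipode C B j \<cdot> j X
      = j (dual_obj C X) \<cdot> (bidual C X \<otimes>\<^sub>m twist C (dual_obj C X)) \<cdot> braid C (dual_obj C X) X"
proof -
  let ?f = "\<lambda>X. j (dual_obj C X) \<cdot> (bidual C X \<otimes>\<^sub>m twist C (dual_obj C X)) \<cdot> braid C (dual_obj C X) X"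
  have "\<exists>!d. d \<in> Hom C B B \<and> (\<forall>X \<in> Obj C. d \<cdot> j X = ?f X)"
  proof (rule coend_factor_plain)
    show "?f X \<in> Hom C (dual_obj C X \<otimes>\<^sub>o X) B" if "X \<in> Obj C" for X
      using that by (simp add: Hom_def cbase)
  next
    fix X Y g assume g: "g \<in> Hom C X Y"
    then have [simp]: "g \<in> Arr C" "Dom C g = X" "Cod C g = Y" "X \<in> Obj C" "Y \<in> Obj C"
      using Hom_Obj[OF g] by (auto simp: Hom_def)
    let ?X' = "dual_obj C X" and ?Y' = "dual_obj C Y" and ?g' = "dual_arr C g"
    have "?f Y \<cdot> (Ide C ?Y' \<otimes>\<^sub>m g) = j ?Y' \<cdot> ((bidual C Y \<otimes>\<^sub>m twist C ?Y') \<cdot> (braid C ?Y' Y \<cdot> (Ide C ?Y' \<otimes>\<^sub>m g)))"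
      by (simp add: cbase)
    also have "braid C ?Y' Y \<cdot> (Ide C ?Y' \<otimes>\<^sub>m g) = (g \<otimes>\<^sub>m Ide C ?Y') \<cdot> braid C ?Y' X"
      by (simp add: braid_nat cbase)
    also have "j ?Y' \<cdot> ((bidual C Y \<otimes>\<^sub>m twist C ?Y') \<cdot> \<dots>) = j ?Y' \<cdot> (((bidual C Y \<cdot> g) \<otimes>\<^sub>m twist C ?Y') \<cdot> braid C ?Y' X)"
      by (simp add: cmerge)
    also have "bidual C Y \<cdot> g = dual_arr C ?g' \<cdot> bidual C X"
      by (rule bidual_natural[symmetric]) simp_all
    also have "j ?Y' \<cdot> ((\<dots> \<otimes>\<^sub>m twist C ?Y') \<cdot> braid C ?Y' X)
        = (j ?Y' \<cdot> (dual_arr C ?g' \<otimes>\<^sub>m Ide C ?Y')) \<cdot> ((bidual C X \<otimes>\<^sub>m twist C ?Y') \<cdot> braid C ?Y' X)"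
      by (simp add: cmerge)
    also have "j ?Y' \<cdot> (dual_arr C ?g' \<otimes>\<^sub>m Ide C ?Y') = j ?X' \<cdot> (Ide C (dual_obj C ?X') \<otimes>\<^sub>m ?g')"
      by (rule j_dinatural[symmetric]) (simp add: Hom_def cbase)
    also have "\<dots> \<cdot> ((bidual C X \<otimes>\<^sub>m twist C ?Y') \<cdot> braid C ?Y' X)
        = j ?X' \<cdot> ((bidual C X \<otimes>\<^sub>m (?g' \<cdot> twist C ?Y')) \<cdot> braid C ?Y' X)"
      by (simp add: cmerge)
    also have "?g' \<cdot> twist C ?Y' = twist C ?X' \<cdot> ?g'"
      by (simp add: twist_nat cbase)
    also have "j ?X' \<cdot> ((bidual C X \<otimes>\<^sub>m \<dots>) \<cdot> braid C ?Y' X)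
        = j ?X' \<cdot> ((bidual C X \<otimes>\<^sub>m twist C ?X') \<cdot> ((Ide C X \<otimes>\<^sub>m ?g') \<cdot> braid C ?Y' X))"
      by (simp add: cmerge)
    also have "(Ide C X \<otimes>\<^sub>m ?g') \<cdot> braid C ?Y' X = braid C ?X' X \<cdot> (?g' \<otimes>\<^sub>m Ide C X)"
      by (simp add: braid_nat cbase)
    finally show "?f Y \<cdot> (Ide C ?Y' \<otimes>\<^sub>m g) = ?f X \<cdot> (?g' \<otimes>\<^sub>m Ide C X)"
      by (simp add: cbase)
  qed
  from theI'[OF this]
  show "coend_antipode C B j \<in> Hom C B B"
    and "X \<in> Obj C \<Longrightarrow> coend_antipode C B j \<cdot> j X = ?f X"
    unfolding coend_antipode_def by simp_all
qed

definition mult_family where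
  "mult_family X Y = j (Y \<otimes>\<^sub>o X) \<cdot> (dual_tensor C X Y \<otimes>\<^sub>m Ide C (Y \<otimes>\<^sub>o X))
     \<cdot> (Ide C (dual_obj C X) \<otimes>\<^sub>m braid C X (dual_obj C Y \<otimes>\<^sub>o Y))"

lemma mult_family_typing:
  assumes "X \<in> Obj C" "Y \<in> Obj C"
  shows "mult_family X Y \<in> Arr C" "Dom C (mult_family X Y) = dual_obj C X \<otimes>\<^sub>o (X \<otimes>\<^sub>o (dual_obj C Y \<otimes>\<^sub>o Y))"
    "Cod C (mult_family X Y) = B"
  using assms by (simp_all add: mult_family_def cbase)

lemma mult_family_dinatural:
  assumes f: "f \<in> Hom C X W" and g: "g \<in> Hom C Y Z"
  shows "mult_family W Z \<cdot> ((Ide C (dual_obj C W) \<otimes>\<^sub>m f) \<otimes>\<^sub>m (Ide C (dual_obj C Z) \<otimes>\<^sub>m g))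
    = mult_family X Y \<cdot> ((dual_arr C f \<otimes>\<^sub>m Ide C X) \<otimes>\<^sub>m (dual_arr C g \<otimes>\<^sub>m Ide C Y))"
proof -
  have [simp]: "f \<in> Arr C" "Dom C f = X" "Cod C f = W" "g \<in> Arr C" "Dom C g = Y" "Cod C g = Z"
    "X \<in> Obj C" "W \<in> Obj C" "Y \<in> Obj C" "Z \<in> Obj C"
    using f g Hom_Obj[OF f] Hom_Obj[OF g] by (auto simp: Hom_def)
  let ?X' = "dual_obj C X" and ?Y' = "dual_obj C Y" and ?Z' = "dual_obj C Z" and ?W' = "dual_obj C W"
  let ?f' = "dual_arr C f" and ?g' = "dual_arr C g" and ?V = "dual_obj C (Z \<otimes>\<^sub>o W)"
  have "mult_family W Z \<cdot> ((Ide C ?W' \<otimes>\<^sub>m f) \<otimes>\<^sub>m (Ide C ?Z' \<otimes>\<^sub>m g))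
      = j (Z \<otimes>\<^sub>o W) \<cdot> ((dual_tensor C W Z \<otimes>\<^sub>m Ide C (Z \<otimes>\<^sub>o W))
         \<cdot> (Ide C ?W' \<otimes>\<^sub>m (braid C W (?Z' \<otimes>\<^sub>o Z) \<cdot> (f \<otimes>\<^sub>m (Ide C ?Z' \<otimes>\<^sub>m g)))))"
    by (simp add: mult_family_def cmerge)
  also have "braid C W (?Z' \<otimes>\<^sub>o Z) \<cdot> (f \<otimes>\<^sub>m (Ide C ?Z' \<otimes>\<^sub>m g)) = (Ide C ?Z' \<otimes>\<^sub>m g \<otimes>\<^sub>m f) \<cdot> braid C X (?Z' \<otimes>\<^sub>o Y)"
    by (simp add: braid_nat cbase)
  also have "(dual_tensor C W Z \<otimes>\<^sub>m Ide C (Z \<otimes>\<^sub>o W)) \<cdot> (Ide C ?W' \<otimes>\<^sub>m \<dots>)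
      = ((dual_tensor C W Z \<otimes>\<^sub>m Ide C (Z \<otimes>\<^sub>o W)) \<cdot> (Ide C (?W' \<otimes>\<^sub>o ?Z') \<otimes>\<^sub>m (g \<otimes>\<^sub>m f))) \<cdot> (Ide C ?W' \<otimes>\<^sub>m braid C X (?Z' \<otimes>\<^sub>o Y))"
    by (simp add: clayers)
  also have "(dual_tensor C W Z \<otimes>\<^sub>m Ide C (Z \<otimes>\<^sub>o W)) \<cdot> (Ide C (?W' \<otimes>\<^sub>o ?Z') \<otimes>\<^sub>m (g \<otimes>\<^sub>m f)) = dual_tensor C W Z \<otimes>\<^sub>m (g \<otimes>\<^sub>m f)"
    by (rule slide_left) (simp_all add: cbase)
  also have "\<dots> = (Ide C ?V \<otimes>\<^sub>m (g \<otimes>\<^sub>m f)) \<cdot> (dual_tensor C W Z \<otimes>\<^sub>m Ide C (Y \<otimes>\<^sub>o X))"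
    by (rule slide_right[symmetric]) (simp_all add: cbase)
  also have "j (Z \<otimes>\<^sub>o W) \<cdot> (\<dots> \<cdot> (Ide C ?W' \<otimes>\<^sub>m braid C X (?Z' \<otimes>\<^sub>o Y)))
      = (j (Z \<otimes>\<^sub>o W) \<cdot> (Ide C ?V \<otimes>\<^sub>m (g \<otimes>\<^sub>m f))) \<cdot> ((dual_tensor C W Z \<otimes>\<^sub>m Ide C (Y \<otimes>\<^sub>o X))
         \<cdot> (Ide C ?W' \<otimes>\<^sub>m braid C X (?Z' \<otimes>\<^sub>o Y)))"
    by (simp add: cbase)
  also have "j (Z \<otimes>\<^sub>o W) \<cdot> (Ide C ?V \<otimes>\<^sub>m (g \<otimes>\<^sub>m f)) = j (Y \<otimes>\<^sub>o X) \<cdot> (dual_arr C (g \<otimes>\<^sub>m f) \<otimes>\<^sub>m Ide C (Y \<otimes>\<^sub>o X))"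
    by (rule j_dinatural) (simp add: Hom_def cbase)
  also have "\<dots> \<cdot> ((dual_tensor C W Z \<otimes>\<^sub>m Ide C (Y \<otimes>\<^sub>o X)) \<cdot> (Ide C ?W' \<otimes>\<^sub>m braid C X (?Z' \<otimes>\<^sub>o Y)))
      = j (Y \<otimes>\<^sub>o X) \<cdot> (((dual_arr C (g \<otimes>\<^sub>m f) \<cdot> dual_tensor C W Z) \<otimes>\<^sub>m Ide C (Y \<otimes>\<^sub>o X)) \<cdot> (Ide C ?W' \<otimes>\<^sub>m braid C X (?Z' \<otimes>\<^sub>o Y)))"
    by (simp add: clayers)
  also have "dual_arr C (g \<otimes>\<^sub>m f) \<cdot> dual_tensor C W Z = dual_tensor C X Y \<cdot> (?f' \<otimes>\<^sub>m ?g')"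
    by (rule dual_tensor_natural) simp_all
  also have "(\<dots> \<otimes>\<^sub>m Ide C (Y \<otimes>\<^sub>o X)) \<cdot> (Ide C ?W' \<otimes>\<^sub>m braid C X (?Z' \<otimes>\<^sub>o Y))
      = (dual_tensor C X Y \<otimes>\<^sub>m Ide C (Y \<otimes>\<^sub>o X)) \<cdot> ((?f' \<otimes>\<^sub>m (?g' \<otimes>\<^sub>m Ide C Y \<otimes>\<^sub>m Ide C X)) \<cdot> (Ide C ?W' \<otimes>\<^sub>m braid C X (?Z' \<otimes>\<^sub>o Y)))"
    by (simp add: clayers)
  also have "(?f' \<otimes>\<^sub>m (?g' \<otimes>\<^sub>m Ide C Y \<otimes>\<^sub>m Ide C X)) \<cdot> (Ide C ?W' \<otimes>\<^sub>m braid C X (?Z' \<otimes>\<^sub>o Y))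
      = ?f' \<otimes>\<^sub>m ((?g' \<otimes>\<^sub>m Ide C Y \<otimes>\<^sub>m Ide C X) \<cdot> braid C X (?Z' \<otimes>\<^sub>o Y))"
    by (simp add: cmerge)
  also have "(?g' \<otimes>\<^sub>m Ide C Y \<otimes>\<^sub>m Ide C X) \<cdot> braid C X (?Z' \<otimes>\<^sub>o Y) = braid C X (?Y' \<otimes>\<^sub>o Y) \<cdot> (Ide C X \<otimes>\<^sub>m (?g' \<otimes>\<^sub>m Ide C Y))"
    by (simp add: braid_nat cbase)
  also have "?f' \<otimes>\<^sub>m \<dots> = (Ide C ?X' \<otimes>\<^sub>m braid C X (?Y' \<otimes>\<^sub>o Y)) \<cdot> ((?f' \<otimes>\<^sub>m Ide C X) \<otimes>\<^sub>m (?g' \<otimes>\<^sub>m Ide C Y))"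
    by (simp add: cmerge)
  finally show ?thesis
    by (simp add: mult_family_def cbase)
qed

lemma mult_ext:
  assumes m: "m \<in> Hom C (B \<otimes>\<^sub>o B) Z" and m': "m' \<in> Hom C (B \<otimes>\<^sub>o B) Z"
    and eq: "\<And>X Y. \<lbrakk>X \<in> Obj C; Y \<in> Obj C\<rbrakk> \<Longrightarrow> m \<cdot> (j X \<otimes>\<^sub>m j Y) = m' \<cdot> (j X \<otimes>\<^sub>m j Y)"
  shows "m = m'"
proof (rule coend_ext[of B \<bbbone> _ Z])
  have [simp]: "m \<in> Arr C" "Dom C m = B \<otimes>\<^sub>o B" "Cod C m = Z" "m' \<in> Arr C" "Dom C m' = B \<otimes>\<^sub>o B" "Cod C m' = Z"
    using m m' by (auto simp: Hom_def)
  fix l assume [simp]: "l \<in> L"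
  let ?Y = "dual_obj C l \<otimes>\<^sub>o l"
  have "m \<cdot> (Ide C B \<otimes>\<^sub>m j l) = m' \<cdot> (Ide C B \<otimes>\<^sub>m j l)"
  proof (rule coend_ext[of \<bbbone> ?Y _ Z])
    fix k assume [simp]: "k \<in> L"
    show "(m \<cdot> (Ide C B \<otimes>\<^sub>m j l)) \<cdot> (Ide C \<bbbone> \<otimes>\<^sub>m j k \<otimes>\<^sub>m Ide C ?Y)
        = (m' \<cdot> (Ide C B \<otimes>\<^sub>m j l)) \<cdot> (Ide C \<bbbone> \<otimes>\<^sub>m j k \<otimes>\<^sub>m Ide C ?Y)"
      using eq[of k l] slide_right[of "j k" "j l" B ?Y] by (simp add: cbase)
  qed (simp_all add: Hom_def cbase)
  then show "m \<cdot> (Ide C B \<otimes>\<^sub>m j l \<otimes>\<^sub>m Ide C \<bbbone>) = m' \<cdot> (Ide C B \<otimes>\<^sub>m j l \<otimes>\<^sub>m Ide C \<bbbone>)"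
    by (simp add: cbase)
qed (use m m' in \<open>simp_all add: cbase\<close>)

text \<open>
  The universal property is applied in one variable after the other: first an arrow out of
  \<open>B \<otimes> (Y' \<otimes> Y)\<close> for each Y, which is then seen to be dinatural in Y.
\<close>

lemma mult:
  shows mult_Hom: "coend_mult C B j \<in> Hom C (B \<otimes>\<^sub>o B) B"
    and mult_j: "\<lbrakk>X \<in> Obj C; Y \<in> Obj C\<rbrakk> \<Longrightarrow> coend_mult C B j \<cdot> (j X \<otimes>\<^sub>m j Y) = mult_family X Y"
proof -
  note mbase = cbase mult_family_typing
  have "\<exists>M. M \<in> Hom C (B \<otimes>\<^sub>o (dual_obj C Y \<otimes>\<^sub>o Y)) B \<and>
      (\<forall>X \<in> Obj C. M \<cdot> (j X \<otimes>\<^sub>m Ide C (dual_obj C Y \<otimes>\<^sub>o Y)) = mult_family X Y)" if [simp]: "Y \<in> Obj C" for Y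
  proof -
    let ?V = "dual_obj C Y \<otimes>\<^sub>o Y"
    obtain M where M: "M \<in> Hom C (\<bbbone> \<otimes>\<^sub>o B \<otimes>\<^sub>o ?V) B"
      "\<And>X. X \<in> Obj C \<Longrightarrow> M \<cdot> (Ide C \<bbbone> \<otimes>\<^sub>m j X \<otimes>\<^sub>m Ide C ?V) = mult_family X Y"
    proof (rule coend_factor[of \<bbbone> ?V "\<lambda>X. mult_family X Y" B])
      fix X W g assume g: "g \<in> Hom C X W"
      then have [simp]: "g \<in> Arr C" "Dom C g = X" "Cod C g = W" "X \<in> Obj C" "W \<in> Obj C"
        using Hom_Obj[OF g] by (auto simp: Hom_def)
      show "mult_family W Y \<cdot> (Ide C \<bbbone> \<otimes>\<^sub>m (Ide C (dual_obj C W) \<otimes>\<^sub>m g) \<otimes>\<^sub>m Ide C ?V)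
          = mult_family X Y \<cdot> (Ide C \<bbbone> \<otimes>\<^sub>m (dual_arr C g \<otimes>\<^sub>m Ide C X) \<otimes>\<^sub>m Ide C ?V)"
        using mult_family_dinatural[OF g Ide_Hom[of Y]] by (simp add: mbase dual_Ide tensor_Ide_split)
    qed (simp_all add: Hom_def mbase)
    then show ?thesis
      by (intro exI[of _ M]) (simp add: cbase)
  qed
  then obtain M where M: "\<And>Y. Y \<in> Obj C \<Longrightarrow> M Y \<in> Hom C (B \<otimes>\<^sub>o (dual_obj C Y \<otimes>\<^sub>o Y)) B"
    and Mj: "\<And>X Y. \<lbrakk>X \<in> Obj C; Y \<in> Obj C\<rbrakk> \<Longrightarrow> M Y \<cdot> (j X \<otimes>\<^sub>m Ide C (dual_obj C Y \<otimes>\<^sub>o Y)) = mult_family X Y"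
    by metis
  have M_typing: "M Y \<in> Arr C" "Dom C (M Y) = B \<otimes>\<^sub>o (dual_obj C Y \<otimes>\<^sub>o Y)" "Cod C (M Y) = B" if "Y \<in> Obj C" for Y
    using M[OF that] by (auto simp: Hom_def)
  obtain m where m: "m \<in> Hom C (B \<otimes>\<^sub>o B \<otimes>\<^sub>o \<bbbone>) B"
    "\<And>Y. Y \<in> Obj C \<Longrightarrow> m \<cdot> (Ide C B \<otimes>\<^sub>m j Y \<otimes>\<^sub>m Ide C \<bbbone>) = M Y"
  proof (rule coend_factor[of B \<bbbone> M B])
    fix Y Z g assume g: "g \<in> Hom C Y Z"
    then have [simp]: "g \<in> Arr C" "Dom C g = Y" "Cod C g = Z" "Y \<in> Obj C" "Z \<in> Obj C"
      using Hom_Obj[OF g] by (auto simp: Hom_def)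
    let ?V = "dual_obj C Z \<otimes>\<^sub>o Y"
    have "M Z \<cdot> (Ide C B \<otimes>\<^sub>m (Ide C (dual_obj C Z) \<otimes>\<^sub>m g)) = M Y \<cdot> (Ide C B \<otimes>\<^sub>m (dual_arr C g \<otimes>\<^sub>m Ide C Y))"
    proof (rule coend_ext[of \<bbbone> ?V _ B])
      fix k assume [simp]: "k \<in> L"
      have "(M Z \<cdot> (Ide C B \<otimes>\<^sub>m (Ide C (dual_obj C Z) \<otimes>\<^sub>m g))) \<cdot> (Ide C \<bbbone> \<otimes>\<^sub>m j k \<otimes>\<^sub>m Ide C ?V)
          = (M Z \<cdot> (j k \<otimes>\<^sub>m Ide C (dual_obj C Z \<otimes>\<^sub>o Z))) \<cdot> (Ide C (dual_obj C k \<otimes>\<^sub>o k) \<otimes>\<^sub>m (Ide C (dual_obj C Z) \<otimes>\<^sub>m g))"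
        using slide_right[of "j k" "Ide C (dual_obj C Z) \<otimes>\<^sub>m g" B ?V]
          slide_left[of "j k" "Ide C (dual_obj C Z) \<otimes>\<^sub>m g" "dual_obj C k \<otimes>\<^sub>o k" "dual_obj C Z \<otimes>\<^sub>o Z"]
        by (simp add: cbase M_typing)
      also have "\<dots> = (M Y \<cdot> (j k \<otimes>\<^sub>m Ide C (dual_obj C Y \<otimes>\<^sub>o Y))) \<cdot> (Ide C (dual_obj C k \<otimes>\<^sub>o k) \<otimes>\<^sub>m (dual_arr C g \<otimes>\<^sub>m Ide C Y))"
        unfolding Mj[OF L_Obj[OF \<open>k \<in> L\<close>] \<open>Y \<in> Obj C\<close>] Mj[OF L_Obj[OF \<open>k \<in> L\<close>] \<open>Z \<in> Obj C\<close>]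
        using mult_family_dinatural[OF Ide_Hom[of k] g] by (simp add: mbase dual_Ide tensor_Ide_split)
      also have "\<dots> = (M Y \<cdot> (Ide C B \<otimes>\<^sub>m (dual_arr C g \<otimes>\<^sub>m Ide C Y))) \<cdot> (Ide C \<bbbone> \<otimes>\<^sub>m j k \<otimes>\<^sub>m Ide C ?V)"
        using slide_right[of "j k" "dual_arr C g \<otimes>\<^sub>m Ide C Y" B ?V]
          slide_left[of "j k" "dual_arr C g \<otimes>\<^sub>m Ide C Y" "dual_obj C k \<otimes>\<^sub>o k" "dual_obj C Y \<otimes>\<^sub>o Y"]
        by (simp add: cbase M_typing)
      finally show "(M Z \<cdot> (Ide C B \<otimes>\<^sub>m (Ide C (dual_obj C Z) \<otimes>\<^sub>m g))) \<cdot> (Ide C \<bbbone> \<otimes>\<^sub>m j k \<otimes>\<^sub>m Ide C ?V)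
          = (M Y \<cdot> (Ide C B \<otimes>\<^sub>m (dual_arr C g \<otimes>\<^sub>m Ide C Y))) \<cdot> (Ide C \<bbbone> \<otimes>\<^sub>m j k \<otimes>\<^sub>m Ide C ?V)" .
    qed (simp_all add: Hom_def cbase M_typing)
    then show "M Z \<cdot> (Ide C B \<otimes>\<^sub>m (Ide C (dual_obj C Z) \<otimes>\<^sub>m g) \<otimes>\<^sub>m Ide C \<bbbone>)
        = M Y \<cdot> (Ide C B \<otimes>\<^sub>m (dual_arr C g \<otimes>\<^sub>m Ide C Y) \<otimes>\<^sub>m Ide C \<bbbone>)"
      by (simp add: cbase)
  qed (simp_all add: Hom_def cbase M_typing)
  have mj: "m \<cdot> (j X \<otimes>\<^sub>m j Y) = mult_family X Y" if [simp]: "X \<in> Obj C" "Y \<in> Obj C" for X Y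
  proof -
    have "m \<in> Arr C" "Dom C m = B \<otimes>\<^sub>o B"
      using m(1) by (auto simp: Hom_def cbase)
    then have "m \<cdot> (j X \<otimes>\<^sub>m j Y) = (m \<cdot> (Ide C B \<otimes>\<^sub>m j Y)) \<cdot> (j X \<otimes>\<^sub>m Ide C (dual_obj C Y \<otimes>\<^sub>o Y))"
      using slide_right[of "j X" "j Y" B "dual_obj C Y \<otimes>\<^sub>o Y"] by (simp add: cbase)
    also have "m \<cdot> (Ide C B \<otimes>\<^sub>m j Y) = M Y"
      using m(2)[of Y] by (simp add: cbase)
    finally show ?thesis
      by (simp add: Mj)
  qed
  let ?P = "\<lambda>m. m \<in> Hom C (B \<otimes>\<^sub>o B) B \<and> (\<forall>X \<in> Obj C. \<forall>Y \<in> Obj C. m \<cdot> (j X \<otimes>\<^sub>m j Y) = mult_family X Y)"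
  have "\<exists>!m. ?P m"
  proof (rule ex1I[of _ m])
    show "?P m"
      using m(1) mj by (simp add: cbase)
    then show "m' = m" if "?P m'" for m'
      using that by (intro mult_ext[of m' B m]) auto
  qed
  from theI'[OF this]
  show "coend_mult C B j \<in> Hom C (B \<otimes>\<^sub>o B) B"
    and "\<lbrakk>X \<in> Obj C; Y \<in> Obj C\<rbrakk> \<Longrightarrow> coend_mult C B j \<cdot> (j X \<otimes>\<^sub>m j Y) = mult_family X Y"
    unfolding coend_mult_def mult_family_def by simp_all
qed

end

section \<open>Handle slides\<close>

context ribbon_k_category
begin

lemma finsum_Hom_zero:
  assumes "X \<in> Obj C" "Y \<in> Obj C"
  shows "(\<Oplus>\<^bsub>Hom_module C X Y\<^esub>k\<in>I. arr_zero C X Y) = arr_zero C X Y"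
proof -
  interpret M: abelian_group "Hom_module C X Y"
    by (rule Hom_abelian[OF assms])
  show ?thesis
    using M.finsum_zero[of I] by (simp add: Hom_module_simps)
qed

text \<open>
  If the identity of X' vanished, so would the evaluation of X, and then the identity of X by the zigzag
  identity.
\<close>

lemma Ide_dual_nonzero:
  assumes X: "scalar_object K C X"
  shows "Ide C (dual_obj C X) \<noteq> arr_zero C (dual_obj C X) (dual_obj C X)"
proof
  let ?X' = "dual_obj C X"
  have [simp]: "X \<in> Obj C"
    using X by (simp add: scalar_object_def)
  assume 0: "Ide C ?X' = arr_zero C ?X' ?X'"
  have lin: "linear_map ?X' ?X' X X (\<lambda>h. (Ide C X \<otimes>\<^sub>m (ev C X \<cdot> (h \<otimes>\<^sub>m Ide C X))) \<cdot> (coev C X \<otimes>\<^sub>m Ide C X))"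
    by (auto simp: linearity dbase)
  have "Ide C X = (Ide C X \<otimes>\<^sub>m (ev C X \<cdot> (Ide C ?X' \<otimes>\<^sub>m Ide C X))) \<cdot> (coev C X \<otimes>\<^sub>m Ide C X)"
    by (simp add: dlayers zigzag_rules)
  also have "\<dots> = arr_zero C X X"
    using linear_map_zero[OF lin] by (simp add: 0)
  also have "\<dots> = \<zero>\<^bsub>K\<^esub> \<odot>\<^sub>m Ide C X"
    using arr_smult_null[of X X "Ide C X"] by (simp add: Ide_Hom)
  finally have "\<one>\<^bsub>K\<^esub> \<odot>\<^sub>m Ide C X = \<zero>\<^bsub>K\<^esub> \<odot>\<^sub>m Ide C X"
    using arr_smult_one[of X X "Ide C X"] by (simp add: Ide_Hom)
  then have "\<one>\<^bsub>K\<^esub> = \<zero>\<^bsub>K\<^esub>"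
    by (rule smult_Ide_inject[OF X one_closed zero_closed])
  then show False
    by simp
qed

text \<open>
  The composites of f, g and i that are endomorphisms of M or N are scalars b and c. They are partial
  closures of one diagram, so taking traces gives \<open>b (d M) = c (d N)\<close>. This replaces the usual
  normalization of dual bases by \<open>d N / d M\<close> and does not need \<open>d M\<close> to be invertible.
\<close>

lemma dim_smult_bend:
  assumes M: "scalar_object K C M" and N: "scalar_object K C N" and [simp]: "X \<in> Obj C"
    and f: "f \<in> Hom C (M \<otimes>\<^sub>o X) N" and g: "g \<in> Hom C N (M \<otimes>\<^sub>o X)" and i: "i \<in> Hom C M (N \<otimes>\<^sub>o dual_obj C X)"
  shows "dim_q K C M \<odot>\<^sub>m ((bend_up M X f \<cdot> bend_up_r M X g) \<cdot> i)
    = dim_q K C N \<odot>\<^sub>m bend_up M X ((bend_down N X i \<cdot> g) \<cdot> f)"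
proof -
  have [simp]: "M \<in> Obj C" "N \<in> Obj C" "f \<in> Arr C" "Dom C f = M \<otimes>\<^sub>o X" "Cod C f = N"
    "g \<in> Arr C" "Dom C g = N" "Cod C g = M \<otimes>\<^sub>o X" "i \<in> Arr C" "Dom C i = M" "Cod C i = N \<otimes>\<^sub>o dual_obj C X"
    using M N f g i by (auto simp: Hom_def scalar_object_def)
  note bbase = dbase bend_up_typing bend_up_r_typing bend_down_typing
  let ?dM = "dim_q K C M" and ?dN = "dim_q K C N" and ?i = "bend_down N X i" and ?f = "bend_up M X f"
  have d[simp]: "?dM \<in> carrier K" "?dN \<in> carrier K"
    by (simp_all add: dim_q_closed)
  obtain b where b[simp]: "b \<in> carrier K" and gi: "bend_up_r M X g \<cdot> i = b \<odot>\<^sub>m Ide C M"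
    by (rule scalar_obtain[OF M, of "bend_up_r M X g \<cdot> i"]) (simp_all add: Hom_def bbase)
  obtain c where c[simp]: "c \<in> carrier K" and ig: "?i \<cdot> g = c \<odot>\<^sub>m Ide C N"
    by (rule scalar_obtain[OF N, of "?i \<cdot> g"]) (simp_all add: Hom_def bbase)
  have i_up: "i = bend_up M X ?i"
    by (rule bend_up_down[symmetric]) simp_all
  have tr: "trace_arr (a \<odot>\<^sub>m Ide C Y) = (a \<otimes>\<^bsub>K\<^esub> dim_q K C Y) \<odot>\<^sub>m Ide C \<bbbone>"
    if "a \<in> carrier K" "Y \<in> Obj C" for a Y
    using that linear_map_smult[OF linear_trace_arr[OF that(2)] that(1) Ide_Hom[OF that(2)]]
      arr_smult_smult[OF tunit_Obj tunit_Obj that(1) dim_q_closed[OF that(2)] Ide_Hom[OF tunit_Obj]]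
    by (simp add: dim_q_trace_arr)
  have "trace_arr (bend_up_r M X g \<cdot> bend_up M X ?i) = trace_arr (?i \<cdot> g)"
    by (rule trace_bend) (use g in \<open>simp_all add: Hom_def bbase\<close>)
  then have "(b \<otimes>\<^bsub>K\<^esub> ?dM) \<odot>\<^sub>m Ide C \<bbbone> = (c \<otimes>\<^bsub>K\<^esub> ?dN) \<odot>\<^sub>m Ide C \<bbbone>"
    unfolding i_up[symmetric] gi ig by (simp add: tr)
  then have "b \<otimes>\<^bsub>K\<^esub> ?dM = c \<otimes>\<^bsub>K\<^esub> ?dN"
    by (rule smult_Ide_inject[OF scalar_tunit, rotated 2]) simp_all
  then have bc: "?dM \<otimes>\<^bsub>K\<^esub> b = ?dN \<otimes>\<^bsub>K\<^esub> c"
    by (simp add: m_comm)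
  have fH: "?f \<in> Hom C M (N \<otimes>\<^sub>o dual_obj C X)"
    by (simp add: Hom_def bbase)
  have "?dM \<odot>\<^sub>m ((?f \<cdot> bend_up_r M X g) \<cdot> i) = ?dM \<odot>\<^sub>m (?f \<cdot> (b \<odot>\<^sub>m Ide C M))"
    by (simp add: bbase gi)
  also have "\<dots> = ?dM \<odot>\<^sub>m (b \<odot>\<^sub>m ?f)"
    by (simp add: arr_smult_rules bbase)
  also have "\<dots> = ?dN \<odot>\<^sub>m (c \<odot>\<^sub>m ?f)"
    using arr_smult_smult[OF _ _ _ _ fH, of ?dM b] arr_smult_smult[OF _ _ _ _ fH, of ?dN c] bc
    by (simp add: bbase)
  also have "c \<odot>\<^sub>m ?f = bend_up M X (c \<odot>\<^sub>m f)"
    by (rule linear_map_smult[OF linear_bend_up, symmetric]) (use f in \<open>simp_all add: bbase\<close>)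
  also have "c \<odot>\<^sub>m f = (?i \<cdot> g) \<cdot> f"
    unfolding ig by (simp add: arr_smult_rules bbase)
  finally show ?thesis .
qed

end

context scalar_semisimple_coend
begin

text \<open>
  For simple objects these are the vectors \<open>e l\<close>; for arbitrary objects they are needed for duals
  and serve to show independence of representatives.
\<close>

definition loop where
  "loop X = j X \<cdot> coev_r C X"

lemma loop_typing:
  assumes "X \<in> Obj C"
  shows "loop X \<in> Arr C" "Dom C (loop X) = \<bbbone>" "Cod C (loop X) = B"
  using assms by (simp_all add: loop_def cbase)

lemma loop_iso:
  assumes u: "u \<in> Hom C X Y" "v \<in> Hom C Y X" "v \<cdot> u = Ide C X" "u \<cdot> v = Ide C Y"
  shows "loop X = loop Y"
proof -
  have [simp]: "u \<in> Arr C" "Dom C u = X" "Cod C u = Y" "v \<in> Arr C" "Dom C v = Y" "Cod C v = X"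
    "X \<in> Obj C" "Y \<in> Obj C"
    using u Hom_Obj[OF u(1)] by (auto simp: Hom_def)
  let ?X' = "dual_obj C X" and ?Y' = "dual_obj C Y"
  have "loop Y = j Y \<cdot> ((Ide C ?Y' \<otimes>\<^sub>m (u \<cdot> v)) \<cdot> coev_r C Y)"
    by (simp add: loop_def u clayers)
  also have "\<dots> = (j Y \<cdot> (Ide C ?Y' \<otimes>\<^sub>m u)) \<cdot> ((Ide C ?Y' \<otimes>\<^sub>m v) \<cdot> coev_r C Y)"
    by (simp add: clayers)
  also have "j Y \<cdot> (Ide C ?Y' \<otimes>\<^sub>m u) = j X \<cdot> (dual_arr C u \<otimes>\<^sub>m Ide C X)"
    by (rule j_dinatural[OF u(1)])
  also have "\<dots> \<cdot> ((Ide C ?Y' \<otimes>\<^sub>m v) \<cdot> coev_r C Y)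
      = j X \<cdot> ((Ide C ?X' \<otimes>\<^sub>m v) \<cdot> ((dual_arr C u \<otimes>\<^sub>m Ide C Y) \<cdot> coev_r C Y))"
    by (simp add: cmerge)
  also have "(dual_arr C u \<otimes>\<^sub>m Ide C Y) \<cdot> coev_r C Y = (Ide C ?X' \<otimes>\<^sub>m u) \<cdot> coev_r C X"
    by (rule coev_r_dual_arr) simp_all
  also have "j X \<cdot> ((Ide C ?X' \<otimes>\<^sub>m v) \<cdot> \<dots>) = j X \<cdot> ((Ide C ?X' \<otimes>\<^sub>m (v \<cdot> u)) \<cdot> coev_r C X)"
    by (simp add: clayers)
  also have "\<dots> = loop X"
    by (simp add: loop_def u clayers)
  finally show ?thesis ..
qed

lemma antipode_loop:
  assumes [simp]: "X \<in> Obj C"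
  shows "coend_antipode C B j \<cdot> loop X = loop (dual_obj C X)"
proof -
  let ?X' = "dual_obj C X" and ?t = "twist C X" and ?b = "bidual C X"
  let ?c = "braid C ?X' X"
  have [simp]: "coend_antipode C B j \<in> Arr C" "Dom C (coend_antipode C B j) = B" "Cod C (coend_antipode C B j) = B"
    using antipode_Hom by (auto simp: Hom_def)
  have "coend_antipode C B j \<cdot> loop X = (coend_antipode C B j \<cdot> j X) \<cdot> coev_r C X"
    by (simp add: loop_def cbase)
  also have "\<dots> = j ?X' \<cdot> ((?b \<otimes>\<^sub>m twist C ?X') \<cdot> ((?c \<cdot> (Ide C ?X' \<otimes>\<^sub>m inverse_of C ?t)) \<cdot> (inverse_of C ?c \<cdot> coev C X)))"
    by (simp add: antipode_j coev_r_def cbase)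
  also have "?c \<cdot> (Ide C ?X' \<otimes>\<^sub>m inverse_of C ?t) = (inverse_of C ?t \<otimes>\<^sub>m Ide C ?X') \<cdot> ?c"
    by (simp add: braid_nat cbase)
  also have "\<dots> \<cdot> (inverse_of C ?c \<cdot> coev C X) = (inverse_of C ?t \<otimes>\<^sub>m Ide C ?X') \<cdot> coev C X"
    by (simp add: cbase inverse_braid_cancel)
  also have "(?b \<otimes>\<^sub>m twist C ?X') \<cdot> \<dots>
      = (?b \<otimes>\<^sub>m Ide C ?X') \<cdot> ((inverse_of C ?t \<otimes>\<^sub>m Ide C ?X') \<cdot> ((Ide C X \<otimes>\<^sub>m twist C ?X') \<cdot> coev C X))"
    by (simp add: cmerge)
  also have "(Ide C X \<otimes>\<^sub>m twist C ?X') \<cdot> coev C X = (?t \<otimes>\<^sub>m Ide C ?X') \<cdot> coev C X"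
    by (simp add: twist_dual coev_dual_arr[OF _ refl] rbase)
  also have "(inverse_of C ?t \<otimes>\<^sub>m Ide C ?X') \<cdot> \<dots> = coev C X"
    by (simp add: cmerge cancel)
  also have "(?b \<otimes>\<^sub>m Ide C ?X') \<cdot> coev C X = coev_r C ?X'"
    by (rule coev_r_dual) simp
  finally show ?thesis
    by (simp add: loop_def)
qed

text \<open>
  The strand X with a parallel copy of the closed strand M.
\<close>

definition handle_slide where
  "handle_slide M X = j (M \<otimes>\<^sub>o X) \<cdot> (dual_tensor C X M \<otimes>\<^sub>m Ide C (M \<otimes>\<^sub>o X))
     \<cdot> (Ide C (dual_obj C X) \<otimes>\<^sub>m coev_r C M \<otimes>\<^sub>m Ide C X)"

text \<open>
  The closed strand M starts at the unit object, hence passes through the braiding in the product.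
\<close>

lemma mult_loop:
  assumes [simp]: "M \<in> Obj C" "X \<in> Obj C"
  shows "coend_mult C B j \<cdot> (j X \<otimes>\<^sub>m loop M) = handle_slide M X"
proof -
  let ?X' = "dual_obj C X" and ?M' = "dual_obj C M"
  have [simp]: "coend_mult C B j \<in> Arr C" "Dom C (coend_mult C B j) = B \<otimes>\<^sub>o B" "Cod C (coend_mult C B j) = B"
    using mult_Hom by (auto simp: Hom_def)
  have "j X \<otimes>\<^sub>m loop M = (j X \<otimes>\<^sub>m j M) \<cdot> (Ide C (?X' \<otimes>\<^sub>o X) \<otimes>\<^sub>m coev_r C M)"
    using interchange[of "Ide C (?X' \<otimes>\<^sub>o X)" "j X" "coev_r C M" "j M"] by (simp add: loop_def cbase)
  then have "coend_mult C B j \<cdot> (j X \<otimes>\<^sub>m loop M) = (coend_mult C B j \<cdot> (j X \<otimes>\<^sub>m j M)) \<cdot> (Ide C (?X' \<otimes>\<^sub>o X) \<otimes>\<^sub>m coev_r C M)"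
    by (simp add: cbase)
  also have "\<dots> = j (M \<otimes>\<^sub>o X) \<cdot> ((dual_tensor C X M \<otimes>\<^sub>m Ide C (M \<otimes>\<^sub>o X))
     \<cdot> (Ide C ?X' \<otimes>\<^sub>m (braid C X (?M' \<otimes>\<^sub>o M) \<cdot> (Ide C X \<otimes>\<^sub>m coev_r C M))))"
    by (simp add: mult_j mult_family_def clayers)
  also have "braid C X (?M' \<otimes>\<^sub>o M) \<cdot> (Ide C X \<otimes>\<^sub>m coev_r C M) = coev_r C M \<otimes>\<^sub>m Ide C X"
    by (simp add: braid_nat cbase braid_unit)
  finally show ?thesis
    by (simp add: handle_slide_def cbase)
qed

text \<open>
  The endomorphism h is the sum of the composites of bent injections and projections over the summands N of
  \<open>M \<otimes> X\<close>. Up to the factors \<open>d M\<close> and \<open>d N\<close> it is the projection of \<open>N \<otimes> X'\<close> to its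
  M-isotypic part. For i from M this is \<open>dim_smult_bend\<close> for each summand, followed by summation over a
  decomposition of \<open>M \<otimes> X\<close>, to which the summands different from N contribute zero.
\<close>

lemma handle_slide_component:
  assumes [simp]: "M \<in> L" "N \<in> L" "X \<in> Obj C"
  obtains h where "h \<in> Hom C (N \<otimes>\<^sub>o dual_obj C X) (N \<otimes>\<^sub>o dual_obj C X)"
    and "p N \<cdot> handle_slide M X = unroll N X h"
    and "\<And>R i. \<lbrakk>R \<in> L; i \<in> Hom C R (N \<otimes>\<^sub>o dual_obj C X)\<rbrakk> \<Longrightarrow>
      dim_q K C M \<odot>\<^sub>m (h \<cdot> i) = (if R = M then dim_q K C N \<odot>\<^sub>m i else arr_zero C R (N \<otimes>\<^sub>o dual_obj C X))"
proof -
  have [simp]: "M \<in> Obj C" "N \<in> Obj C"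
    by (simp_all add: L_Obj)
  let ?X' = "dual_obj C X" and ?N' = "dual_obj C N" and ?Z = "N \<otimes>\<^sub>o dual_obj C X" and ?Y = "M \<otimes>\<^sub>o X"
  obtain n :: nat and T p' q' where T: "\<forall>k<n. T k \<in> L" and ds: "direct_sum C {..<n} T ?Y p' q'"
    and jY: "j ?Y = (\<Oplus>\<^bsub>Hom_module C (dual_obj C ?Y \<otimes>\<^sub>o ?Y) B\<^esub>k \<in> {..<n}. q (T k) \<cdot> (dual_arr C (q' k) \<otimes>\<^sub>m p' k))"
    by (rule decomposition[of ?Y]) (simp_all add: cbase)
  note t = direct_sum_typing[OF ds]
  have t': "T k \<in> L" "T k \<in> Obj C" "p' k \<in> Arr C" "Dom C (p' k) = ?Y" "Cod C (p' k) = T k"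
      "q' k \<in> Arr C" "Dom C (q' k) = T k" "Cod C (q' k) = ?Y" if "k < n" for k
    using that T t[of k] by auto
  note bbase = cbase bend_up_typing bend_up_r_typing bend_down_typing unroll_typing
  define s where "s k = (if T k = N then bend_up M X (p' k) \<cdot> bend_up_r M X (q' k) else arr_zero C ?Z ?Z)" for k
  have s: "s k \<in> Hom C ?Z ?Z" if "k < n" for k
    using t'[OF that] by (auto simp: s_def Hom_def bbase arr_zero_typing)
  define h where "h = (\<Oplus>\<^bsub>Hom_module C ?Z ?Z\<^esub>k \<in> {..<n}. s k)"
  have h: "h \<in> Hom C ?Z ?Z"
    unfolding h_def by (rule finsum_Hom) (simp_all add: s cbase)
  show thesis
  proof (rule that[OF h])
    let ?W = "(dual_tensor C X M \<otimes>\<^sub>m Ide C ?Y) \<cdot> (Ide C ?X' \<otimes>\<^sub>m coev_r C M \<otimes>\<^sub>m Ide C X)"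
    let ?F = "\<lambda>f. p N \<cdot> (f \<cdot> ?W)"
    have F: "linear_map (dual_obj C ?Y \<otimes>\<^sub>o ?Y) B (?X' \<otimes>\<^sub>o X) (?N' \<otimes>\<^sub>o N) ?F"
      by (auto simp: linearity cbase)
    have U: "linear_map ?Z ?Z (?X' \<otimes>\<^sub>o X) (?N' \<otimes>\<^sub>o N) (unroll N X)"
      by (rule linear_unroll) simp_all
    have eq: "?F (q (T k) \<cdot> (dual_arr C (q' k) \<otimes>\<^sub>m p' k)) = unroll N X (s k)" if "k < n" for k
    proof -
      note [simp] = t'[OF that]
      have "?F (q (T k) \<cdot> (dual_arr C (q' k) \<otimes>\<^sub>m p' k))
          = (p N \<cdot> q (T k)) \<cdot> (((dual_arr C (q' k) \<otimes>\<^sub>m p' k) \<cdot> (dual_tensor C X M \<otimes>\<^sub>m Ide C ?Y))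
            \<cdot> (Ide C ?X' \<otimes>\<^sub>m coev_r C M \<otimes>\<^sub>m Ide C X))"
        by (simp add: cbase)
      also have "(dual_arr C (q' k) \<otimes>\<^sub>m p' k) \<cdot> (dual_tensor C X M \<otimes>\<^sub>m Ide C ?Y)
          = (dual_arr C (q' k) \<cdot> dual_tensor C X M) \<otimes>\<^sub>m p' k"
        using interchange[of "dual_tensor C X M" "dual_arr C (q' k)" "Ide C ?Y" "p' k"] by (simp add: cbase)
      also have "(p N \<cdot> q (T k)) \<cdot> (\<dots> \<cdot> (Ide C ?X' \<otimes>\<^sub>m coev_r C M \<otimes>\<^sub>m Ide C X)) = unroll N X (s k)"
      proof (cases "T k = N")
        case True
        then have "s k = bend_up M X (p' k) \<cdot> bend_up_r M X (q' k)"
          by (simp add: s_def)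
        then have "unroll N X (s k)
            = ((dual_arr C (q' k) \<cdot> dual_tensor C X M) \<otimes>\<^sub>m p' k) \<cdot> (Ide C ?X' \<otimes>\<^sub>m coev_r C M \<otimes>\<^sub>m Ide C X)"
          using True by (simp add: unroll_bend[of "p' k" "q' k" M X N])
        then show ?thesis
          using True by (simp add: p_q cbase)
      next
        case False
        have "linear_map (dual_obj C (T k) \<otimes>\<^sub>o T k) (?N' \<otimes>\<^sub>o N) (?X' \<otimes>\<^sub>o X) (?N' \<otimes>\<^sub>o N)
          (\<lambda>f. f \<cdot> (((dual_arr C (q' k) \<cdot> dual_tensor C X M) \<otimes>\<^sub>m p' k) \<cdot> (Ide C ?X' \<otimes>\<^sub>m coev_r C M \<otimes>\<^sub>m Ide C X)))"
          by (auto simp: linearity cbase)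
        from linear_map_zero[OF this] linear_map_zero[OF U] False show ?thesis
          by (auto simp: s_def p_q)
      qed
      finally show ?thesis .
    qed
    have "p N \<cdot> handle_slide M X = ?F (j ?Y)"
      by (simp add: handle_slide_def cbase)
    also have "\<dots> = (\<Oplus>\<^bsub>Hom_module C (?X' \<otimes>\<^sub>o X) (?N' \<otimes>\<^sub>o N)\<^esub>k \<in> {..<n}. ?F (q (T k) \<cdot> (dual_arr C (q' k) \<otimes>\<^sub>m p' k)))"
      unfolding jY by (rule linear_map_finsum[OF F]) (simp add: t' Hom_def cbase)
    also have "\<dots> = (\<Oplus>\<^bsub>Hom_module C (?X' \<otimes>\<^sub>o X) (?N' \<otimes>\<^sub>o N)\<^esub>k \<in> {..<n}. unroll N X (s k))"
      by (rule finsum_Hom_cong) (simp_all only: eq lessThan_iff, simp_all add: linear_map_Hom[OF U] s cbase)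
    also have "\<dots> = unroll N X h"
      unfolding h_def by (rule linear_map_finsum[OF U, symmetric]) (simp add: s)
    finally show "p N \<cdot> handle_slide M X = unroll N X h" .
  next
    fix R i assume R[simp]: "R \<in> L" and i: "i \<in> Hom C R ?Z"
    have [simp]: "R \<in> Obj C" "i \<in> Arr C" "Dom C i = R" "Cod C i = ?Z"
      using i by (auto simp: Hom_def L_Obj)
    have d[simp]: "dim_q K C M \<in> carrier K" "dim_q K C N \<in> carrier K"
      by (simp_all add: dim_q_closed)
    let ?F = "\<lambda>f. dim_q K C M \<odot>\<^sub>m (f \<cdot> i)"
    have F: "linear_map ?Z ?Z R ?Z ?F"
      by (rule linear_map_compose[OF linear_Comp_right[OF i] linear_smult]) (simp_all add: cbase)
    have Fh: "?F h = (\<Oplus>\<^bsub>Hom_module C R ?Z\<^esub>k \<in> {..<n}. ?F (s k))"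
      unfolding h_def by (rule linear_map_finsum[OF F]) (simp add: s)
    show "?F h = (if R = M then dim_q K C N \<odot>\<^sub>m i else arr_zero C R ?Z)"
    proof (cases "R = M")
      case True
      let ?i = "bend_down N X i"
      have [simp]: "?i \<in> Arr C" "Dom C ?i = ?Y" "Cod C ?i = N"
        using True by (simp_all add: bbase)
      let ?G = "\<lambda>f. dim_q K C N \<odot>\<^sub>m bend_up M X (?i \<cdot> f)"
      have G: "linear_map ?Y ?Y R ?Z ?G"
        using linear_map_compose[OF linear_map_compose[OF linear_Comp_left[of ?i ?Y N ?Y] linear_bend_up[of M X N]] linear_smult[of "dim_q K C N" M ?Z]] True
        by (simp add: Hom_def cbase)
      have "?F (s k) = ?G (q' k \<cdot> p' k)" if "k < n" for k
      proof (cases "T k = N")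
        case True
        note [simp] = t'[OF that]
        have "?F (s k) = dim_q K C M \<odot>\<^sub>m ((bend_up M X (p' k) \<cdot> bend_up_r M X (q' k)) \<cdot> i)"
          using True by (simp add: s_def)
        also have "\<dots> = dim_q K C N \<odot>\<^sub>m bend_up M X ((?i \<cdot> q' k) \<cdot> p' k)"
          by (rule dim_smult_bend) (use i \<open>R = M\<close> True in \<open>simp_all add: scalar_L Hom_def\<close>)
        finally show ?thesis
          using True by (simp add: cbase)
      next
        case False
        note [simp] = t'[OF that]
        have "?i \<cdot> q' k = arr_zero C (T k) N"
          by (rule schur) (use False in \<open>simp_all add: Hom_def cbase\<close>)
        then have "?i \<cdot> (q' k \<cdot> p' k) = arr_zero C (T k) N \<cdot> p' k"
          by (simp add: Comp_reassoc[symmetric])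
        also have "\<dots> = arr_zero C ?Y N"
          using linear_map_zero[OF linear_Comp_right[of "p' k" ?Y "T k" N]] by (simp add: Hom_def)
        finally have "?i \<cdot> (q' k \<cdot> p' k) = arr_zero C ?Y N" .
        then have "?G (q' k \<cdot> p' k) = arr_zero C R ?Z"
          using linear_map_zero[OF linear_bend_up[of M X N]] arr_smult_zero[of R ?Z "dim_q K C N"] \<open>R = M\<close>
          by (simp add: cbase)
        moreover have "?F (s k) = arr_zero C R ?Z"
          using False linear_map_zero[OF F] by (simp add: s_def)
        ultimately show ?thesis
          by simp
      qed
      then have "?F h = (\<Oplus>\<^bsub>Hom_module C R ?Z\<^esub>k \<in> {..<n}. ?G (q' k \<cdot> p' k))"
        unfolding Fh by (intro finsum_Hom_cong linear_map_Hom[OF G]) (simp_all add: t' Hom_def cbase)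
      also have "\<dots> = ?G (\<Oplus>\<^bsub>Hom_module C ?Y ?Y\<^esub>k \<in> {..<n}. q' k \<cdot> p' k)"
        by (rule linear_map_finsum[OF G, symmetric]) (simp add: t' Hom_def cbase)
      also have "\<dots> = ?G (Ide C ?Y)"
        using ds by (simp add: direct_sum_def)
      also have "\<dots> = dim_q K C N \<odot>\<^sub>m i"
        using True bend_up_down[of i N X M] by (simp add: cbase)
      finally show ?thesis
        using True by simp
    next
      case False
      have "?F (s k) = arr_zero C R ?Z" if "k < n" for k
      proof (cases "T k = N")
        case True
        note [simp] = t'[OF that]
        have "bend_up_r M X (q' k) \<cdot> i = arr_zero C R M"
          by (rule schur) (use False True in \<open>simp_all add: Hom_def bbase\<close>)
        then have "s k \<cdot> i = bend_up M X (p' k) \<cdot> arr_zero C R M"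
          using True by (simp add: s_def bbase)
        also have "\<dots> = arr_zero C R ?Z"
          using linear_map_zero[OF linear_Comp_left[of "bend_up M X (p' k)" M ?Z R]] True by (simp add: Hom_def bbase)
        finally show ?thesis
          by (simp add: arr_smult_zero cbase)
      next
        case False
        then show ?thesis
          using linear_map_zero[OF F] by (simp add: s_def)
      qed
      then have "?F h = (\<Oplus>\<^bsub>Hom_module C R ?Z\<^esub>k \<in> {..<n}. arr_zero C R ?Z)"
        unfolding Fh by (intro finsum_Hom_cong) (simp_all add: arr_zero_Hom cbase)
      then show ?thesis
        using False by (simp add: finsum_Hom_zero cbase)
    qed
  qed
qed

end

section \<open>The Kirby element of a closed set of simple objects\<close>

text \<open>
  The set D of simple objects contains all simple constituents of the tensor products \<open>M \<otimes> X\<close> and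
  \<open>N \<otimes> X'\<close> and a representative of each dual of its members. The constituents are seen as quotients
  in one case and as subobjects in the other, in the form in which the bending of legs produces them.
\<close>

locale closed_simples = scalar_semisimple_coend K C L B p q j
  for K :: "('k, 'r) ring_scheme" and C :: "('k, 'o, 'm, 'z) ribbon_category_scheme" (structure)
    and L :: "'o set" and B :: 'o and p q j :: "'o \<Rightarrow> 'm" +
  fixes D :: "'o set"
  assumes D_L: "D \<subseteq> L"
    and tensor_closed: "\<lbrakk>M \<in> D; X \<in> D; N \<in> L; i \<in> Hom C (M \<otimes>\<^sub>o X) N; i \<noteq> arr_zero C (M \<otimes>\<^sub>o X) N\<rbrakk> \<Longrightarrow> N \<in> D"
    and tensor_dual_closed: "\<lbrakk>N \<in> D; X \<in> D; M \<in> L; i \<in> Hom C M (N \<otimes>\<^sub>o dual_obj C X);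
      i \<noteq> arr_zero C M (N \<otimes>\<^sub>o dual_obj C X)\<rbrakk> \<Longrightarrow> M \<in> D"
    and dual_closed: "l \<in> D \<Longrightarrow> \<exists>m \<in> D. isomorphic C (dual_obj C l) m"
begin

definition kirby where
  "kirby = (\<Oplus>\<^bsub>Hom_module C \<bbbone> B\<^esub>l \<in> D. dim_q K C l \<odot>\<^sub>m loop l)"

lemma D_rules:
  "finite D" "l \<in> D \<Longrightarrow> l \<in> L" "l \<in> D \<Longrightarrow> l \<in> Obj C"
  using D_L B_typing(1) L_Obj by (auto intro: finite_subset)

lemma dim_loop_Hom: "X \<in> Obj C \<Longrightarrow> dim_q K C X \<odot>\<^sub>m loop X \<in> Hom C \<bbbone> B"
  by (simp add: Hom_def arr_smult_rules dim_q_closed loop_typing)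

lemma kirby_Hom: "kirby \<in> Hom C \<bbbone> B"
  unfolding kirby_def by (rule finsum_Hom) (simp_all add: cbase dim_loop_Hom D_rules)

lemma kirby_typing: "kirby \<in> Arr C" "Dom C kirby = \<bbbone>" "Cod C kirby = B"
  using kirby_Hom by (auto simp: Hom_def)

text \<open>
  An isomorphism between the duals is the dual of an arrow, which is zero if the simple objects differ.
\<close>

lemma dual_iso_cancel:
  assumes l: "l \<in> L" and m: "m \<in> L" and u: "u \<in> Hom C (dual_obj C m) (dual_obj C l)" "iso_arrow C u"
  shows "l = m"
proof (rule ccontr)
  assume "l \<noteq> m"
  note [simp] = L_Obj[OF l] L_Obj[OF m]
  obtain f where f: "f \<in> Hom C l m" "dual_arr C f = u"
    by (rule dual_arr_full[of u l m]) (use u in \<open>auto simp: Hom_def\<close>)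
  have "u = arr_zero C (dual_obj C m) (dual_obj C l)"
    using schur[OF l m \<open>l \<noteq> m\<close> f(1)] f(2) linear_map_zero[OF linear_dual_arr[of l m]] by simp
  moreover have "u \<cdot> inverse_of C u = Ide C (dual_obj C l)"
    using inverse_of_iso(5)[OF u(2)] u(1) by (simp add: Hom_def)
  moreover have "arr_zero C (dual_obj C m) (dual_obj C l) \<cdot> inverse_of C u = arr_zero C (dual_obj C l) (dual_obj C l)"
    by (rule linear_map_zero[OF linear_Comp_right]) (use u inverse_of_iso[OF u(2)] in \<open>simp_all add: Hom_def cbase\<close>)
  ultimately show False
    using Ide_dual_nonzero[OF scalar_L[OF l]] by simp
qed

lemma isomorphic_arrows:
  assumes "isomorphic C X Y"
  obtains u v where "u \<in> Hom C X Y" "v \<in> Hom C Y X" "v \<cdot> u = Ide C X" "u \<cdot> v = Ide C Y" "iso_arrow C u" "iso_arrow C v"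
proof -
  obtain u v where u: "u \<in> Hom C X Y" "iso_arrow C u" "inverse_arrows C u v"
    using assms by (auto simp: isomorphic_def iso_arrow_def)
  then have "inverse_arrows C v u"
    by (auto simp: inverse_arrows_def Hom_def)
  then show thesis
    using u by (intro that[of u v]) (auto simp: inverse_arrows_def Hom_def iso_arrow_def)
qed

text \<open>
  Choosing representatives of the duals permutes D.
\<close>

lemma antipode_kirby: "coend_antipode C B j \<cdot> kirby = kirby"
proof -
  obtain r where r: "\<And>l. l \<in> D \<Longrightarrow> r l \<in> D" "\<And>l. l \<in> D \<Longrightarrow> isomorphic C (dual_obj C l) (r l)"
    using dual_closed by metis
  have inj: "inj_on r D"
  proof (rule inj_onI)
    fix l m assume l: "l \<in> D" and m: "m \<in> D" and eq: "r l = r m"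
    obtain a b where a: "b \<in> Hom C (r l) (dual_obj C l)" "iso_arrow C b"
      by (rule isomorphic_arrows[OF r(2)[OF l]])
    obtain c d where c: "c \<in> Hom C (dual_obj C m) (r l)" "iso_arrow C c"
      unfolding eq by (rule isomorphic_arrows[OF r(2)[OF m]])
    have "iso_arrow C (b \<cdot> c)"
      unfolding iso_arrow_def inverse_arrows_def
    proof (intro exI[of _ "inverse_of C c \<cdot> inverse_of C b"] conjI)
      note i = inverse_of_iso[OF a(2)] inverse_of_iso[OF c(2)]
      have [simp]: "b \<in> Arr C" "Dom C b = r l" "Cod C b = dual_obj C l" "c \<in> Arr C" "Dom C c = dual_obj C m" "Cod C c = r l"
        using a c by (auto simp: Hom_def)
      have [simp]: "dual_obj C m \<in> Obj C" "dual_obj C l \<in> Obj C" "r l \<in> Obj C"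
        using l m r(1) by (simp_all add: D_rules dual_Obj)
      have 1: "inverse_of C b \<cdot> (b \<cdot> c) = c" "c \<cdot> (inverse_of C c \<cdot> inverse_of C b) = inverse_of C b"
        using Comp_reassoc[of c b "inverse_of C b"] Comp_reassoc[of "inverse_of C b" "inverse_of C c" c]
        by (simp_all add: i Comp_unit)
      show "b \<cdot> c \<in> Arr C" "inverse_of C c \<cdot> inverse_of C b \<in> Hom C (Cod C (b \<cdot> c)) (Dom C (b \<cdot> c))"
        by (simp_all add: Hom_def typing i)
      show "inverse_of C c \<cdot> inverse_of C b \<cdot> (b \<cdot> c) = Ide C (Dom C (b \<cdot> c))"
        "b \<cdot> c \<cdot> (inverse_of C c \<cdot> inverse_of C b) = Ide C (Cod C (b \<cdot> c))"
        by (simp_all add: Comp_reassoc typing i 1)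
    qed
    then show "l = m"
      using Comp_Hom[OF c(1) a(1)] l m by (intro dual_iso_cancel[of l m "b \<cdot> c"]) (simp_all add: D_rules)
  qed
  have rD: "r ` D = D"
    using r(1) inj D_rules(1) by (intro endo_inj_surj) auto
  let ?F = "\<lambda>f. coend_antipode C B j \<cdot> f" and ?H = "Hom_module C \<bbbone> B"
  have F: "linear_map \<bbbone> B \<bbbone> B ?F"
    by (rule linear_Comp_left[OF antipode_Hom tunit_Obj])
  have eq: "?F (dim_q K C l \<odot>\<^sub>m loop l) = dim_q K C (r l) \<odot>\<^sub>m loop (r l)" if l: "l \<in> D" for l
  proof -
    have [simp]: "l \<in> Obj C"
      using l by (rule D_rules)
    obtain u v where u: "u \<in> Hom C (dual_obj C l) (r l)" "v \<in> Hom C (r l) (dual_obj C l)"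
      "v \<cdot> u = Ide C (dual_obj C l)" "u \<cdot> v = Ide C (r l)"
      by (rule isomorphic_arrows[OF r(2)[OF l]])
    have "?F (dim_q K C l \<odot>\<^sub>m loop l) = dim_q K C l \<odot>\<^sub>m loop (dual_obj C l)"
      using linear_map_smult[OF F dim_q_closed, of l "loop l"] by (simp add: Hom_def loop_typing antipode_loop)
    then show ?thesis
      using loop_iso[OF u] dim_q_iso[OF u] dim_q_dual[of l] by simp
  qed
  interpret M: abelian_group ?H
    by (rule Hom_abelian) (simp_all add: cbase)
  have "?F kirby = (\<Oplus>\<^bsub>?H\<^esub>l \<in> D. ?F (dim_q K C l \<odot>\<^sub>m loop l))"
    unfolding kirby_def by (rule linear_map_finsum[OF F]) (simp add: dim_loop_Hom D_rules)
  also have "\<dots> = (\<Oplus>\<^bsub>?H\<^esub>l \<in> D. dim_q K C (r l) \<odot>\<^sub>m loop (r l))"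
    by (rule finsum_Hom_cong) (simp_all add: eq dim_loop_Hom D_rules r cbase)
  also have "\<dots> = (\<Oplus>\<^bsub>?H\<^esub>l \<in> r ` D. dim_q K C l \<odot>\<^sub>m loop l)"
    by (rule M.finsum_reindex[symmetric]) (use inj rD in \<open>auto simp: Hom_module_simps dim_loop_Hom D_rules\<close>)
  finally show ?thesis
    unfolding rD kirby_def .
qed

lemma p_kirby:
  assumes N: "N \<in> L"
  shows "p N \<cdot> kirby = (if N \<in> D then dim_q K C N \<odot>\<^sub>m coev_r C N else arr_zero C \<bbbone> (dual_obj C N \<otimes>\<^sub>o N))"
proof -
  have [simp]: "N \<in> Obj C" "N \<in> L"
    using N by (simp_all add: L_Obj)
  let ?Z = "dual_obj C N \<otimes>\<^sub>o N"
  have F: "linear_map \<bbbone> B \<bbbone> ?Z (\<lambda>f. p N \<cdot> f)"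
    by (rule linear_Comp_left) (simp_all add: Hom_def cbase)
  have eq: "p N \<cdot> (dim_q K C l \<odot>\<^sub>m loop l) = (if l = N then dim_q K C N \<odot>\<^sub>m coev_r C N else arr_zero C \<bbbone> ?Z)" if "l \<in> D" for l
  proof -
    have [simp]: "l \<in> L" "l \<in> Obj C"
      using that by (simp_all add: D_rules)
    have "p N \<cdot> loop l = (p N \<cdot> q l) \<cdot> coev_r C l"
      by (simp add: loop_def j_simple cbase)
    also have "\<dots> = (if l = N then coev_r C N else arr_zero C \<bbbone> ?Z)"
      using linear_map_zero[OF linear_Comp_right[of "coev_r C l" \<bbbone> "dual_obj C l \<otimes>\<^sub>o l" ?Z]]
      by (auto simp: p_q Hom_def cbase)
    finally have "p N \<cdot> loop l = (if l = N then coev_r C N else arr_zero C \<bbbone> ?Z)" .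
    moreover have "p N \<cdot> (dim_q K C l \<odot>\<^sub>m loop l) = dim_q K C l \<odot>\<^sub>m (p N \<cdot> loop l)"
      by (rule linear_map_smult[OF F]) (simp_all add: Hom_def loop_typing dim_q_closed)
    ultimately show ?thesis
      by (simp add: arr_smult_zero cbase dim_q_closed)
  qed
  have "p N \<cdot> kirby = (\<Oplus>\<^bsub>Hom_module C \<bbbone> ?Z\<^esub>l \<in> D. p N \<cdot> (dim_q K C l \<odot>\<^sub>m loop l))"
    unfolding kirby_def by (rule linear_map_finsum[OF F]) (simp add: dim_loop_Hom D_rules)
  also have "\<dots> = (\<Oplus>\<^bsub>Hom_module C \<bbbone> ?Z\<^esub>l \<in> D. if l = N then dim_q K C N \<odot>\<^sub>m coev_r C N else arr_zero C \<bbbone> ?Z)"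
    by (rule finsum_Hom_cong) (simp_all add: eq cbase Hom_def arr_smult_rules dim_q_closed arr_zero_typing)
  also have "\<dots> = (if N \<in> D then dim_q K C N \<odot>\<^sub>m coev_r C N else arr_zero C \<bbbone> ?Z)"
    by (rule finsum_Hom_delta) (simp_all add: cbase Hom_def arr_smult_rules dim_q_closed D_rules)
  finally show ?thesis .
qed

text \<open>
  With respect to strands X in D, \<open>kirby\<close> is an integral. At a simple object N, the left-hand side is
  \<open>unroll\<close> of the sum H of the multiples by \<open>d N\<close> of the projections of \<open>N \<otimes> X'\<close> onto its
  M-isotypic parts for M in D. H is evaluated on the injections of a decomposition of \<open>N \<otimes> X'\<close>. The closure
  properties of D say that a summand of \<open>N \<otimes> X'\<close> lies in D if and only if N does.
\<close>

lemma mult_kirby: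
  assumes X: "X \<in> D"
  shows "coend_mult C B j \<cdot> (j X \<otimes>\<^sub>m kirby) = kirby \<cdot> ev C X"
proof (rule direct_sum_ext_left[OF B_sum])
  have [simp]: "X \<in> Obj C"
    using X by (rule D_rules)
  let ?m = "coend_mult C B j" and ?X' = "dual_obj C X" and ?XX = "dual_obj C X \<otimes>\<^sub>o X"
  have m[simp]: "?m \<in> Arr C" "Dom C ?m = B \<otimes>\<^sub>o B" "Cod C ?m = B"
    using mult_Hom by (auto simp: Hom_def)
  show "?m \<cdot> (j X \<otimes>\<^sub>m kirby) \<in> Hom C ?XX B" "kirby \<cdot> ev C X \<in> Hom C ?XX B"
    by (simp_all add: Hom_def cbase kirby_typing)
  fix N assume N[simp]: "N \<in> L"
  have [simp]: "N \<in> Obj C"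
    by (simp add: L_Obj)
  let ?Z = "N \<otimes>\<^sub>o ?X'" and ?NN = "dual_obj C N \<otimes>\<^sub>o N"
  have "\<forall>M\<in>D. \<exists>h. h \<in> Hom C ?Z ?Z \<and> p N \<cdot> handle_slide M X = unroll N X h \<and>
      (\<forall>R\<in>L. \<forall>i\<in>Hom C R ?Z. dim_q K C M \<odot>\<^sub>m (h \<cdot> i) = (if R = M then dim_q K C N \<odot>\<^sub>m i else arr_zero C R ?Z))"
  proof
    fix M assume "M \<in> D"
    then have "M \<in> L" by (rule D_rules)
    from handle_slide_component[OF this N \<open>X \<in> Obj C\<close>] show "\<exists>h. h \<in> Hom C ?Z ?Z \<and> p N \<cdot> handle_slide M X = unroll N X h \<and>
      (\<forall>R\<in>L. \<forall>i\<in>Hom C R ?Z. dim_q K C M \<odot>\<^sub>m (h \<cdot> i) = (if R = M then dim_q K C N \<odot>\<^sub>m i else arr_zero C R ?Z))"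
      by metis
  qed
  then obtain h where h: "\<And>M. M \<in> D \<Longrightarrow> h M \<in> Hom C ?Z ?Z"
    and ph: "\<And>M. M \<in> D \<Longrightarrow> p N \<cdot> handle_slide M X = unroll N X (h M)"
    and hi: "\<And>M R i. \<lbrakk>M \<in> D; R \<in> L; i \<in> Hom C R ?Z\<rbrakk> \<Longrightarrow>
      dim_q K C M \<odot>\<^sub>m (h M \<cdot> i) = (if R = M then dim_q K C N \<odot>\<^sub>m i else arr_zero C R ?Z)"
    by metis
  have dh: "dim_q K C M \<odot>\<^sub>m h M \<in> Hom C ?Z ?Z" if "M \<in> D" for M
    using arr_smult_Hom[OF _ _ dim_q_closed h[OF that]] that by (simp add: cbase D_rules)
  define H where "H = (\<Oplus>\<^bsub>Hom_module C ?Z ?Z\<^esub>M \<in> D. dim_q K C M \<odot>\<^sub>m h M)"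
  have H: "H \<in> Hom C ?Z ?Z"
    unfolding H_def by (rule finsum_Hom) (simp_all add: dh cbase)
  have Hi: "H \<cdot> i = (if R \<in> D then dim_q K C N \<odot>\<^sub>m i else arr_zero C R ?Z)" if R: "R \<in> L" and i: "i \<in> Hom C R ?Z" for R i
  proof -
    have [simp]: "R \<in> Obj C"
      using R by (rule L_Obj)
    have F: "linear_map ?Z ?Z R ?Z (\<lambda>f. f \<cdot> i)"
      by (rule linear_Comp_right[OF i]) (simp add: cbase)
    have "H \<cdot> i = (\<Oplus>\<^bsub>Hom_module C R ?Z\<^esub>M \<in> D. (dim_q K C M \<odot>\<^sub>m h M) \<cdot> i)"
      unfolding H_def by (rule linear_map_finsum[OF F]) (rule dh)
    also have "\<dots> = (\<Oplus>\<^bsub>Hom_module C R ?Z\<^esub>M \<in> D. if M = R then dim_q K C N \<odot>\<^sub>m i else arr_zero C R ?Z)"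
    proof (rule finsum_Hom_cong)
      fix M assume M: "M \<in> D"
      show "(if M = R then dim_q K C N \<odot>\<^sub>m i else arr_zero C R ?Z) \<in> Hom C R ?Z"
        using i by (simp add: arr_smult_Hom arr_zero_Hom dim_q_closed cbase)
      show "(dim_q K C M \<odot>\<^sub>m h M) \<cdot> i = (if M = R then dim_q K C N \<odot>\<^sub>m i else arr_zero C R ?Z)"
        using linear_map_smult[OF F dim_q_closed h[OF M], of M] M hi[OF M R i] by (auto simp: D_rules)
    qed (simp_all add: cbase)
    also have "\<dots> = (if R \<in> D then dim_q K C N \<odot>\<^sub>m i else arr_zero C R ?Z)"
      by (rule finsum_Hom_delta) (use i in \<open>simp_all add: arr_smult_Hom dim_q_closed cbase D_rules\<close>)
    finally show ?thesis .
  qed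
  have H_eq: "H = (if N \<in> D then dim_q K C N \<odot>\<^sub>m Ide C ?Z else arr_zero C ?Z ?Z)"
  proof -
    obtain n :: nat and T p' q' where T: "\<forall>k<n. T k \<in> L" and ds: "direct_sum C {..<n} T ?Z p' q'"
      by (rule decomposition[of ?Z]) (simp_all add: cbase)
    have q': "q' k \<in> Hom C (T k) ?Z" if "k < n" for k
      using ds that by (auto simp: direct_sum_def)
    show ?thesis
    proof (rule direct_sum_ext[OF ds H])
      show rhs: "(if N \<in> D then dim_q K C N \<odot>\<^sub>m Ide C ?Z else arr_zero C ?Z ?Z) \<in> Hom C ?Z ?Z"
        by (simp add: arr_smult_Hom arr_zero_Hom dim_q_closed Ide_Hom cbase)
      fix k assume "k \<in> {..<n}"
      then have k: "k < n" by simp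
      have TL: "T k \<in> L" and [simp]: "T k \<in> Obj C"
        using T k by (auto simp: L_Obj)
      note i = q'[OF k]
      have [simp]: "q' k \<in> Arr C" "Dom C (q' k) = T k" "Cod C (q' k) = ?Z"
        using i by (auto simp: Hom_def)
      have z: "arr_zero C ?Z ?Z \<cdot> q' k = arr_zero C (T k) ?Z"
        by (rule linear_map_zero[OF linear_Comp_right[OF i]]) (simp add: cbase)
      have s: "(dim_q K C N \<odot>\<^sub>m Ide C ?Z) \<cdot> q' k = dim_q K C N \<odot>\<^sub>m q' k"
        by (simp add: arr_smult_rules dim_q_closed cbase)
      show "H \<cdot> q' k = (if N \<in> D then dim_q K C N \<odot>\<^sub>m Ide C ?Z else arr_zero C ?Z ?Z) \<cdot> q' k"
      \<comment> \<open>If only one of N and T k lies in D, the closure properties force the injection to vanish.\<close>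
      proof (cases "N \<in> D \<longleftrightarrow> T k \<in> D")
        case True
        then show ?thesis
          by (simp add: Hi[OF TL i] z s)
      next
        case False
        have "q' k = arr_zero C (T k) ?Z"
        proof (rule ccontr)
          assume nz: "q' k \<noteq> arr_zero C (T k) ?Z"
          show False
          proof (cases "N \<in> D")
            case True
            then show False
              using tensor_dual_closed[OF True X TL i nz] False by simp
          next
            case N': False
            have "bend_down N X (q' k) \<noteq> arr_zero C (T k \<otimes>\<^sub>o X) N"
            proof
              assume "bend_down N X (q' k) = arr_zero C (T k \<otimes>\<^sub>o X) N"
              then have "q' k = bend_up (T k) X (arr_zero C (T k \<otimes>\<^sub>o X) N)"
                using bend_up_down[of "q' k" N X "T k"] by simp
              then show False
                using nz linear_map_zero[OF linear_bend_up[of "T k" X N]] by simp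
            qed
            moreover have "bend_down N X (q' k) \<in> Hom C (T k \<otimes>\<^sub>o X) N"
              by (simp add: Hom_def bend_down_typing)
            ultimately show False
              using tensor_closed[of "T k" X N "bend_down N X (q' k)"] N' False X by auto
          qed
        qed
        then have q0: "f \<cdot> q' k = arr_zero C (T k) ?Z" if "f \<in> Hom C ?Z ?Z" for f
          using linear_map_zero[OF linear_Comp_left[OF that \<open>T k \<in> Obj C\<close>]] by simp
        show ?thesis
          unfolding q0[OF H] q0[OF rhs] ..
      qed
    qed
  qed
  let ?F = "\<lambda>f. p N \<cdot> (?m \<cdot> (j X \<otimes>\<^sub>m f))"
  have F: "linear_map \<bbbone> B ?XX ?NN ?F"
    by (auto simp: linearity cbase)
  have U: "linear_map ?Z ?Z ?XX ?NN (unroll N X)"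
    by (rule linear_unroll) simp_all
  have "?F kirby = (\<Oplus>\<^bsub>Hom_module C ?XX ?NN\<^esub>M \<in> D. ?F (dim_q K C M \<odot>\<^sub>m loop M))"
    unfolding kirby_def by (rule linear_map_finsum[OF F]) (simp add: dim_loop_Hom D_rules)
  also have "\<dots> = (\<Oplus>\<^bsub>Hom_module C ?XX ?NN\<^esub>M \<in> D. unroll N X (dim_q K C M \<odot>\<^sub>m h M))"
  proof (rule finsum_Hom_cong)
    fix M assume M: "M \<in> D"
    show "unroll N X (dim_q K C M \<odot>\<^sub>m h M) \<in> Hom C ?XX ?NN"
      by (rule linear_map_Hom[OF U dh[OF M]])
    have "?F (dim_q K C M \<odot>\<^sub>m loop M) = dim_q K C M \<odot>\<^sub>m ?F (loop M)"
      by (rule linear_map_smult[OF F]) (use M in \<open>simp_all add: dim_q_closed loop_typing Hom_def D_rules\<close>)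
    also have "?F (loop M) = unroll N X (h M)"
      using M by (simp add: mult_loop ph D_rules)
    also have "dim_q K C M \<odot>\<^sub>m \<dots> = unroll N X (dim_q K C M \<odot>\<^sub>m h M)"
      by (rule linear_map_smult[OF U _ h[OF M], symmetric]) (use M in \<open>simp add: dim_q_closed D_rules\<close>)
    finally show "?F (dim_q K C M \<odot>\<^sub>m loop M) = unroll N X (dim_q K C M \<odot>\<^sub>m h M)" .
  qed (simp_all add: cbase)
  also have "\<dots> = unroll N X H"
    unfolding H_def by (rule linear_map_finsum[OF U, symmetric]) (rule dh)
  also have "\<dots> = (if N \<in> D then dim_q K C N \<odot>\<^sub>m (coev_r C N \<cdot> ev C X) else arr_zero C ?XX ?NN)"
    using linear_map_smult[OF U dim_q_closed Ide_Hom[of ?Z], of N] linear_map_zero[OF U]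
    by (simp add: H_eq unroll_Ide cbase)
  also have "\<dots> = (p N \<cdot> kirby) \<cdot> ev C X"
    using linear_map_zero[OF linear_Comp_right[OF ev_Hom[OF \<open>X \<in> Obj C\<close>], of ?NN]]
    by (simp add: p_kirby arr_smult_rules dim_q_closed cbase)
  also have "\<dots> = p N \<cdot> (kirby \<cdot> ev C X)"
    by (simp add: cbase kirby_typing)
  finally show "?F kirby = p N \<cdot> (kirby \<cdot> ev C X)" .
qed

text \<open>
  After the comultiplication of \<open>loop X\<close> the second factor absorbs \<open>kirby\<close> and becomes an evaluation,
  which cancels the cup introduced by the comultiplication. The identity for the first tensor factor
  \<open>kirby\<close> follows by linearity.
\<close>

lemma Gamma_kirby: "Gamma_l C B j \<cdot> (kirby \<otimes>\<^sub>m kirby) = kirby \<otimes>\<^sub>m kirby"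
proof -
  let ?m = "coend_mult C B j" and ?d = "coend_comult C B j" and ?G = "Gamma_l C B j"
  have [simp]: "?m \<in> Arr C" "Dom C ?m = B \<otimes>\<^sub>o B" "Cod C ?m = B"
    using mult_Hom by (auto simp: Hom_def)
  have [simp]: "?d \<in> Arr C" "Dom C ?d = B" "Cod C ?d = B \<otimes>\<^sub>o B"
    using comult_Hom by (auto simp: Hom_def)
  have G: "?G = (Ide C B \<otimes>\<^sub>m ?m) \<cdot> (?d \<otimes>\<^sub>m Ide C B)"
    by (simp add: Gamma_l_def)
  have [simp]: "?G \<in> Arr C" "Dom C ?G = B \<otimes>\<^sub>o B" "Cod C ?G = B \<otimes>\<^sub>o B"
    by (simp_all add: G cbase)
  note kbase = cbase kirby_typing loop_typing
  have loop: "?G \<cdot> (loop X \<otimes>\<^sub>m kirby) = loop X \<otimes>\<^sub>m kirby" if X: "X \<in> D" for X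
  proof -
    have [simp]: "X \<in> Obj C"
      using X by (rule D_rules)
    let ?X' = "dual_obj C X"
    let ?w = "(Ide C ?X' \<otimes>\<^sub>m coev C X \<otimes>\<^sub>m Ide C X) \<cdot> coev_r C X"
    have w[simp]: "?w \<in> Arr C" "Dom C ?w = \<bbbone>" "Cod C ?w = (?X' \<otimes>\<^sub>o X) \<otimes>\<^sub>o (?X' \<otimes>\<^sub>o X)"
      by (simp_all add: kbase)
    have dl: "?d \<cdot> loop X = (j X \<otimes>\<^sub>m j X) \<cdot> ?w"
    proof -
      have "?d \<cdot> loop X = (?d \<cdot> j X) \<cdot> coev_r C X"
        by (simp add: loop_def kbase)
      then show ?thesis
        by (simp add: comult_j kbase)
    qed
    have "?G \<cdot> (loop X \<otimes>\<^sub>m kirby) = (Ide C B \<otimes>\<^sub>m ?m) \<cdot> ((?d \<otimes>\<^sub>m Ide C B) \<cdot> (loop X \<otimes>\<^sub>m kirby))"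
      by (simp add: G kbase)
    also have "(?d \<otimes>\<^sub>m Ide C B) \<cdot> (loop X \<otimes>\<^sub>m kirby) = (?d \<cdot> loop X) \<otimes>\<^sub>m kirby"
      using interchange[of "loop X" ?d kirby "Ide C B"] by (simp add: kbase)
    also have "(?d \<cdot> loop X) \<otimes>\<^sub>m kirby = ((j X \<otimes>\<^sub>m j X) \<otimes>\<^sub>m kirby) \<cdot> ?w"
      unfolding dl using interchange[of ?w "j X \<otimes>\<^sub>m j X" "Ide C \<bbbone>" kirby] by (simp add: kbase)
    also have "(Ide C B \<otimes>\<^sub>m ?m) \<cdot> (((j X \<otimes>\<^sub>m j X) \<otimes>\<^sub>m kirby) \<cdot> ?w)
        = (j X \<otimes>\<^sub>m (?m \<cdot> (j X \<otimes>\<^sub>m kirby))) \<cdot> ?w"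
      using interchange_assoc[of "j X" "Ide C B" "j X \<otimes>\<^sub>m kirby" ?m ?w] by (simp add: kbase)
    also have "?m \<cdot> (j X \<otimes>\<^sub>m kirby) = kirby \<cdot> ev C X"
      by (rule mult_kirby[OF X])
    also have "j X \<otimes>\<^sub>m (kirby \<cdot> ev C X) = (j X \<otimes>\<^sub>m kirby) \<cdot> (Ide C (?X' \<otimes>\<^sub>o X) \<otimes>\<^sub>m ev C X)"
      using interchange[of "Ide C (?X' \<otimes>\<^sub>o X)" "j X" "ev C X" kirby] by (simp add: kbase)
    also have "\<dots> \<cdot> ?w = (j X \<otimes>\<^sub>m kirby)
        \<cdot> ((Ide C ?X' \<otimes>\<^sub>m ((Ide C X \<otimes>\<^sub>m ev C X) \<cdot> (coev C X \<otimes>\<^sub>m Ide C X))) \<cdot> coev_r C X)"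
      by (simp add: clayers kirby_typing)
    also have "\<dots> = (j X \<otimes>\<^sub>m kirby) \<cdot> coev_r C X"
      by (simp add: zigzag_rules clayers kirby_typing)
    also have "\<dots> = loop X \<otimes>\<^sub>m kirby"
      using interchange[of "coev_r C X" "j X" "Ide C \<bbbone>" kirby] by (simp add: loop_def kbase)
    finally show ?thesis .
  qed
  have B2: "B \<otimes>\<^sub>o B \<in> Obj C"
    by (simp add: cbase)
  let ?T = "\<lambda>f. f \<otimes>\<^sub>m kirby"
  have T: "linear_map \<bbbone> B \<bbbone> (B \<otimes>\<^sub>o B) ?T"
    using linear_tensor_left[OF kirby_Hom, of \<bbbone> B] by (simp add: cbase)
  have GT: "linear_map \<bbbone> B \<bbbone> (B \<otimes>\<^sub>o B) (\<lambda>f. ?G \<cdot> ?T f)"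
    by (rule linear_map_compose[OF T linear_Comp_left]) (simp_all add: Hom_def cbase)
  have "?G \<cdot> ?T (\<Oplus>\<^bsub>Hom_module C \<bbbone> B\<^esub>l \<in> D. dim_q K C l \<odot>\<^sub>m loop l) = ?T (\<Oplus>\<^bsub>Hom_module C \<bbbone> B\<^esub>l \<in> D. dim_q K C l \<odot>\<^sub>m loop l)"
  proof (rule linear_maps_eq_on_finsum[OF GT T])
    fix l assume l: "l \<in> D"
    have [simp]: "l \<in> Obj C"
      using l by (rule D_rules)
    have lH: "loop l \<in> Hom C \<bbbone> B"
      by (simp add: Hom_def loop_typing)
    show "dim_q K C l \<odot>\<^sub>m loop l \<in> Hom C \<bbbone> B"
      by (simp add: dim_loop_Hom)
    show "?G \<cdot> ?T (dim_q K C l \<odot>\<^sub>m loop l) = ?T (dim_q K C l \<odot>\<^sub>m loop l)"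
      using linear_map_smult[OF GT dim_q_closed lH, of l] linear_map_smult[OF T dim_q_closed lH, of l] loop[OF l] by simp
  qed
  then show ?thesis
    by (simp only: kirby_def[symmetric])
qed

theorem kirby_in_I_set: "kirby \<in> I_set K C B j"
proof -
  have "kirby \<otimes>\<^sub>m kirby \<in> Hom C \<bbbone> (B \<otimes>\<^sub>o B)"
    by (simp add: Hom_def cbase kirby_typing)
  then show ?thesis
    unfolding I_set_def mem_Collect_eq antipode_kirby Gamma_kirby
    by (intro conjI negligible_minus_self kirby_Hom)
qed

end

section \<open>Summands in full abelian subcategories\<close>

context k_category
begin

lemma obtain_difference:
  assumes "f \<in> Hom C X Y" "g \<in> Hom C X Y"
  obtains h where "h \<in> Hom C X Y" "h \<oplus>\<^sub>m g = f"
proof -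
  interpret M: abelian_group "Hom_module C X Y"
    by (rule Hom_abelian[OF Hom_Obj[OF assms(1)]])
  note s = Hom_module_simps[of X Y]
  have "(f \<ominus>\<^bsub>Hom_module C X Y\<^esub> g) \<in> Hom C X Y" "(f \<ominus>\<^bsub>Hom_module C X Y\<^esub> g) \<oplus>\<^sub>m g = f"
    using assms M.minus_closed[of f g] M.a_assoc[of f "\<ominus>\<^bsub>Hom_module C X Y\<^esub> g" g] M.l_neg[of g] M.a_inv_closed[of g] M.r_zero[of f]
    by (simp_all add: s a_minus_def)
  then show thesis
    by (rule that)
qed

lemma arr_zero_add: "f \<in> Hom C X Y \<Longrightarrow> arr_zero C X Y \<oplus>\<^sub>m f = f"
proof -
  assume f: "f \<in> Hom C X Y"
  interpret M: abelian_group "Hom_module C X Y"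
    by (rule Hom_abelian[OF Hom_Obj[OF f]])
  show ?thesis
    using M.l_zero[of f] f by (simp add: Hom_module_simps)
qed

lemma arr_add_eq_right:
  assumes "h \<in> Hom C X Y" "g \<in> Hom C X Y" "h \<oplus>\<^sub>m g = g"
  shows "h = arr_zero C X Y"
proof -
  interpret M: abelian_group "Hom_module C X Y"
    by (rule Hom_abelian[OF Hom_Obj[OF assms(1)]])
  show ?thesis
    using M.add.right_cancel[of g h "arr_zero C X Y"] assms arr_zero_add[OF assms(2)] M.zero_closed by (simp add: Hom_module_simps)
qed

lemma zero_Comp:
  "\<lbrakk>f \<in> Hom C X Y; Z \<in> Obj C\<rbrakk> \<Longrightarrow> arr_zero C Y Z \<cdot> f = arr_zero C X Z"
  "\<lbrakk>f \<in> Hom C X Y; Z \<in> Obj C\<rbrakk> \<Longrightarrow> f \<cdot> arr_zero C Z X = arr_zero C Z Y"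
  using linear_map_zero[OF linear_Comp_right] linear_map_zero[OF linear_Comp_left] by blast+

lemma kernel_mono:
  assumes k: "kernel_of C f i" and gh: "g \<in> Hom C W (Dom C i)" "h \<in> Hom C W (Dom C i)" "i \<cdot> g = i \<cdot> h"
  shows "g = h"
proof -
  have i: "i \<in> Hom C (Dom C i) (Dom C f)" and f: "f \<in> Hom C (Dom C f) (Cod C f)"
    and fi: "f \<cdot> i = arr_zero C (Dom C i) (Cod C f)"
    using k by (auto simp: kernel_of_def Hom_def)
  have "f \<cdot> (i \<cdot> g) = arr_zero C W (Cod C f)"
    using Comp_assoc[OF gh(1) i f] zero_Comp(1)[OF gh(1) Hom_Obj(2)[OF f]] fi by simp
  then have "\<exists>!u. u \<in> Hom C W (Dom C i) \<and> i \<cdot> u = i \<cdot> g"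
    using k Comp_Hom[OF gh(1) i] by (auto simp: kernel_of_def)
  then show ?thesis
    using gh by metis
qed

end

context abelian_k_category
begin

text \<open>
  The kernel of a nonzero arrow out of a simple object is zero, so the arrow is a monomorphism, and a
  monomorphism into a simple object is invertible unless its source vanishes.
\<close>

lemma schur_lemma:
  assumes X: "simple_object C X" and Y: "simple_object C Y" and f: "f \<in> Hom C X Y" "f \<noteq> arr_zero C X Y"
  shows "iso_arrow C f"
proof -
  have fA: "f \<in> Arr C" "Dom C f = X" "Cod C f = Y" and o: "X \<in> Obj C" "Y \<in> Obj C"
    using f(1) Hom_Obj[OF f(1)] by (auto simp: Hom_def)
  obtain i where k: "kernel_of C f i"
    using kernels fA(1) by blast
  then have i: "i \<in> Hom C (Dom C i) X" and fi: "f \<cdot> i = arr_zero C (Dom C i) Y"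
    using fA by (auto simp: kernel_of_def Hom_def)
  have iA: "i \<in> Arr C" "Cod C i = X"
    using i by (auto simp: Hom_def)
  have "mono_arrow C i"
    unfolding mono_arrow_def using kernel_mono[OF k] iA by blast
  then have "zero_object C (Dom C i) \<or> iso_arrow C i"
    using X iA by (auto simp: simple_object_def)
  moreover have "\<not> iso_arrow C i"
  proof
    assume iso: "iso_arrow C i"
    have j: "inverse_of C i \<in> Hom C X (Dom C i)"
      using inverse_of_iso[OF iso] iA by (simp add: Hom_def)
    have "f = f \<cdot> (i \<cdot> inverse_of C i)"
      using inverse_of_iso(5)[OF iso] iA Ide_right[OF f(1)] by simp
    also have "\<dots> = (f \<cdot> i) \<cdot> inverse_of C i"
      by (rule Comp_assoc[OF j i f(1), symmetric])
    also have "\<dots> = arr_zero C X Y"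
      using zero_Comp(1)[OF j o(2)] fi by simp
    finally show False
      using f(2) by simp
  qed
  ultimately have Z: "zero_object C (Dom C i)"
    by simp
  have "mono_arrow C f"
    unfolding mono_arrow_def
  proof (intro conjI allI ballI impI)
    fix W g h assume g: "g \<in> Hom C W (Dom C f)" and h: "h \<in> Hom C W (Dom C f)" and eq: "f \<cdot> g = f \<cdot> h"
    have gX: "g \<in> Hom C W X" "h \<in> Hom C W X"
      using g h fA by auto
    have W: "W \<in> Obj C"
      using Hom_Obj(1)[OF g] .
    obtain d where d: "d \<in> Hom C W X" "d \<oplus>\<^sub>m h = g"
      by (rule obtain_difference[OF gX])
    have "f \<cdot> d \<oplus>\<^sub>m f \<cdot> h = f \<cdot> h"
      using Comp_add_right[OF d(1) gX(2) f(1)] d(2) eq by simp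
    then have "f \<cdot> d = arr_zero C W Y"
      by (rule arr_add_eq_right[OF Comp_Hom[OF d(1) f(1)] Comp_Hom[OF gX(2) f(1)]])
    then obtain u where u: "u \<in> Hom C W (Dom C i)" "i \<cdot> u = d"
      using k d(1) fA unfolding kernel_of_def by blast
    have "u = arr_zero C W (Dom C i)"
      using Z W u(1) arr_zero_Hom[OF W Hom_Obj(1)[OF i]] by (auto simp: zero_object_def)
    then have "d = arr_zero C W X"
      using u(2) zero_Comp(2)[OF i W] by simp
    then show "g = h"
      using d(2) arr_zero_add[OF gX(2)] by simp
  qed (fact fA)
  then have "zero_object C X \<or> iso_arrow C f"
    using Y fA by (auto simp: simple_object_def)
  then show ?thesis
    using X by (simp add: simple_object_def)
qed

end

lemma full_subcategory_sel:
  "Obj (full_subcategory C D) = D"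
  "Arr (full_subcategory C D) = {f \<in> Arr C. Dom C f \<in> D \<and> Cod C f \<in> D}"
  "Dom (full_subcategory C D) = Dom C" "Cod (full_subcategory C D) = Cod C"
  "Ide (full_subcategory C D) = Ide C" "Comp (full_subcategory C D) = Comp C"
  by (simp_all add: full_subcategory_def)

lemma full_subcategory_arr_zero: "arr_zero (full_subcategory C D) = arr_zero C"
  by (simp add: full_subcategory_def)

lemma Hom_full_subcategory:
  "Hom (full_subcategory C D) X Y = (if X \<in> D \<and> Y \<in> D then Hom C X Y else {})"
  by (auto simp: Hom_def full_subcategory_sel)

lemma iso_full_subcategory: "iso_arrow (full_subcategory C D) f \<Longrightarrow> iso_arrow C f"
  by (auto simp: iso_arrow_def inverse_arrows_def full_subcategory_sel Hom_full_subcategory split: if_splits)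

context scalar_semisimple_coend
begin

lemma Ide_simple_nonzero:
  assumes "N \<in> L"
  shows "Ide C N \<noteq> arr_zero C N N"
proof
  assume "Ide C N = arr_zero C N N"
  then have "\<one>\<^bsub>K\<^esub> \<odot>\<^sub>m Ide C N = \<zero>\<^bsub>K\<^esub> \<odot>\<^sub>m Ide C N"
    using arr_smult_one[of N N "Ide C N"] arr_smult_null[of N N "Ide C N"] assms by (simp add: arr_zero_Hom L_Obj)
  then have "\<one>\<^bsub>K\<^esub> = \<zero>\<^bsub>K\<^esub>"
    by (rule smult_Ide_inject[OF scalar_L[OF assms] one_closed zero_closed])
  then show False
    by simp
qed

lemma nonzero_endo_invertible:
  assumes N: "N \<in> L" and f: "f \<in> Hom C N N" "f \<noteq> arr_zero C N N"
  obtains a where "a \<in> carrier K" "a \<odot>\<^sub>m f = Ide C N"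
proof -
  have I: "Ide C N \<in> Hom C N N" and [simp]: "N \<in> Obj C"
    using N by (simp_all add: Ide_Hom L_Obj)
  obtain c where c: "c \<in> carrier K" "f = c \<odot>\<^sub>m Ide C N"
    by (rule scalar_obtain[OF scalar_L[OF N] f(1)])
  have "c \<noteq> \<zero>\<^bsub>K\<^esub>"
    using f(2) c(2) arr_smult_null[OF _ _ I] by auto
  then have u: "c \<in> Units K"
    using c(1) field_Units by simp
  have "inv\<^bsub>K\<^esub> c \<odot>\<^sub>m f = (inv\<^bsub>K\<^esub> c \<otimes>\<^bsub>K\<^esub> c) \<odot>\<^sub>m Ide C N"
    using c arr_smult_smult[OF _ _ Units_inv_closed[OF u] c(1) I] by simp
  also have "\<dots> = Ide C N"
    using Units_l_inv[OF u] arr_smult_one[OF _ _ I] by simp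
  finally show thesis
    by (rule that[OF Units_inv_closed[OF u]])
qed

lemma simple_quotient_splits:
  assumes N: "N \<in> L" and f: "f \<in> Hom C Z N" "f \<noteq> arr_zero C Z N"
  obtains s where "s \<in> Hom C N Z" "f \<cdot> s = Ide C N"
proof -
  note o = Hom_Obj[OF f(1)]
  obtain n :: nat and T p' q' where T: "\<forall>k<n. T k \<in> L" and ds: "direct_sum C {..<n} T Z p' q'"
    by (rule decomposition[OF o(1)])
  have q': "q' k \<in> Hom C (T k) Z" if "k < n" for k
    using ds that by (auto simp: direct_sum_def)
  have "\<exists>k<n. f \<cdot> q' k \<noteq> arr_zero C (T k) N"
  proof (rule ccontr)
    assume "\<not> ?thesis"
    then have "f \<cdot> q' k = arr_zero C Z N \<cdot> q' k" if "k \<in> {..<n}" for k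
      using that zero_Comp(1)[OF q' o(2)] by simp
    then have "f = arr_zero C Z N"
      by (rule direct_sum_ext[OF ds f(1) arr_zero_Hom[OF o]])
    then show False
      using f(2) by simp
  qed
  then obtain k where k: "k < n" and nz: "f \<cdot> q' k \<noteq> arr_zero C (T k) N"
    by blast
  have fq: "f \<cdot> q' k \<in> Hom C (T k) N"
    by (rule Comp_Hom[OF q'[OF k] f(1)])
  have TN: "T k = N"
    using schur[OF _ N _ fq] T k nz by blast
  obtain a where a: "a \<in> carrier K" "a \<odot>\<^sub>m (f \<cdot> q' k) = Ide C N"
    by (rule nonzero_endo_invertible[OF N]) (use fq nz TN in auto)
  show thesis
  proof (rule that[of "a \<odot>\<^sub>m q' k"])
    show "a \<odot>\<^sub>m q' k \<in> Hom C N Z"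
      using arr_smult_Hom[OF o(2,1) a(1)] q'[OF k] TN by simp
    show "f \<cdot> (a \<odot>\<^sub>m q' k) = Ide C N"
      using Comp_smult_right[OF a(1) q'[OF k] f(1)] a(2) by simp
  qed
qed

lemma simple_sub_splits:
  assumes N: "N \<in> L" and g: "g \<in> Hom C N Z" "g \<noteq> arr_zero C N Z"
  obtains r where "r \<in> Hom C Z N" "r \<cdot> g = Ide C N"
proof -
  note o = Hom_Obj[OF g(1)]
  obtain n :: nat and T p' q' where T: "\<forall>k<n. T k \<in> L" and ds: "direct_sum C {..<n} T Z p' q'"
    by (rule decomposition[OF o(2)])
  have p': "p' k \<in> Hom C Z (T k)" if "k < n" for k
    using ds that by (auto simp: direct_sum_def)
  have "\<exists>k<n. p' k \<cdot> g \<noteq> arr_zero C N (T k)"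
  proof (rule ccontr)
    assume "\<not> ?thesis"
    then have "p' k \<cdot> g = p' k \<cdot> arr_zero C N Z" if "k \<in> {..<n}" for k
      using that zero_Comp(2)[OF p' o(1)] by simp
    then have "g = arr_zero C N Z"
      by (rule direct_sum_ext_left[OF ds g(1) arr_zero_Hom[OF o]])
    then show False
      using g(2) by simp
  qed
  then obtain k where k: "k < n" and nz: "p' k \<cdot> g \<noteq> arr_zero C N (T k)"
    by blast
  have pg: "p' k \<cdot> g \<in> Hom C N (T k)"
    by (rule Comp_Hom[OF g(1) p'[OF k]])
  have TN: "T k = N"
    using schur[OF N _ _ pg] T k nz by metis
  obtain a where a: "a \<in> carrier K" "a \<odot>\<^sub>m (p' k \<cdot> g) = Ide C N"
    by (rule nonzero_endo_invertible[OF N]) (use pg nz TN in auto)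
  show thesis
  proof (rule that[of "a \<odot>\<^sub>m p' k"])
    show "a \<odot>\<^sub>m p' k \<in> Hom C Z N"
      using arr_smult_Hom[OF o(2,1) a(1)] p'[OF k] TN by simp
    show "(a \<odot>\<^sub>m p' k) \<cdot> g = Ide C N"
      using Comp_smult_left[OF a(1) g(1) p'[OF k]] a(2) by simp
  qed
qed

text \<open>
  A nonzero projection of the dual to a simple object has a section. The composite in the other order is an
  endomorphism of the dual, hence a scalar by \<open>dual_arr_full\<close>, and the scalar is one.
\<close>

lemma dual_simple_iso:
  assumes l: "l \<in> L"
  obtains N u v where "N \<in> L" "u \<in> Hom C (dual_obj C l) N" "v \<in> Hom C N (dual_obj C l)"
    "u \<cdot> v = Ide C N" "v \<cdot> u = Ide C (dual_obj C l)"
proof -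
  let ?l = "dual_obj C l"
  have lo: "l \<in> Obj C" "?l \<in> Obj C"
    using l by (simp_all add: L_Obj dual_Obj)
  obtain n :: nat and T p' q' where T: "\<forall>k<n. T k \<in> L" and ds: "direct_sum C {..<n} T ?l p' q'"
    by (rule decomposition[OF lo(2)])
  have p': "p' k \<in> Hom C ?l (T k)" if "k < n" for k
    using ds that by (auto simp: direct_sum_def)
  have "\<exists>k<n. p' k \<noteq> arr_zero C ?l (T k)"
  proof (rule ccontr)
    assume "\<not> ?thesis"
    then have z: "p' k = arr_zero C ?l (T k)" if "k < n" for k
      using that by auto
    have "p' k \<cdot> Ide C ?l = p' k \<cdot> arr_zero C ?l ?l" if "k \<in> {..<n}" for k
      using that zero_Comp(2)[OF p' lo(2)] z Ide_right[OF p'] by simp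
    then have "Ide C ?l = arr_zero C ?l ?l"
      by (rule direct_sum_ext_left[OF ds Ide_Hom[OF lo(2)] arr_zero_Hom[OF lo(2,2)]])
    then show False
      using Ide_dual_nonzero[OF scalar_L[OF l]] by simp
  qed
  then obtain k where k: "k < n" and nz: "p' k \<noteq> arr_zero C ?l (T k)"
    by blast
  let ?u = "p' k" and ?N = "T k"
  have NL: "?N \<in> L"
    using T k by simp
  note u = p'[OF k]
  obtain v where v: "v \<in> Hom C ?N ?l" "?u \<cdot> v = Ide C ?N"
    by (rule simple_quotient_splits[OF NL u nz])
  have vu: "v \<cdot> ?u \<in> Hom C ?l ?l"
    by (rule Comp_Hom[OF u v(1)])
  obtain f where f: "f \<in> Hom C l l" "dual_arr C f = v \<cdot> ?u"
    by (rule dual_arr_full[of "v \<cdot> ?u" l l]) (use vu lo in \<open>auto simp: Hom_def\<close>)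
  obtain a where a: "a \<in> carrier K" "f = a \<odot>\<^sub>m Ide C l"
    by (rule scalar_obtain[OF scalar_L[OF l] f(1)])
  have vu': "v \<cdot> ?u = a \<odot>\<^sub>m Ide C ?l"
    using linear_map_smult[OF linear_dual_arr[OF lo(1,1)] a(1) Ide_Hom[OF lo(1)]] f(2) a(2) lo(1)
    by (simp add: dual_Ide)
  have "a \<odot>\<^sub>m ?u = ?u \<cdot> (v \<cdot> ?u)"
    using Comp_smult_right[OF a(1) Ide_Hom[OF lo(2)] u] Ide_right[OF u] vu' by simp
  also have "\<dots> = ?u"
    using Comp_assoc[OF u v(1) u] v(2) Ide_left[OF u] by simp
  finally have "a \<odot>\<^sub>m Ide C ?N = \<one>\<^bsub>K\<^esub> \<odot>\<^sub>m Ide C ?N"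
    using Comp_smult_left[OF a(1) v(1) u] v(2) arr_smult_one[OF _ _ Ide_Hom[OF L_Obj[OF NL]]] L_Obj[OF NL] by simp
  then have "a = \<one>\<^bsub>K\<^esub>"
    by (rule smult_Ide_inject[OF scalar_L[OF NL] a(1) one_closed])
  then have "v \<cdot> ?u = Ide C ?l"
    using vu' arr_smult_one[OF lo(2,2) Ide_Hom[OF lo(2)]] by simp
  then show thesis
    by (rule that[OF NL u v])
qed

text \<open>
  In the full subcategory the idempotent \<open>g \<cdot> f\<close> splits through the kernel of its complement, and the
  resulting object W is isomorphic to N. The point is then that W is simple in the subcategory: a monomorphism
  there need not be one in the ambient category, but a nonzero arrow into W has a section, because
  N is simple and the ambient category is semisimple, and a monomorphism with a section is
  invertible.
\<close>

lemma summand_representative: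
  assumes ab: "abelian_k_category K (full_subcategory C D)" and D: "D \<subseteq> Obj C"
    and reps: "simple_representatives (full_subcategory C D) LD"
    and N: "N \<in> L" and Z: "Z \<in> D" and f: "f \<in> Hom C Z N" and g: "g \<in> Hom C N Z" and fg: "f \<cdot> g = Ide C N"
  obtains l where "l \<in> LD" "isomorphic C N l"
proof -
  let ?F = "full_subcategory C D"
  interpret F: abelian_k_category K ?F
    by (rule ab)
  note sel = full_subcategory_sel full_subcategory_arr_zero
  note FHom = Hom_full_subcategory[of C D]
  have No: "N \<in> Obj C" and Zo: "Z \<in> Obj C"
    using Hom_Obj[OF f] by auto
  have gf: "g \<cdot> f \<in> Hom C Z Z"
    by (rule Comp_Hom[OF f g])
  have fgf: "f \<cdot> (g \<cdot> f) = f" and gfg: "(g \<cdot> f) \<cdot> g = g"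
    using Comp_assoc[OF f g f] Comp_assoc[OF g f g] fg Ide_left[OF f] Ide_right[OF g] by simp_all
  have idem: "(g \<cdot> f) \<cdot> (g \<cdot> f) = g \<cdot> f"
    using Comp_assoc[OF gf f g] fgf by simp
  \<comment> \<open>The complementary idempotent, whose kernel in the subcategory is the image of \<open>g \<cdot> f\<close>.\<close>
  obtain e where e: "e \<in> Hom C Z Z" "e \<oplus>\<^sub>m g \<cdot> f = Ide C Z"
    by (rule obtain_difference[OF Ide_Hom[OF Zo] gf])
  have eA: "e \<in> Arr ?F" "Dom C e = Z" "Cod C e = Z"
    using e(1) Z by (auto simp: Hom_def sel)
  have "g \<cdot> f = (e \<oplus>\<^sub>m g \<cdot> f) \<cdot> (g \<cdot> f)"
    using e(2) Ide_left[OF gf] by simp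
  also have "\<dots> = e \<cdot> (g \<cdot> f) \<oplus>\<^sub>m (g \<cdot> f)"
    using Comp_add_left[OF gf e(1) gf] idem by simp
  finally have egf: "e \<cdot> (g \<cdot> f) = arr_zero C Z Z"
    using arr_add_eq_right[OF Comp_Hom[OF gf e(1)] gf] by simp
  obtain i where k: "kernel_of ?F e i"
    using F.kernels eA(1) by blast
  define W where "W = Dom C i"
  have iA: "i \<in> Arr ?F" "Cod C i = Z" and ei: "e \<cdot> i = arr_zero C W Z"
    using k eA by (auto simp: kernel_of_def sel W_def)
  then have W: "W \<in> D" and i: "i \<in> Hom C W Z"
    by (auto simp: sel W_def Hom_def)
  have Wo: "W \<in> Obj C"
    using W D by blast
  have "i = (e \<oplus>\<^sub>m g \<cdot> f) \<cdot> i"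
    using e(2) Ide_left[OF i] by simp
  also have "\<dots> = (g \<cdot> f) \<cdot> i"
    using Comp_add_left[OF i e(1) gf] ei arr_zero_add[OF Comp_Hom[OF i gf]] by simp
  finally have gfi: "(g \<cdot> f) \<cdot> i = i" ..
  have "\<exists>!u. u \<in> Hom ?F Z W \<and> i \<cdot> u = g \<cdot> f"
  proof -
    have "\<forall>V. \<forall>h \<in> Hom ?F V Z. e \<cdot> h = arr_zero C V Z \<longrightarrow> (\<exists>!u. u \<in> Hom ?F V W \<and> i \<cdot> u = h)"
      using k eA by (simp add: kernel_of_def full_subcategory_sel(3-) full_subcategory_arr_zero W_def)
    moreover have "g \<cdot> f \<in> Hom ?F Z Z"
      using gf Z by (simp add: FHom)
    ultimately show ?thesis
      using egf by blast
  qed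
  then obtain u where u: "u \<in> Hom C Z W" "i \<cdot> u = g \<cdot> f"
    using Z W by (auto simp: FHom)
  have ui: "u \<cdot> i = Ide C W"
  proof (rule F.kernel_mono[OF k, of _ W, unfolded sel])
    show "u \<cdot> i \<in> Hom ?F W (Dom C i)" "Ide C W \<in> Hom ?F W (Dom C i)"
      using W Comp_Hom[OF i u(1)] Ide_Hom[OF Wo] by (simp_all add: FHom W_def)
    show "i \<cdot> (u \<cdot> i) = i \<cdot> Ide C W"
      using Comp_assoc[OF i u(1) i] u(2) gfi Ide_right[OF i] by simp
  qed
  define a where "a = f \<cdot> i"
  define b where "b = u \<cdot> g"
  have a: "a \<in> Hom C W N" and b: "b \<in> Hom C N W"
    unfolding a_def b_def by (rule Comp_Hom[OF i f] Comp_Hom[OF g u(1)])+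
  have ab: "a \<cdot> b = Ide C N"
  proof -
    have "a \<cdot> b = f \<cdot> (i \<cdot> (u \<cdot> g))"
      unfolding a_def b_def by (rule Comp_assoc[OF _ i f]) (rule Comp_Hom[OF g u(1)])
    also have "i \<cdot> (u \<cdot> g) = g"
      using Comp_assoc[OF g u(1) i] u(2) gfg by simp
    finally show ?thesis
      by (simp add: fg)
  qed
  have ba: "b \<cdot> a = Ide C W"
  proof -
    have "b \<cdot> a = u \<cdot> (g \<cdot> (f \<cdot> i))"
      unfolding a_def b_def by (rule Comp_assoc[OF _ g u(1)]) (rule Comp_Hom[OF i f])
    also have "g \<cdot> (f \<cdot> i) = i"
      using Comp_assoc[OF i f g] gfi by simp
    finally show ?thesis
      by (simp add: ui)
  qed
  have IdW: "Ide C W \<noteq> arr_zero C W W"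
  proof
    assume 0: "Ide C W = arr_zero C W W"
    have "Ide C N = a \<cdot> (Ide C W \<cdot> b)"
      using ab Ide_left[OF b] by simp
    also have "\<dots> = arr_zero C N N"
      unfolding 0 using zero_Comp(1)[OF b Wo] zero_Comp(2)[OF a No] by simp
    finally show False
      using Ide_simple_nonzero[OF N] by simp
  qed
  have "simple_object ?F W"
    unfolding simple_object_def
  proof (intro conjI allI impI)
    show "W \<in> Obj ?F"
      using W by (simp add: sel)
    show "\<not> zero_object ?F W"
    proof
      assume "zero_object ?F W"
      then have "\<exists>!h. h \<in> Hom C W W"
        using W by (auto simp: zero_object_def sel FHom)
      then show False
        using IdW Ide_Hom[OF Wo] arr_zero_Hom[OF Wo Wo] by blast
    qed
    fix m assume m: "mono_arrow ?F m \<and> Cod ?F m = W"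
    define Y where "Y = Dom C m"
    have Y: "Y \<in> D" and mH: "m \<in> Hom C Y W"
      using m by (auto simp: mono_arrow_def sel Y_def Hom_def)
    have Yo: "Y \<in> Obj C"
      using Y D by blast
    have mono: "g1 = g2" if "g1 \<in> Hom C V Y" "g2 \<in> Hom C V Y" "V \<in> D" "m \<cdot> g1 = m \<cdot> g2" for g1 g2 V
    proof -
      have "\<forall>V. \<forall>g \<in> Hom ?F V Y. \<forall>h \<in> Hom ?F V Y. m \<cdot> g = m \<cdot> h \<longrightarrow> g = h"
        using m by (simp add: mono_arrow_def full_subcategory_sel(3-) Y_def)
      moreover have "g1 \<in> Hom ?F V Y" "g2 \<in> Hom ?F V Y"
        using that Y by (simp_all add: FHom)
      ultimately show ?thesis
        using that(4) by blast
    qed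
    show "zero_object ?F (Dom ?F m) \<or> iso_arrow ?F m"
    proof (cases "m = arr_zero C Y W")
      case True
      have "m \<cdot> Ide C Y = m \<cdot> arr_zero C Y Y"
        using zero_Comp(2)[OF mH Yo] Ide_right[OF mH] True by simp
      then have 0: "Ide C Y = arr_zero C Y Y"
        by (rule mono[OF Ide_Hom[OF Yo] arr_zero_Hom[OF Yo Yo] Y])
      have from_Y: "h = arr_zero C Y V" if "h \<in> Hom C Y V" for h V
        using that zero_Comp(2)[OF that Yo] Ide_right[OF that] 0 by simp
      have to_Y: "h = arr_zero C V Y" if "h \<in> Hom C V Y" for h V
        using that zero_Comp(1)[OF that Yo] Ide_left[OF that] 0 by simp
      have "zero_object ?F Y"
        unfolding zero_object_def sel
      proof (intro conjI ballI)
        fix V assume V: "V \<in> D"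
        then have Vo: "V \<in> Obj C"
          using D by blast
        show "\<exists>!h. h \<in> Hom ?F Y V"
          by (rule ex1I[of _ "arr_zero C Y V"]) (use V Y Vo Yo from_Y in \<open>simp_all add: FHom arr_zero_Hom\<close>)
        show "\<exists>!h. h \<in> Hom ?F V Y"
          by (rule ex1I[of _ "arr_zero C V Y"]) (use V Y Vo Yo to_Y in \<open>simp_all add: FHom arr_zero_Hom\<close>)
      qed (fact Y)
      then show ?thesis
        by (simp add: sel Y_def)
    next
      case False
      have am: "a \<cdot> m \<in> Hom C Y N"
        by (rule Comp_Hom[OF mH a])
      have bam: "b \<cdot> (a \<cdot> m) = m"
        using Comp_assoc[OF mH a b] ba Ide_left[OF mH] by simp
      have "a \<cdot> m \<noteq> arr_zero C Y N"
        using False bam zero_Comp(2)[OF b Yo] by auto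
      then obtain s where s: "s \<in> Hom C N Y" "(a \<cdot> m) \<cdot> s = Ide C N"
        by (rule simple_quotient_splits[OF N am])
      define v where "v = s \<cdot> a"
      have v: "v \<in> Hom C W Y"
        unfolding v_def by (rule Comp_Hom[OF a s(1)])
      have ms: "m \<cdot> s = b"
        using Comp_assoc[OF s(1) am b] s(2) bam Ide_right[OF b] by simp
      have mv: "m \<cdot> v = Ide C W"
        unfolding v_def using Comp_assoc[OF a s(1) mH] ms ba by simp
      have vm: "v \<cdot> m = Ide C Y"
      proof (rule mono[OF Comp_Hom[OF mH v] Ide_Hom[OF Yo] Y])
        show "m \<cdot> (v \<cdot> m) = m \<cdot> Ide C Y"
          using Comp_assoc[OF mH v mH] mv Ide_left[OF mH] Ide_right[OF mH] by simp
      qed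
      have "inverse_arrows ?F m v"
        using mv vm v mH Y W by (auto simp: inverse_arrows_def sel FHom Hom_def)
      then show ?thesis
        by (auto simp: iso_arrow_def)
    qed
  qed
  then obtain l where l: "l \<in> LD" "isomorphic ?F W l"
    using reps by (auto simp: simple_representatives_def)
  then obtain x where x: "x \<in> Hom C W l" "iso_arrow C x"
    by (auto simp: isomorphic_def FHom split: if_splits dest: iso_full_subcategory)
  obtain y where y: "y \<in> Hom C l W" "y \<cdot> x = Ide C W" "x \<cdot> y = Ide C l"
    using x by (auto simp: iso_arrow_def inverse_arrows_def Hom_def)
  have "inverse_arrows C (x \<cdot> b) (a \<cdot> y)"
  proof -
    have xb: "x \<cdot> b \<in> Hom C N l" and ay: "a \<cdot> y \<in> Hom C l N"
      by (rule Comp_Hom[OF b x(1)] Comp_Hom[OF y(1) a])+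
    have "(a \<cdot> y) \<cdot> (x \<cdot> b) = a \<cdot> ((y \<cdot> x) \<cdot> b)"
      using Comp_assoc[OF xb y(1) a] Comp_assoc[OF b x(1) y(1)] by simp
    then have 1: "(a \<cdot> y) \<cdot> (x \<cdot> b) = Ide C N"
      using y(2) Ide_left[OF b] ab by simp
    have "(x \<cdot> b) \<cdot> (a \<cdot> y) = x \<cdot> ((b \<cdot> a) \<cdot> y)"
      using Comp_assoc[OF ay b x(1)] Comp_assoc[OF y(1) a b] by simp
    then have "(x \<cdot> b) \<cdot> (a \<cdot> y) = Ide C l"
      using ba Ide_left[OF y(1)] y(3) by simp
    then show ?thesis
      using 1 xb ay by (auto simp: inverse_arrows_def Hom_def)
  qed
  then have "isomorphic C N l"
    using Comp_Hom[OF b x(1)] by (auto simp: isomorphic_def iso_arrow_def)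
  then show thesis
    by (rule that[OF l(1)])
qed

end

section \<open>Kirby elements of full ribbon subcategories\<close>

theorem theorem3p4:
  fixes K :: "('k, 'r) ring_scheme"
    and \<B> :: "('k, 'o, 'm, 'z) ribbon_category_scheme"
    and \<Lambda> \<Lambda>\<^sub>D D :: "'o set"
    and B :: 'o
    and p q j e :: "'o \<Rightarrow> 'm"
  assumes "ribbon_k_category K \<B>"
    and "finitely_semisimple_k_category K \<B>"
    and "\<And>X. simple_object \<B> X \<Longrightarrow> scalar_object K \<B> X"
    and "simple_representatives \<B> \<Lambda>" and "tunit \<B> \<in> \<Lambda>"
    and "semisimple_coend \<B> \<Lambda> B p q j"
    and "\<And>l. l \<in> \<Lambda> \<Longrightarrow> e l = j l \<cdot>\<^bsub>\<B>\<^esub> coev_r \<B> l"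
    and "full_ribbon_abelian_subcategory K \<B> D"
    and "simple_representatives (full_subcategory \<B> D) \<Lambda>\<^sub>D" and "\<Lambda>\<^sub>D \<subseteq> \<Lambda>"
  shows "(\<Oplus>\<^bsub>Hom_module \<B> (tunit \<B>) B\<^esub>l \<in> \<Lambda>\<^sub>D. dim_q K \<B> l \<odot>\<^sub>m\<^bsub>\<B>\<^esub> e l) \<in> I_set K \<B> B j"
proof -
  interpret R: ribbon_k_category K \<B>
    by (rule assms(1))
  interpret S: finitely_semisimple_k_category K \<B>
    by (rule assms(2))
  have simple: "simple_object \<B> l" if "l \<in> \<Lambda>" for l
    using assms(4) that by (simp add: simple_representatives_def)
  have unique: "l = m" if "l \<in> \<Lambda>" "m \<in> \<Lambda>" "isomorphic \<B> l m" for l m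
  proof -
    have "isomorphic \<B> l l"
    proof -
      have o: "l \<in> Obj \<B>"
        using simple[OF that(1)] by (simp add: simple_object_def)
      have "inverse_arrows \<B> (Ide \<B> l) (Ide \<B> l)"
        using o R.Ide_Hom[OF o] R.Ide_left[OF R.Ide_Hom[OF o]] by (auto simp: inverse_arrows_def Hom_def)
      then show ?thesis
        using R.Ide_Hom[OF o] by (auto simp: isomorphic_def iso_arrow_def)
    qed
    then show ?thesis
      using assms(4) simple[OF that(1)] that by (auto simp: simple_representatives_def)
  qed
  interpret C: scalar_semisimple_coend K \<B> \<Lambda> B p q j
  proof
    show "scalar_object K \<B> l" if "l \<in> \<Lambda>" for l
      using assms(3)[OF simple[OF that]] .
    show "f = arr_zero \<B> l m" if "l \<in> \<Lambda>" "m \<in> \<Lambda>" "l \<noteq> m" "f \<in> Hom \<B> l m" for l m f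
      using S.schur_lemma[OF simple[OF that(1)] simple[OF that(2)] that(4)] unique[OF that(1,2)] that(3,4)
      by (auto simp: isomorphic_def)
    show "semisimple_coend \<B> \<Lambda> B p q j"
      by (rule assms(6))
  qed
  have D: "D \<subseteq> Obj \<B>" "\<And>X Y. \<lbrakk>X \<in> D; Y \<in> D\<rbrakk> \<Longrightarrow> X \<otimes>\<^sub>o\<^bsub>\<B>\<^esub> Y \<in> D" "\<And>X. X \<in> D \<Longrightarrow> dual_obj \<B> X \<in> D"
    and abD: "abelian_k_category K (full_subcategory \<B> D)"
    using assms(8) by (auto simp: full_ribbon_abelian_subcategory_def)
  have LD: "l \<in> D" if "l \<in> \<Lambda>\<^sub>D" for l
    using assms(9) that by (auto simp: simple_representatives_def simple_object_def full_subcategory_sel)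
  have summand: "N \<in> \<Lambda>\<^sub>D" if "N \<in> \<Lambda>" "Z \<in> D" "f \<in> Hom \<B> Z N" "g \<in> Hom \<B> N Z" "f \<cdot>\<^bsub>\<B>\<^esub> g = Ide \<B> N" for N Z f g
  proof -
    note splitting = that
    obtain l where "l \<in> \<Lambda>\<^sub>D" "isomorphic \<B> N l"
      by (rule C.summand_representative[OF abD D(1) assms(9) splitting])
    then show ?thesis
      using unique[OF that(1)] assms(10) by auto
  qed
  interpret closed_simples K \<B> \<Lambda> B p q j \<Lambda>\<^sub>D
  proof
    show "\<Lambda>\<^sub>D \<subseteq> \<Lambda>"
      by (rule assms(10))
  next
    fix M X N i
    assume *: "M \<in> \<Lambda>\<^sub>D" "X \<in> \<Lambda>\<^sub>D" "N \<in> \<Lambda>" "i \<in> Hom \<B> (M \<otimes>\<^sub>o\<^bsub>\<B>\<^esub> X) N" "i \<noteq> arr_zero \<B> (M \<otimes>\<^sub>o\<^bsub>\<B>\<^esub> X) N"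
    obtain s where "s \<in> Hom \<B> N (M \<otimes>\<^sub>o\<^bsub>\<B>\<^esub> X)" "i \<cdot>\<^bsub>\<B>\<^esub> s = Ide \<B> N"
      by (rule C.simple_quotient_splits[OF *(3-5)])
    then show "N \<in> \<Lambda>\<^sub>D"
      by (rule summand[OF *(3) D(2)[OF LD[OF *(1)] LD[OF *(2)]] *(4)])
  next
    fix N X M i
    assume *: "N \<in> \<Lambda>\<^sub>D" "X \<in> \<Lambda>\<^sub>D" "M \<in> \<Lambda>" "i \<in> Hom \<B> M (N \<otimes>\<^sub>o\<^bsub>\<B>\<^esub> dual_obj \<B> X)"
      "i \<noteq> arr_zero \<B> M (N \<otimes>\<^sub>o\<^bsub>\<B>\<^esub> dual_obj \<B> X)"
    obtain r where "r \<in> Hom \<B> (N \<otimes>\<^sub>o\<^bsub>\<B>\<^esub> dual_obj \<B> X) M" "r \<cdot>\<^bsub>\<B>\<^esub> i = Ide \<B> M"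
      by (rule C.simple_sub_splits[OF *(3-5)])
    then show "M \<in> \<Lambda>\<^sub>D"
      using summand[OF *(3) D(2)[OF LD[OF *(1)] D(3)[OF LD[OF *(2)]]]] *(4) by blast
  next
    fix l assume l: "l \<in> \<Lambda>\<^sub>D"
    then have lL: "l \<in> \<Lambda>"
      using assms(10) by blast
    obtain N u v where N: "N \<in> \<Lambda>" "u \<in> Hom \<B> (dual_obj \<B> l) N" "v \<in> Hom \<B> N (dual_obj \<B> l)"
      "u \<cdot>\<^bsub>\<B>\<^esub> v = Ide \<B> N" "v \<cdot>\<^bsub>\<B>\<^esub> u = Ide \<B> (dual_obj \<B> l)"
      by (rule C.dual_simple_iso[OF lL])
    have "N \<in> \<Lambda>\<^sub>D"
      by (rule summand[OF N(1) D(3)[OF LD[OF l]] N(2-4)])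
    moreover have "inverse_arrows \<B> u v"
      using N by (auto simp: inverse_arrows_def Hom_def)
    ultimately show "\<exists>m \<in> \<Lambda>\<^sub>D. isomorphic \<B> (dual_obj \<B> l) m"
      using N(2) by (auto simp: isomorphic_def iso_arrow_def)
  qed
  have "(\<Oplus>\<^bsub>Hom_module \<B> (tunit \<B>) B\<^esub>l \<in> \<Lambda>\<^sub>D. dim_q K \<B> l \<odot>\<^sub>m\<^bsub>\<B>\<^esub> e l) = kirby"
    unfolding kirby_def
    by (rule R.finsum_Hom_cong) (use assms(7,10) dim_loop_Hom D_rules in \<open>auto simp: C.loop_def C.cbase\<close>)
  then show ?thesis
    using kirby_in_I_set by simp
qed

end
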